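(* Let $A$ be a (Lie) conformal algebra, $M$ a conformal $A$-module, and $\mathfrak g_-=(\mathrm{Lie}\,A)_-$ the annihilation Lie algebra of $A$. There is a canonical isomorphism of complexes between the basic complex $\widetilde C^\bullet(A,M)$ and the Chevalley--Eilenberg complex $C^\bullet(\mathfrak g_-,M)$ of continuous cochains, compatible with the action of $\mathbb C[\partial]$. Consequently, the reduced complex $C^\bullet(A,M)$ is isomorphic to $C^\bullet(\mathfrak g_-,M)/\partial C^\bullet(\mathfrak g_-,M)$.
   Context: Everything is over $\mathbb C$; $\lambda^{(n)}=\lambda^n/n!$. A (Lie) conformal algebra is a $\mathbb C[\partial]$-module $A$ with a linear map $A\otimes A\to A[\lambda]$, $a\otimes b\mapsto[a_\lambda b]=\sum_{n\ge0}\lambda^{(n)}a_{(n)}b$, such that: $[(\partial a)_\lambda b]=-\lambda[a_\lambda b]$ and $[a_\lambda\,\partial b]=(\partial+\lambda)[a_\lambda b]$; $[a_\lambda b]=-[b_{-\lambda-\partial}a]$ (if $[b_\mu a]=\sum_n\mu^n c_n$ then $[b_{-\lambda-\partial}a]=\sum_n(-\lambda-\partial)^nc_n$); $[a_\lambda[b_\mu c]]=[[a_\lambda b]_{\lambda+\mu}c]+[b_\mu[a_\lambda c]]$. A conformal $A$-module is a $\mathbb C[\partial]$-module $M$ with a linear map $A\otimes M\to M[\lambda]$, $a\otimes v\mapsto a_\lambda v=\sum_n\lambda^{(n)}a_{(n)}v$, such that $a_\lambda(b_\mu v)-b_\mu(a_\lambda v)=[a_\lambda b]_{\lambda+\mu}v$,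 $(\partial a)_\lambda v=-\lambda a_\lambda v$, $a_\lambda(\partial v)=(\partial+\lambda)a_\lambda v$. Basic complex: $\widetilde C^n(A,M)$ is the space of linear maps $\gamma\colon A^{\otimes n}\to M[\lambda_1,\dots,\lambda_n]$, $a_1\otimes\dots\otimes a_n\mapsto\gamma_{\lambda_1,\dots,\lambda_n}(a_1,\dots,a_n)$, such that $\gamma_{\lambda_1,\dots,\lambda_n}(a_1,\dots,\partial a_i,\dots,a_n)=-\lambda_i\gamma_{\lambda_1,\dots,\lambda_n}(a_1,\dots,a_n)$ for all $i$, and $\gamma$ is skew-symmetric under simultaneous permutations of the $a_i$ and the $\lambda_i$ ($\widetilde C^0=M$). The differential is $$(d\gamma)_{\lambda_1,\dots,\lambda_{n+1}}(a_1,\dots,a_{n+1})=\sum_{i}(-1)^{i+1}{a_i}_{\lambda_i}\gamma_{\lambda_1,\dots,\widehat{\lambda_i},\dots,\lambda_{n+1}}(a_1,\dots,\widehat{a_i},\dots,a_{n+1})$$ $$+\sum_{i<j}(-1)^{i+j}\gamma_{\lambda_i+\lambda_j,\lambda_1,\dots,\widehat{\lambda_i},\dots,\widehat{\lambda_j},\dots,\lambda_{n+1}}([{a_i}_{\lambda_i}a_j],a_1,\dots,\widehat{a_i},\dots,\widehat{a_j},\dots,a_{n+1}),$$ with $\gamma$ extended linearly over polynomials in the $\lambda_i$. $\mathbb C[\partial]$ acts on $\widetilde C^n(A,M)$ by $(\partial\gamma)_{\lambda_1,\dots,\lambda_n}=(\partial_M+\sum_i\lambda_i)\gamma_{\lambda_1,\dots,\lambda_n}$,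 where $\partial_M$ is the action of $\partial$ on $M$; this commutes with $d$. The reduced complex is $C^\bullet(A,M)=\widetilde C^\bullet(A,M)/\partial\widetilde C^\bullet(A,M)$. Annihilation algebra: $\mathrm{Lie}\,A=A[t,t^{-1}]/(\partial+\partial_t)A[t,t^{-1}]$, with $a_n$ the image of $at^n$, is a Lie algebra with bracket $[a_m,b_n]=\sum_{j\ge0}\binom mj(a_{(j)}b)_{m+n-j}$. $(\mathrm{Lie}\,A)_-$ is the Lie subalgebra spanned by all $a_n$, $a\in A$, $n\ge0$; equivalently $(\mathrm{Lie}\,A)_-=A[t]/(\partial+\partial_t)A[t]$. $\partial$ acts on it by $\partial(a_n)=(\partial a)_n=-n\,a_{n-1}$. $M$ is a $\mathfrak g_-$-module via $a_nv=a_{(n)}v$. $C^n(\mathfrak g_-,M)$ is the space of skew-symmetric linear maps $\gamma\colon\mathfrak g_-^{\otimes n}\to M$ that are continuous: for any $a_1,\dots,a_n\in A$, $\gamma({a_1}_{m_1}\otimes\dots\otimes{a_n}_{m_n})=0$ for all but finitely many $(m_1,\dots,m_n)\in\mathbb Z_+^n$; it carries the usual Chevalley--Eilenberg differential. $\mathbb C[\partial]$ acts on it by $(\partial\gamma)(x_1\otimes\dots\otimes x_n)=\partial(\gamma(x_1\otimes\dots\otimes x_n))-\sum_i\gamma(x_1\otimes\dots\otimes\partial x_i\otimes\dots\otimes x_n)$, $x_i\in\mathfrak g_-$. *)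

theory Defs
  imports
    Complex_Main
    "HOL-Library.Poly_Mapping"
    "HOL-Combinatorics.Permutations"
    "HOL-Algebra.AbelCoset"
    "HOL-Algebra.Module"
begin

section \<open>Complex vector spaces and modules over \<open>\<complex>[\<partial>]\<close>\<close>

class complex_vector = ab_group_add +
  fixes scaleC :: "complex \<Rightarrow> 'a \<Rightarrow> 'a" (infixr "*\<^sub>C" 75)
  assumes scaleC_add_right: "c *\<^sub>C (x + y) = c *\<^sub>C x + c *\<^sub>C y"
    and scaleC_add_left: "(c + c') *\<^sub>C x = c *\<^sub>C x + c' *\<^sub>C x"
    and scaleC_scaleC [simp]: "c *\<^sub>C c' *\<^sub>C x = (c * c') *\<^sub>C x"
    and scaleC_one [simp]: "1 *\<^sub>C x = x"

interpretation scaleC: vector_space "scaleC :: complex \<Rightarrow> 'a \<Rightarrow> 'a::complex_vector"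
  by unfold_locales (rule scaleC_add_right scaleC_add_left scaleC_scaleC scaleC_one)+

abbreviation clinear :: "('a::complex_vector \<Rightarrow> 'b::complex_vector) \<Rightarrow> bool"
  where "clinear \<equiv> Vector_Spaces.linear scaleC scaleC"

lemma clinearI:
  assumes "\<And>x y. f (x + y) = f x + f y" and "\<And>c x. f (c *\<^sub>C x) = c *\<^sub>C f x"
  shows "clinear f"
  using assms by unfold_locales (auto simp: scaleC_add_right scaleC_add_left)

class del_module = complex_vector +
  fixes del :: "'a \<Rightarrow> 'a" ("\<partial>")
  assumes del_add: "\<partial> (x + y) = \<partial> x + \<partial> y"
    and del_scaleC: "\<partial> (c *\<^sub>C x) = c *\<^sub>C \<partial> x"

lemma clinear_del: "clinear (\<partial> :: 'a \<Rightarrow> 'a::del_module)"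
  by (rule clinearI) (rule del_add del_scaleC)+

lemma del_0 [simp]: "\<partial> (0 :: 'a::del_module) = 0"
  using del_add[of 0 "0::'a"] by simp

lemma del_minus: "\<partial> (- x :: 'a::del_module) = - \<partial> x"
  using del_add[of x "- x"] by (simp add: add_eq_0_iff)

lemma del_diff: "\<partial> (x - y :: 'a::del_module) = \<partial> x - \<partial> y"
  using del_add[of x "- y"] by (simp add: del_minus)


section \<open>Polynomials with coefficients in a vector space\<close>

instantiation poly_mapping :: (type, complex_vector) complex_vector
begin
definition "c *\<^sub>C p = Poly_Mapping.map (scaleC c) p"
lemma lookup_scaleC [simp]:
  "Poly_Mapping.lookup (c *\<^sub>C p) k = c *\<^sub>C Poly_Mapping.lookup p k"
  by (simp add: scaleC_poly_mapping_def Poly_Mapping.map.rep_eq when_def)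
instance
  by standard
    (rule poly_mapping_eqI; simp add: lookup_add scaleC_add_right scaleC_add_left)+
end

text \<open>The action of \<open>\<partial>\<close> on \<open>M[\<lambda>\<^sub>1,\<dots>,\<lambda>\<^sub>n]\<close> and on \<open>A[t]\<close> is the coefficientwise one.\<close>

instantiation poly_mapping :: (type, del_module) del_module
begin
definition "\<partial> p = Poly_Mapping.map \<partial> p"
lemma lookup_del [simp]:
  "Poly_Mapping.lookup (\<partial> p) k = \<partial> (Poly_Mapping.lookup p k)"
  by (simp add: del_poly_mapping_def Poly_Mapping.map.rep_eq when_def)
instance
  by standard (rule poly_mapping_eqI; simp add: lookup_add del_add del_scaleC)+
end

text \<open>
  \<open>V[\<lambda>]\<close> is rendered as \<open>nat \<Rightarrow>\<^sub>0 'v\<close>. A polynomial in \<open>\<lambda>\<^sub>0, \<lambda>\<^sub>1, \<dots>\<close> is a finitely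
  supported function on exponents, and an exponent is a finitely supported function
  from variable indices to \<open>\<nat>\<close>; \<open>V[\<lambda>\<^sub>1,\<dots>,\<lambda>\<^sub>n]\<close> consists of the polynomials in
  which only the variables with index \<open>< n\<close> occur (so all indices are shifted by one).
\<close>

type_synonym 'v mpol = "(nat \<Rightarrow>\<^sub>0 nat) \<Rightarrow>\<^sub>0 'v"

abbreviation const :: "'v \<Rightarrow> 'v::zero mpol"
  where "const \<equiv> Poly_Mapping.single 0"

definition Var :: "nat \<Rightarrow> complex mpol"
  where "Var i = Poly_Mapping.single (Poly_Mapping.single i 1) 1"

definition vars_below :: "nat \<Rightarrow> 'v::zero mpol \<Rightarrow> bool"
  where "vars_below n p \<longleftrightarrow> (\<forall>k \<in> Poly_Mapping.keys p. Poly_Mapping.keys k \<subseteq> {..<n})"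

definition pmult :: "('k::comm_monoid_add \<Rightarrow>\<^sub>0 complex) \<Rightarrow> ('k \<Rightarrow>\<^sub>0 'v::complex_vector) \<Rightarrow> ('k \<Rightarrow>\<^sub>0 'v)"
    (infixr "\<cdot>" 75)
  where "P \<cdot> p = (\<Sum>k \<in> Poly_Mapping.keys P. \<Sum>l \<in> Poly_Mapping.keys p.
    Poly_Mapping.single (k + l) (Poly_Mapping.lookup P k *\<^sub>C Poly_Mapping.lookup p l))"

definition psubst :: "(nat \<Rightarrow> complex mpol) \<Rightarrow> 'v::complex_vector mpol \<Rightarrow> 'v mpol"
  where "psubst \<sigma> p = (\<Sum>k \<in> Poly_Mapping.keys p.
    (\<Prod>i \<in> Poly_Mapping.keys k. \<sigma> i ^ Poly_Mapping.lookup k i) \<cdot> const (Poly_Mapping.lookup p k))"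

text \<open>
  For \<open>f a v = a\<^sub>\<lambda>v\<close>, the term \<open>lam f q P V\<close> is \<open>P\<^sub>q V\<close>: the substitution \<open>\<lambda> = q\<close>,
  extended bilinearly over polynomials to \<open>P \<in> A[\<lambda>\<^sub>1,\<dots>]\<close> and \<open>V \<in> M[\<lambda>\<^sub>1,\<dots>]\<close>.
\<close>

definition lam :: "('a::complex_vector \<Rightarrow> 'm::complex_vector \<Rightarrow> (nat \<Rightarrow>\<^sub>0 'm))
    \<Rightarrow> complex mpol \<Rightarrow> 'a mpol \<Rightarrow> 'm mpol \<Rightarrow> 'm mpol"
  where "lam f q P V = (\<Sum>k \<in> Poly_Mapping.keys P. \<Sum>l \<in> Poly_Mapping.keys V.
    let p = f (Poly_Mapping.lookup P k) (Poly_Mapping.lookup V l) in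
    \<Sum>n \<in> Poly_Mapping.keys p.
      (Poly_Mapping.single (k + l) 1 * q ^ n) \<cdot> const (Poly_Mapping.lookup p n))"


section \<open>Conformal algebras and modules\<close>

locale lie_conformal_algebra =
  fixes br :: "'a::del_module \<Rightarrow> 'a \<Rightarrow> (nat \<Rightarrow>\<^sub>0 'a)"
  assumes br_linear_left: "clinear (\<lambda>a. br a b)"
    and br_linear_right: "clinear (br a)"
    and br_del_left: "br (\<partial> a) b = - (Poly_Mapping.single 1 1 \<cdot> br a b)"
    and br_del_right: "br a (\<partial> b) = \<partial> (br a b) + Poly_Mapping.single 1 1 \<cdot> br a b"
    and br_skew: "br a b = - (\<Sum>n \<in> Poly_Mapping.keys (br b a).
      ((\<lambda>p. - (Poly_Mapping.single 1 1 \<cdot> p) - \<partial> p) ^^ n)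
        (Poly_Mapping.single 0 (Poly_Mapping.lookup (br b a) n)))"
    and br_jacobi: "lam br (Var 0) (const a) (lam br (Var 1) (const b) (const c)) =
      lam br (Var 0 + Var 1) (lam br (Var 0) (const a) (const b)) (const c) +
      lam br (Var 1) (const b) (lam br (Var 0) (const a) (const c))"

locale conformal_module = lie_conformal_algebra br
  for br :: "'a::del_module \<Rightarrow> 'a \<Rightarrow> (nat \<Rightarrow>\<^sub>0 'a)" +
  fixes act :: "'a \<Rightarrow> 'm::del_module \<Rightarrow> (nat \<Rightarrow>\<^sub>0 'm)"
  assumes act_linear_left: "clinear (\<lambda>a. act a v)"
    and act_linear_right: "clinear (act a)"
    and act_act: "lam act (Var 0) (const a) (lam act (Var 1) (const b) (const v)) -
      lam act (Var 1) (const b) (lam act (Var 0) (const a) (const v)) =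
      lam act (Var 0 + Var 1) (lam br (Var 0) (const a) (const b)) (const v)"
    and act_del_left: "act (\<partial> a) v = - (Poly_Mapping.single 1 1 \<cdot> act a v)"
    and act_del_right: "act a (\<partial> v) = \<partial> (act a v) + Poly_Mapping.single 1 1 \<cdot> act a v"

text \<open>The products \<open>a\<^bsub>(n)\<^esub>v\<close>, given by \<open>a\<^sub>\<lambda>v = \<Sum>\<^sub>n (\<lambda>\<^sup>n / n!) a\<^bsub>(n)\<^esub>v\<close>.\<close>

definition nprod :: "('a \<Rightarrow> 'm \<Rightarrow> (nat \<Rightarrow>\<^sub>0 'm)) \<Rightarrow> nat \<Rightarrow> 'a \<Rightarrow> 'm \<Rightarrow> 'm::complex_vector"
  where "nprod f n a v = fact n *\<^sub>C Poly_Mapping.lookup (f a v) n"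


section \<open>The annihilation algebra\<close>

definition tderiv :: "(nat \<Rightarrow>\<^sub>0 'a::complex_vector) \<Rightarrow> (nat \<Rightarrow>\<^sub>0 'a)"
  where "tderiv p = (\<Sum>n \<in> Poly_Mapping.keys p.
    Poly_Mapping.single (n - 1) (of_nat n *\<^sub>C Poly_Mapping.lookup p n))"

lemma sum_keys_superset:
  assumes "finite S" "Poly_Mapping.keys p \<subseteq> S" "\<And>k. g k 0 = 0"
  shows "(\<Sum>k \<in> Poly_Mapping.keys p. g k (Poly_Mapping.lookup p k)) =
    (\<Sum>k \<in> S. g k (Poly_Mapping.lookup p k))"
  by (rule sum.mono_neutral_left) (use assms in \<open>auto simp: in_keys_iff\<close>)

lemma sum_keys_add:
  fixes g :: "'k \<Rightarrow> 'v::ab_group_add \<Rightarrow> 'w::ab_group_add"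
  assumes g: "\<And>k x y. g k (x + y) = g k x + g k y"
  shows "(\<Sum>k \<in> Poly_Mapping.keys (p + q). g k (Poly_Mapping.lookup (p + q) k)) =
    (\<Sum>k \<in> Poly_Mapping.keys p. g k (Poly_Mapping.lookup p k)) +
    (\<Sum>k \<in> Poly_Mapping.keys q. g k (Poly_Mapping.lookup q k))"
proof -
  have g0: "g k 0 = 0" for k using g[of k 0 0] by simp
  let ?S = "Poly_Mapping.keys p \<union> Poly_Mapping.keys q"
  show ?thesis
    unfolding sum_keys_superset[where S = ?S and g = g and p = "p + q", simplified, OF keys_add g0]
    by (simp add: sum_keys_superset[where S = ?S and g = g] g0 lookup_add g sum.distrib)
qed

lemma sum_keys_single:
  assumes "g k 0 = 0"
  shows "(\<Sum>l \<in> Poly_Mapping.keys (Poly_Mapping.single k x).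
    g l (Poly_Mapping.lookup (Poly_Mapping.single k x) l)) = g k x"
  using assms by (cases "x = 0") auto

lemma poly_single_induct [case_names single add]:
  assumes single: "\<And>k x. P (Poly_Mapping.single k x)"
    and add: "\<And>p q. P p \<Longrightarrow> P q \<Longrightarrow> P (p + q)"
  shows "P (p :: 'k \<Rightarrow>\<^sub>0 'v::ab_group_add)"
proof -
  have "P (\<Sum>k\<in>S. Poly_Mapping.single k (Poly_Mapping.lookup p k))" if "finite S" for S
    using that
  proof (induction S rule: finite_induct)
    case empty
    show ?case using single[of undefined 0] by simp
  qed (simp add: assms)
  moreover have "(\<Sum>k\<in>Poly_Mapping.keys p. Poly_Mapping.single k (Poly_Mapping.lookup p k)) = p"
    by (rule poly_mapping_eqI) (simp add: lookup_sum lookup_single when_def in_keys_iff)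
  ultimately show ?thesis by (metis finite_keys)
qed

lemma tderiv_add: "tderiv (p + q) = tderiv p + tderiv q"
  unfolding tderiv_def
  by (rule sum_keys_add) (simp add: scaleC_add_right single_add)

lemma tderiv_single: "tderiv (Poly_Mapping.single n a) = Poly_Mapping.single (n - 1) (of_nat n *\<^sub>C a)"
  unfolding tderiv_def by (rule sum_keys_single) simp

lemma lookup_tderiv: "Poly_Mapping.lookup (tderiv p) n = of_nat (Suc n) *\<^sub>C Poly_Mapping.lookup p (Suc n)"
proof -
  have "(of_nat k *\<^sub>C Poly_Mapping.lookup p k when k - 1 = n) =
      (if k = Suc n then of_nat (Suc n) *\<^sub>C Poly_Mapping.lookup p (Suc n) else 0)" for k
    by (cases k) (auto simp: when_def)
  thus ?thesis
    by (auto simp: tderiv_def lookup_sum lookup_single in_keys_iff)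
qed

lemma tderiv_scaleC: "tderiv (c *\<^sub>C p) = c *\<^sub>C tderiv p"
  by (rule poly_mapping_eqI) (simp add: lookup_tderiv mult.commute)

lemma tderiv_del: "tderiv (\<partial> p) = \<partial> (tderiv p)"
  by (rule poly_mapping_eqI) (simp add: lookup_tderiv del_scaleC)

definition total_deriv :: "(nat \<Rightarrow>\<^sub>0 'a::del_module) \<Rightarrow> (nat \<Rightarrow>\<^sub>0 'a)"
  where "total_deriv p = \<partial> p + tderiv p"

lemma total_deriv_add: "total_deriv (p + q) = total_deriv p + total_deriv q"
  by (simp add: total_deriv_def del_add tderiv_add)

lemma total_deriv_scaleC: "total_deriv (c *\<^sub>C p) = c *\<^sub>C total_deriv p"
  by (simp add: total_deriv_def del_scaleC tderiv_scaleC scaleC_add_right)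

lemma total_deriv_del: "total_deriv (\<partial> p) = \<partial> (total_deriv p)"
  by (simp add: total_deriv_def del_add tderiv_del)

lemma total_deriv_0: "total_deriv 0 = 0"
  using total_deriv_add[of 0 0] by simp

lemma total_deriv_minus: "total_deriv (- p) = - total_deriv p"
  using total_deriv_add[of p "- p"] by (simp add: add_eq_0_iff total_deriv_0)

text \<open>\<open>'a annih\<close> is \<open>(Lie A)\<^sub>- = A[t]/(\<partial> + \<partial>\<^sub>t)A[t]\<close> as a module over \<open>\<complex>[\<partial>]\<close>.\<close>

definition annih_rel :: "(nat \<Rightarrow>\<^sub>0 'a::del_module) \<Rightarrow> (nat \<Rightarrow>\<^sub>0 'a) \<Rightarrow> bool"
  where "annih_rel p q \<longleftrightarrow> (\<exists>r. p - q = total_deriv r)"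

lemma annih_rel_equivp: "equivp (annih_rel :: (nat \<Rightarrow>\<^sub>0 'a::del_module) \<Rightarrow> _)"
proof (rule equivpI)
  show "reflp annih_rel"
    by (rule reflpI) (metis annih_rel_def diff_self total_deriv_0)
  show "symp annih_rel"
    by (rule sympI) (metis annih_rel_def minus_diff_eq total_deriv_minus)
  show "transp (annih_rel :: (nat \<Rightarrow>\<^sub>0 'a) \<Rightarrow> _)"
  proof (rule transpI)
    fix p q r :: "nat \<Rightarrow>\<^sub>0 'a"
    assume "annih_rel p q" "annih_rel q r"
    then obtain s s' where "p - q = total_deriv s" "q - r = total_deriv s'"
      unfolding annih_rel_def by blast
    hence "p - r = total_deriv (s + s')"
      by (simp add: total_deriv_add diff_add_eq algebra_simps)
    thus "annih_rel p r" unfolding annih_rel_def by blast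
  qed
qed

quotient_type (overloaded) 'a annih = "nat \<Rightarrow>\<^sub>0 'a::del_module" / annih_rel
  by (rule annih_rel_equivp)

instantiation annih :: (del_module) del_module
begin
lift_definition zero_annih :: "'a annih" is 0 .
lift_definition plus_annih :: "'a annih \<Rightarrow> 'a annih \<Rightarrow> 'a annih" is "(+)"
  unfolding annih_rel_def by (metis add_diff_add total_deriv_add)
lift_definition uminus_annih :: "'a annih \<Rightarrow> 'a annih" is "uminus"
  unfolding annih_rel_def by (metis minus_diff_minus total_deriv_minus)
lift_definition minus_annih :: "'a annih \<Rightarrow> 'a annih \<Rightarrow> 'a annih" is "(-)"
proof -
  fix p p' q q' :: "nat \<Rightarrow>\<^sub>0 'a"
  assume "annih_rel p p'" "annih_rel q q'"
  then obtain s s' where "p - p' = total_deriv s" "q - q' = total_deriv s'"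
    unfolding annih_rel_def by blast
  hence "(p - q) - (p' - q') = total_deriv (s + - s')"
    by (simp only: total_deriv_add total_deriv_minus) (simp add: algebra_simps)
  thus "annih_rel (p - q) (p' - q')" unfolding annih_rel_def by blast
qed
lift_definition scaleC_annih :: "complex \<Rightarrow> 'a annih \<Rightarrow> 'a annih" is scaleC
  unfolding annih_rel_def by (metis scaleC.scale_right_diff_distrib total_deriv_scaleC)
lift_definition del_annih :: "'a annih \<Rightarrow> 'a annih" is \<partial>
  unfolding annih_rel_def by (metis del_diff total_deriv_del)
instance
  by standard
    (transfer; simp add: algebra_simps scaleC_add_left scaleC_add_right del_add del_scaleC
      equivp_reflp[OF annih_rel_equivp])+
end

text \<open>\<open>gen a n\<close> is \<open>a\<^sub>n\<close>, the class of \<open>a t\<^sup>n\<close>.\<close>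

lift_definition gen :: "'a::del_module \<Rightarrow> nat \<Rightarrow> 'a annih"
  is "\<lambda>a n. Poly_Mapping.single n a" .

lemma del_single: "\<partial> (Poly_Mapping.single n a) = Poly_Mapping.single n (\<partial> a)"
  by (rule poly_mapping_eqI) (simp add: lookup_single when_def)

lemma scaleC_single: "c *\<^sub>C Poly_Mapping.single n a = Poly_Mapping.single n (c *\<^sub>C a)"
  by (rule poly_mapping_eqI) (simp add: lookup_single when_def)

lemma total_deriv_single:
  "total_deriv (Poly_Mapping.single n a) =
    Poly_Mapping.single n (\<partial> a) + Poly_Mapping.single (n - 1) (of_nat n *\<^sub>C a)"
  by (simp add: total_deriv_def del_single tderiv_single)

lemma del_gen:
  "\<partial> (gen a n) = gen (\<partial> a) n"
  "\<partial> (gen a n) = - (of_nat n *\<^sub>C gen a (n - 1))"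
proof -
  show "\<partial> (gen a n) = gen (\<partial> a) n"
    by transfer (simp add: del_single equivp_reflp[OF annih_rel_equivp])
  show "\<partial> (gen a n) = - (of_nat n *\<^sub>C gen a (n - 1))"
    by transfer (metis annih_rel_def del_single diff_minus_eq_add scaleC_single total_deriv_single)
qed

text \<open>
  The bracket \<open>[a\<^sub>m, b\<^sub>n] = \<Sum>\<^sub>j (m choose j) (a\<^bsub>(j)\<^esub>b)\<^bsub>m+n-j\<^esub>\<close> and the action
  \<open>a\<^sub>n v = a\<^bsub>(n)\<^esub>v\<close> are first defined on \<open>A[t]\<close>. They are then evaluated on representatives;
  independence of the choice is shown in \<open>annih_bracket_abs\<close> and \<open>annih_act_abs\<close>.
\<close>

definition pre_bracket :: "('a::del_module \<Rightarrow> 'a \<Rightarrow> (nat \<Rightarrow>\<^sub>0 'a))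
    \<Rightarrow> (nat \<Rightarrow>\<^sub>0 'a) \<Rightarrow> (nat \<Rightarrow>\<^sub>0 'a) \<Rightarrow> (nat \<Rightarrow>\<^sub>0 'a)"
  where "pre_bracket br p q = (\<Sum>m \<in> Poly_Mapping.keys p. \<Sum>n \<in> Poly_Mapping.keys q. \<Sum>j\<le>m.
    Poly_Mapping.single (m + n - j)
      (of_nat (m choose j) *\<^sub>C nprod br j (Poly_Mapping.lookup p m) (Poly_Mapping.lookup q n)))"

definition pre_act :: "('a::del_module \<Rightarrow> 'm::del_module \<Rightarrow> (nat \<Rightarrow>\<^sub>0 'm)) \<Rightarrow> (nat \<Rightarrow>\<^sub>0 'a) \<Rightarrow> 'm \<Rightarrow> 'm"
  where "pre_act act p v = (\<Sum>n \<in> Poly_Mapping.keys p. nprod act n (Poly_Mapping.lookup p n) v)"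

definition annih_bracket :: "('a::del_module \<Rightarrow> 'a \<Rightarrow> (nat \<Rightarrow>\<^sub>0 'a)) \<Rightarrow> 'a annih \<Rightarrow> 'a annih \<Rightarrow> 'a annih"
  where "annih_bracket br x y = abs_annih (pre_bracket br (rep_annih x) (rep_annih y))"

definition annih_act :: "('a::del_module \<Rightarrow> 'm::del_module \<Rightarrow> (nat \<Rightarrow>\<^sub>0 'm)) \<Rightarrow> 'a annih \<Rightarrow> 'm \<Rightarrow> 'm"
  where "annih_act act x v = pre_act act (rep_annih x) v"

lemma lookup_var_pmult:
  fixes p :: "nat \<Rightarrow>\<^sub>0 'v::complex_vector"
  shows "Poly_Mapping.lookup (Poly_Mapping.single 1 1 \<cdot> p) n =
    (if n = 0 then 0 else Poly_Mapping.lookup p (n - 1))"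
proof -
  have "(Poly_Mapping.lookup p l when Suc l = n) =
      (if l = n - 1 then if n = 0 then 0 else Poly_Mapping.lookup p (n - 1) else 0)" for l
    by (cases n) (auto simp: when_def)
  thus ?thesis
    by (auto simp: pmult_def lookup_sum lookup_single in_keys_iff)
qed

lemma nprod_linear:
  assumes "clinear (\<lambda>a. f a v)"
  shows "nprod f n (a + b) v = nprod f n a v + nprod f n b v"
    and "nprod f n (c *\<^sub>C a) v = c *\<^sub>C nprod f n a v"
  using Vector_Spaces.linear.axioms(3)[OF assms]
  by (simp_all add: nprod_def module_hom_iff lookup_add scaleC_add_right mult.commute)

lemma nprod_linear_right:
  assumes "clinear (f a)"
  shows "nprod f n a (v + w) = nprod f n a v + nprod f n a w"
    and "nprod f n a (c *\<^sub>C v) = c *\<^sub>C nprod f n a v"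
  using Vector_Spaces.linear.axioms(3)[OF assms]
  by (simp_all add: nprod_def module_hom_iff lookup_add scaleC_add_right mult.commute)

lemma nprod_del_left:
  assumes "f (\<partial> a) v = - (Poly_Mapping.single 1 1 \<cdot> f a v)"
  shows "nprod f n (\<partial> a) v = - (of_nat n *\<^sub>C nprod f (n - 1) a v)"
  using assms by (cases n) (simp_all add: nprod_def lookup_var_pmult[unfolded One_nat_def])

lemma nprod_del_right:
  assumes "f a (\<partial> v) = \<partial> (f a v) + Poly_Mapping.single 1 1 \<cdot> f a v"
  shows "nprod f n a (\<partial> v) = \<partial> (nprod f n a v) + of_nat n *\<^sub>C nprod f (n - 1) a v"
  using assms
  by (cases n) (simp_all add: nprod_def lookup_add lookup_var_pmult[unfolded One_nat_def] scaleC_add_right del_scaleC)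

lemma abs_annih_eq_iff: "abs_annih p = abs_annih q \<longleftrightarrow> annih_rel p q"
  using Quotient3_rel[OF Quotient3_annih] annih_rel_equivp by (metis equivp_reflp)

lemma annih_rel_rep_abs: "annih_rel (rep_annih (abs_annih p)) p"
  using rep_abs_rsp_left[OF Quotient3_annih] annih_rel_equivp by (metis equivp_reflp)

context lie_conformal_algebra
begin

lemmas br_nprod =
  nprod_linear[where f = br, OF br_linear_left]
  nprod_linear_right[where f = br, OF br_linear_right]
  nprod_del_left[where f = br, OF br_del_left]
  nprod_del_right[where f = br, OF br_del_right]

lemma pre_bracket_add_left: "pre_bracket br (p + p') q = pre_bracket br p q + pre_bracket br p' q"
  unfolding pre_bracket_def
  by (rule sum_keys_add[where g = "\<lambda>m a. \<Sum>n \<in> Poly_Mapping.keys q. \<Sum>j\<le>m.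
      Poly_Mapping.single (m + n - j) (of_nat (m choose j) *\<^sub>C nprod br j a (Poly_Mapping.lookup q n))"])
    (simp add: br_nprod scaleC_add_right single_add sum.distrib)

lemma pre_bracket_add_right: "pre_bracket br p (q + q') = pre_bracket br p q + pre_bracket br p q'"
  unfolding pre_bracket_def sum.distrib[symmetric]
  by (intro sum.cong refl sum_keys_add[where g = "\<lambda>n b. \<Sum>j\<le>m.
      Poly_Mapping.single (m + n - j) (of_nat (m choose j) *\<^sub>C nprod br j (Poly_Mapping.lookup p m) b)" for m])
    (simp add: br_nprod scaleC_add_right single_add sum.distrib)

lemma pre_bracket_0:
  "pre_bracket br 0 q = 0" "pre_bracket br p 0 = 0"
  by (simp_all add: pre_bracket_def)

lemma br_nprod_0: "nprod br j 0 b = 0" "nprod br j a 0 = 0"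
  using br_nprod(2)[of j 0 0 b] br_nprod(4)[of j a 0 0] by simp_all

lemma pre_bracket_single:
  "pre_bracket br (Poly_Mapping.single m a) (Poly_Mapping.single n b) =
    (\<Sum>j\<le>m. Poly_Mapping.single (m + n - j) (of_nat (m choose j) *\<^sub>C nprod br j a b))"
proof -
  let ?g = "\<lambda>m a n b. \<Sum>j\<le>m. Poly_Mapping.single (m + n - j) (of_nat (m choose j) *\<^sub>C nprod br j a b)"
  have inner: "(\<Sum>l \<in> Poly_Mapping.keys (Poly_Mapping.single n b).
      ?g k x l (Poly_Mapping.lookup (Poly_Mapping.single n b) l)) = ?g k x n b" for k x
    by (rule sum_keys_single) (simp add: br_nprod_0)
  show ?thesis
    unfolding pre_bracket_def inner
    by (rule sum_keys_single[where g = "\<lambda>k x. ?g k x n b"]) (simp add: br_nprod_0)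
qed

lemma pre_bracket_total_deriv_left_single:
  "pre_bracket br (total_deriv (Poly_Mapping.single m a)) (Poly_Mapping.single n b) = 0"
proof (cases m)
  case 0
  thus ?thesis
    by (simp add: total_deriv_single pre_bracket_add_left pre_bracket_single pre_bracket_0 br_nprod)
next
  case (Suc k)
  have *: "of_nat (Suc k choose Suc j) * of_nat (Suc j) = (of_nat (k choose j) * of_nat (Suc k) :: complex)" for j
    using Suc_times_binomial[of j k] by (metis mult.commute of_nat_mult)
  have "(\<Sum>j\<le>Suc k. Poly_Mapping.single (Suc k + n - j) (of_nat (Suc k choose j) *\<^sub>C nprod br j (\<partial> a) b)) =
      (\<Sum>j\<le>k. Poly_Mapping.single (k + n - j) (of_nat (Suc k choose Suc j) *\<^sub>C nprod br (Suc j) (\<partial> a) b))"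
    by (subst sum.atMost_Suc_shift) (simp add: br_nprod)
  also have "\<dots> = - (\<Sum>j\<le>k. Poly_Mapping.single (k + n - j) (of_nat (k choose j) *\<^sub>C nprod br j (of_nat (Suc k) *\<^sub>C a) b))"
    unfolding sum_negf[symmetric]
    by (intro sum.cong refl)
      (simp only: br_nprod single_uminus[symmetric] scaleC.scale_minus_right scaleC_scaleC * diff_Suc_1)
  finally show ?thesis
    by (simp add: Suc total_deriv_single pre_bracket_add_left pre_bracket_single del: of_nat_Suc binomial_Suc_Suc sum.atMost_Suc)
qed

lemma pre_bracket_total_deriv_right_single:
  "pre_bracket br (Poly_Mapping.single m a) (total_deriv (Poly_Mapping.single n b)) =
    total_deriv (pre_bracket br (Poly_Mapping.single m a) (Poly_Mapping.single n b))"
proof -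
  let ?s = "\<lambda>k c x. Poly_Mapping.single k ((of_nat c :: complex) *\<^sub>C (x :: 'a))"
  let ?p = "\<lambda>j. nprod br j a b"
  have D: "total_deriv (\<Sum>j\<in>S. f j) = (\<Sum>j\<in>S. total_deriv (f j))" for S :: "nat set" and f :: "nat \<Rightarrow> nat \<Rightarrow>\<^sub>0 'a"
    by (induction S rule: infinite_finite_induct) (simp_all add: total_deriv_0 total_deriv_add)
  have A: "(\<Sum>j\<le>m. ?s (m + n - j) ((m choose j) * j) (?p (j - 1))) =
      (\<Sum>j\<le>m. ?s (m + n - j - 1) ((m choose j) * (m - j)) (?p j))"
  proof (cases m)
    case (Suc k)
    have *: "(Suc k choose Suc j) * Suc j = (Suc k choose j) * (Suc k - j)" if "j \<le> k" for j
      using binomial_absorb_comp[of "Suc k" j] Suc_times_binomial[of j k] by (simp add: mult.commute)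
    have "(\<Sum>j\<le>Suc k. ?s (Suc k + n - j) ((Suc k choose j) * j) (?p (j - 1))) =
        (\<Sum>j\<le>k. ?s (k + n - j) ((Suc k choose Suc j) * Suc j) (?p j))"
      by (subst sum.atMost_Suc_shift) simp
    also have "\<dots> = (\<Sum>j\<le>k. ?s (k + n - j) ((Suc k choose j) * (Suc k - j)) (?p j))"
      by (intro sum.cong refl) (simp only: * atMost_iff)
    also have "\<dots> = (\<Sum>j\<le>Suc k. ?s (Suc k + n - j - 1) ((Suc k choose j) * (Suc k - j)) (?p j))"
      by (simp only: sum.atMost_Suc[of _ k]) (simp del: binomial_Suc_Suc of_nat_mult of_nat_diff)
    finally show ?thesis using Suc by simp
  qed simp
  have B: "?s (m + (n - 1) - j) (m choose j) (of_nat n *\<^sub>C ?p j) = ?s (m + n - j - 1) ((m choose j) * n) (?p j)"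
    if "j \<le> m" for j
    using that by (cases n) (simp_all add: algebra_simps)
  have C: "?s k (c * d) x + ?s k (c * e) x = ?s k c (of_nat (d + e) *\<^sub>C x)" for k c d e x
    by (simp add: single_add[symmetric] scaleC_add_left scaleC_add_right distrib_left)
  have "pre_bracket br (Poly_Mapping.single m a) (total_deriv (Poly_Mapping.single n b)) =
      (\<Sum>j\<le>m. ?s (m + n - j) (m choose j) (\<partial> (?p j))) +
      (\<Sum>j\<le>m. ?s (m + n - j) ((m choose j) * j) (?p (j - 1))) +
      (\<Sum>j\<le>m. ?s (m + (n - 1) - j) (m choose j) (of_nat n *\<^sub>C ?p j))"
    by (simp add: total_deriv_single pre_bracket_add_right pre_bracket_single br_nprod
        scaleC_add_right single_add sum.distrib)
  also have "\<dots> = (\<Sum>j\<le>m. ?s (m + n - j) (m choose j) (\<partial> (?p j)) +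
      ?s (m + n - j - 1) (m choose j) (of_nat (m - j + n) *\<^sub>C ?p j))"
    unfolding A C[symmetric] using B by (simp add: sum.distrib algebra_simps)
  also have "\<dots> = total_deriv (pre_bracket br (Poly_Mapping.single m a) (Poly_Mapping.single n b))"
    unfolding pre_bracket_single D total_deriv_single
    by (intro sum.cong refl) (simp add: del_scaleC mult.commute)
  finally show ?thesis .
qed

lemma pre_bracket_total_deriv_left: "pre_bracket br (total_deriv p) q = 0"
proof (induction q rule: poly_single_induct)
  case (single n b)
  show ?case
    by (induction p rule: poly_single_induct)
      (simp_all add: pre_bracket_total_deriv_left_single total_deriv_add pre_bracket_add_left)
qed (simp add: pre_bracket_add_right)

lemma pre_bracket_total_deriv_right: "pre_bracket br p (total_deriv q) = total_deriv (pre_bracket br p q)"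
proof (induction q rule: poly_single_induct)
  case (single n b)
  show ?case
    by (induction p rule: poly_single_induct)
      (simp_all add: pre_bracket_total_deriv_right_single total_deriv_add pre_bracket_add_left)
qed (simp add: pre_bracket_add_right total_deriv_add)

lemma annih_bracket_abs:
  "annih_bracket br (abs_annih p) (abs_annih q) = abs_annih (pre_bracket br p q)"
proof -
  obtain r s where r: "rep_annih (abs_annih p) = p + total_deriv r"
    and s: "rep_annih (abs_annih q) = q + total_deriv s"
    using annih_rel_rep_abs[of p] annih_rel_rep_abs[of q] unfolding annih_rel_def
    by (metis diff_add_cancel add.commute)
  have "pre_bracket br (p + total_deriv r) (q + total_deriv s) =
      pre_bracket br p q + total_deriv (pre_bracket br p s)"
    by (simp add: pre_bracket_add_left pre_bracket_add_right pre_bracket_total_deriv_left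
        pre_bracket_total_deriv_right)
  thus ?thesis
    unfolding annih_bracket_def r s abs_annih_eq_iff annih_rel_def by auto
qed

lemma annih_bracket_gen:
  "annih_bracket br (gen a m) (gen b n) =
    (\<Sum>j\<le>m. of_nat (m choose j) *\<^sub>C gen (nprod br j a b) (m + n - j))"
proof -
  have "abs_annih (\<Sum>j\<in>S. f j) = (\<Sum>j\<in>S. abs_annih (f j))" for S :: "nat set" and f :: "nat \<Rightarrow> nat \<Rightarrow>\<^sub>0 'a"
    by (induction S rule: infinite_finite_induct)
      (simp_all add: zero_annih.abs_eq[symmetric] plus_annih.abs_eq[symmetric])
  thus ?thesis
    by (simp add: gen.abs_eq annih_bracket_abs pre_bracket_single scaleC_annih.abs_eq scaleC_single)
qed

end

context conformal_module
begin

lemmas act_nprod =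
  nprod_linear[where f = act, OF act_linear_left]
  nprod_linear_right[where f = act, OF act_linear_right]
  nprod_del_left[where f = act, OF act_del_left]
  nprod_del_right[where f = act, OF act_del_right]

lemma pre_act_add: "pre_act act (p + q) v = pre_act act p v + pre_act act q v"
  unfolding pre_act_def
  by (rule sum_keys_add[where g = "\<lambda>n a. nprod act n a v"]) (rule act_nprod)

lemma pre_act_single: "pre_act act (Poly_Mapping.single n a) v = nprod act n a v"
  unfolding pre_act_def
  by (rule sum_keys_single[where g = "\<lambda>n a. nprod act n a v"])
    (use act_nprod(2)[of _ 0 0] in simp)

lemma pre_act_total_deriv: "pre_act act (total_deriv p) v = 0"
  by (induction p rule: poly_single_induct)
    (simp_all add: total_deriv_add pre_act_add total_deriv_single pre_act_single act_nprod)

lemma annih_act_abs: "annih_act act (abs_annih p) v = pre_act act p v"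
proof -
  obtain r where r: "rep_annih (abs_annih p) = p + total_deriv r"
    using annih_rel_rep_abs[of p] unfolding annih_rel_def by (metis diff_add_cancel add.commute)
  show ?thesis
    unfolding annih_act_def r by (simp add: pre_act_add pre_act_total_deriv)
qed

lemma annih_act_gen: "annih_act act (gen a n) v = nprod act n a v"
  by (simp add: gen.abs_eq annih_act_abs pre_act_single)

end


section \<open>Cochains\<close>

text \<open>
  A linear map on \<open>V\<^sup>\<otimes>\<^sup>n\<close> is a multilinear function of \<open>n\<close> arguments, given as a list of
  length \<open>n\<close>. Cochains of degree \<open>n\<close> vanish on lists of any other length, so that a cochain is
  determined by its values on the lists of length \<open>n\<close>. As lists are indexed from \<open>0\<close>, so are
  the variables and the sums; this leaves all signs in the differentials unchanged.
\<close>

definition multilinear :: "nat \<Rightarrow> ('v::complex_vector list \<Rightarrow> 'w::complex_vector) \<Rightarrow> bool"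
  where "multilinear n \<gamma> \<longleftrightarrow>
    (\<forall>xs i. length xs = n \<longrightarrow> i < n \<longrightarrow> clinear (\<lambda>x. \<gamma> (xs[i := x])))"

text \<open>
  \<open>permute_list \<pi> as\<close> has \<open>i\<close>-th entry \<open>as ! \<pi> i\<close>, and the substitution \<open>\<lambda>\<^sub>i \<mapsto> \<lambda>\<^bsub>\<pi> i\<^esub>\<close> turns
  \<open>\<gamma>\<^bsub>\<lambda>\<^sub>0,\<lambda>\<^sub>1,\<dots>\<^esub>\<close> into \<open>\<gamma>\<^bsub>\<lambda>\<^bsub>\<pi> 0\<^esub>,\<lambda>\<^bsub>\<pi> 1\<^esub>,\<dots>\<^esub>\<close>.
\<close>

definition basic_cochains :: "nat \<Rightarrow> ('a::del_module list \<Rightarrow> 'm::del_module mpol) set"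
  where "basic_cochains n = {\<gamma>.
    (\<forall>as. length as \<noteq> n \<longrightarrow> \<gamma> as = 0) \<and>
    (\<forall>as. vars_below n (\<gamma> as)) \<and>
    multilinear n \<gamma> \<and>
    (\<forall>as i. length as = n \<longrightarrow> i < n \<longrightarrow> \<gamma> (as[i := \<partial> (as ! i)]) = - (Var i \<cdot> \<gamma> as)) \<and>
    (\<forall>as \<pi>. length as = n \<longrightarrow> \<pi> permutes {..<n} \<longrightarrow>
      psubst (\<lambda>i. Var (\<pi> i)) (\<gamma> (permute_list \<pi> as)) = of_int (sign \<pi>) *\<^sub>C \<gamma> as)}"

text \<open>\<open>eval_at \<gamma> qs as\<close> is \<open>\<gamma>\<^bsub>q\<^sub>1,\<dots>,q\<^sub>n\<^esub>(a\<^sub>1,\<dots>,a\<^sub>n)\<close>; \<open>eval_at_hd\<close> extends it linearly in the first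
  argument to \<open>P \<in> A[\<lambda>\<^sub>1,\<dots>]\<close>. The list \<open>nths xs (- {i, j})\<close> is \<open>xs\<close> with the entries at positions
  \<open>i\<close> and \<open>j\<close> omitted.\<close>

definition eval_at :: "('a list \<Rightarrow> 'm::complex_vector mpol) \<Rightarrow> complex mpol list \<Rightarrow> 'a list \<Rightarrow> 'm mpol"
  where "eval_at \<gamma> qs as = psubst (\<lambda>i. qs ! i) (\<gamma> as)"

definition eval_at_hd :: "('a::zero list \<Rightarrow> 'm::complex_vector mpol) \<Rightarrow> complex mpol list
    \<Rightarrow> 'a mpol \<Rightarrow> 'a list \<Rightarrow> 'm mpol"
  where "eval_at_hd \<gamma> qs P as = (\<Sum>k \<in> Poly_Mapping.keys P.
    Poly_Mapping.single k 1 \<cdot> eval_at \<gamma> qs (Poly_Mapping.lookup P k # as))"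

definition basic_d :: "('a::del_module \<Rightarrow> 'a \<Rightarrow> (nat \<Rightarrow>\<^sub>0 'a)) \<Rightarrow> ('a \<Rightarrow> 'm::del_module \<Rightarrow> (nat \<Rightarrow>\<^sub>0 'm))
    \<Rightarrow> ('a list \<Rightarrow> 'm mpol) \<Rightarrow> ('a list \<Rightarrow> 'm mpol)"
  where "basic_d br act \<gamma> as = (let N = length as; \<Lambda> = map Var [0..<N] in
    (\<Sum>i<N. (- 1) ^ i *\<^sub>C
      lam act (Var i) (const (as ! i)) (eval_at \<gamma> (nths \<Lambda> (- {i})) (nths as (- {i})))) +
    (\<Sum>j<N. \<Sum>i<j. (- 1) ^ (i + j) *\<^sub>C
      eval_at_hd \<gamma> ((Var i + Var j) # nths \<Lambda> (- {i, j}))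
        (lam br (Var i) (const (as ! i)) (const (as ! j))) (nths as (- {i, j}))))"

definition basic_del :: "('a list \<Rightarrow> 'm::del_module mpol) \<Rightarrow> ('a list \<Rightarrow> 'm mpol)"
  where "basic_del \<gamma> as = \<partial> (\<gamma> as) + (\<Sum>i<length as. Var i) \<cdot> \<gamma> as"

definition ce_cochains :: "nat \<Rightarrow> ('a::del_module annih list \<Rightarrow> 'm::del_module) set"
  where "ce_cochains n = {\<gamma>.
    (\<forall>xs. length xs \<noteq> n \<longrightarrow> \<gamma> xs = 0) \<and>
    multilinear n \<gamma> \<and>
    (\<forall>xs \<pi>. length xs = n \<longrightarrow> \<pi> permutes {..<n} \<longrightarrow>
      \<gamma> (permute_list \<pi> xs) = of_int (sign \<pi>) *\<^sub>C \<gamma> xs) \<and>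
    (\<forall>as. length as = n \<longrightarrow> finite {ms. length ms = n \<and> \<gamma> (map2 gen as ms) \<noteq> 0})}"

definition ce_d :: "('a::del_module \<Rightarrow> 'a \<Rightarrow> (nat \<Rightarrow>\<^sub>0 'a)) \<Rightarrow> ('a \<Rightarrow> 'm::del_module \<Rightarrow> (nat \<Rightarrow>\<^sub>0 'm))
    \<Rightarrow> ('a annih list \<Rightarrow> 'm) \<Rightarrow> ('a annih list \<Rightarrow> 'm)"
  where "ce_d br act \<gamma> xs = (let N = length xs in
    (\<Sum>i<N. (- 1) ^ i *\<^sub>C annih_act act (xs ! i) (\<gamma> (nths xs (- {i})))) +
    (\<Sum>j<N. \<Sum>i<j. (- 1) ^ (i + j) *\<^sub>C
      \<gamma> (annih_bracket br (xs ! i) (xs ! j) # nths xs (- {i, j}))))"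

definition ce_del :: "('a::del_module annih list \<Rightarrow> 'm::del_module) \<Rightarrow> ('a annih list \<Rightarrow> 'm)"
  where "ce_del \<gamma> xs = \<partial> (\<gamma> xs) - (\<Sum>i<length xs. \<gamma> (xs[i := \<partial> (xs ! i)]))"


section \<open>Complexes of vector spaces and their quotients\<close>

text \<open>
  Vector spaces with an explicit carrier are modules in the sense of HOL-Algebra over the
  field \<open>complex_ring\<close>; the components \<open>mult\<close> and \<open>one\<close> of the record are irrelevant.
\<close>

definition complex_ring :: "complex ring"
  where "complex_ring = \<lparr>carrier = UNIV, monoid.mult = (*), one = 1, zero = 0, add = (+)\<rparr>"

definition linear_maps :: "(complex, 'v) module \<Rightarrow> (complex, 'w) module \<Rightarrow> ('v \<Rightarrow> 'w) set"
  where "linear_maps V W = {f \<in> carrier V \<rightarrow> carrier W.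
    (\<forall>x \<in> carrier V. \<forall>y \<in> carrier V. f (x \<oplus>\<^bsub>V\<^esub> y) = f x \<oplus>\<^bsub>W\<^esub> f y) \<and>
    (\<forall>c. \<forall>x \<in> carrier V. f (c \<odot>\<^bsub>V\<^esub> x) = c \<odot>\<^bsub>W\<^esub> f x)}"

definition cochain_complex :: "(nat \<Rightarrow> (complex, 'v) module) \<Rightarrow> (nat \<Rightarrow> 'v \<Rightarrow> 'v) \<Rightarrow> bool"
  where "cochain_complex C d \<longleftrightarrow> (\<forall>n.
    Module.module complex_ring (C n) \<and>
    d n \<in> linear_maps (C n) (C (Suc n)) \<and>
    (\<forall>x \<in> carrier (C n). d (Suc n) (d n x) = \<zero>\<^bsub>C (Suc (Suc n))\<^esub>))"

definition complex_iso :: "(nat \<Rightarrow> (complex, 'v) module) \<Rightarrow> (nat \<Rightarrow> 'v \<Rightarrow> 'v)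
    \<Rightarrow> (nat \<Rightarrow> (complex, 'w) module) \<Rightarrow> (nat \<Rightarrow> 'w \<Rightarrow> 'w) \<Rightarrow> (nat \<Rightarrow> 'v \<Rightarrow> 'w) \<Rightarrow> bool"
  where "complex_iso C d C' d' \<phi> \<longleftrightarrow>
    cochain_complex C d \<and> cochain_complex C' d' \<and>
    (\<forall>n. \<phi> n \<in> linear_maps (C n) (C' n) \<and>
      bij_betw (\<phi> n) (carrier (C n)) (carrier (C' n)) \<and>
      (\<forall>x \<in> carrier (C n). \<phi> (Suc n) (d n x) = d' n (\<phi> n x)))"

definition complex_endo :: "(nat \<Rightarrow> (complex, 'v) module) \<Rightarrow> (nat \<Rightarrow> 'v \<Rightarrow> 'v) \<Rightarrow> ('v \<Rightarrow> 'v) \<Rightarrow> bool"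
  where "complex_endo C d D \<longleftrightarrow> (\<forall>n. D \<in> linear_maps (C n) (C n) \<and>
    (\<forall>x \<in> carrier (C n). d n (D x) = D (d n x)))"

definition fun_space :: "('x \<Rightarrow> 'v::complex_vector) set \<Rightarrow> (complex, 'x \<Rightarrow> 'v) module"
  where "fun_space S = \<lparr>carrier = S, monoid.mult = undefined, one = undefined,
    zero = (\<lambda>_. 0), add = (\<lambda>f g x. f x + g x), smult = (\<lambda>c f x. c *\<^sub>C f x)\<rparr>"

text \<open>
  The quotient of \<open>V\<close> by a subspace \<open>B\<close> consists of the cosets of \<open>B\<close>. The summand \<open>B\<close> in the
  scalar multiplication (and in \<open>quot_d\<close>) completes the image of a coset to a coset.
\<close>

definition quot_space :: "(complex, 'v) module \<Rightarrow> 'v set \<Rightarrow> (complex, 'v set) module"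
  where "quot_space V B = \<lparr>carrier = a_rcosets\<^bsub>V\<^esub> B, monoid.mult = undefined, one = undefined,
    zero = B, add = set_add V, smult = (\<lambda>c S. set_add V B ((\<lambda>x. c \<odot>\<^bsub>V\<^esub> x) ` S))\<rparr>"

definition quot_complex :: "(nat \<Rightarrow> (complex, 'v) module) \<Rightarrow> (nat \<Rightarrow> 'v set) \<Rightarrow> nat \<Rightarrow> (complex, 'v set) module"
  where "quot_complex C B n = quot_space (C n) (B n)"

definition quot_d :: "(nat \<Rightarrow> (complex, 'v) module) \<Rightarrow> (nat \<Rightarrow> 'v set) \<Rightarrow> (nat \<Rightarrow> 'v \<Rightarrow> 'v)
    \<Rightarrow> nat \<Rightarrow> 'v set \<Rightarrow> 'v set"
  where "quot_d C B d n S = set_add (C (Suc n)) (B (Suc n)) (d n ` S)"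

definition basic_complex :: "nat \<Rightarrow> (complex, 'a::del_module list \<Rightarrow> 'm::del_module mpol) module"
  where "basic_complex n = fun_space (basic_cochains n)"

definition ce_complex :: "nat \<Rightarrow> (complex, 'a::del_module annih list \<Rightarrow> 'm::del_module) module"
  where "ce_complex n = fun_space (ce_cochains n)"

definition basic_boundaries :: "nat \<Rightarrow> ('a::del_module list \<Rightarrow> 'm::del_module mpol) set"
  where "basic_boundaries n = basic_del ` basic_cochains n"

definition ce_boundaries :: "nat \<Rightarrow> ('a::del_module annih list \<Rightarrow> 'm::del_module) set"
  where "ce_boundaries n = ce_del ` ce_cochains n"

end

(*
  Since t^m is dual to lambda^m / m!, a cochain of the basic complex is the generating function of
  its values on the generators of the annihilation algebra: gamma corresponds to the map that sends
  (a_1)_{m_1}, ..., (a_n)_{m_n} to m_1! ... m_n! times the coefficient of lambda^m. Sesquilinearity is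
  exactly the relation (del a)_m = - m a_{m-1}, and polynomiality is continuity. That the differentials
  agree is a comparison of coefficients based on the identity
  m! n! ((m + n - l) choose n) = (m choose l) l! (m + n - l)!.

  On the Chevalley--Eilenberg side, Cartan's formula computes (d gamma)(x, ...) as L_x gamma - d (iota_x gamma),
  a recursion on the number of arguments. With it, [L, d] = 0 for every derivation L of the pair
  (algebra, module), then d d = 0, and the skew-symmetry of d gamma all follow by induction. Closure of the
  continuous cochains under d, and every identity in the basic complex, are then transported through
  the bijection.
*)
theory Submission
  imports Defs
begin


section \<open>The Chevalley--Eilenberg complex of a Lie algebra\<close>

text \<open>Two matters stand behind the overview. That the annihilation algebra is a Lie algebra
  acting on M has to be derived from the conformal axioms. The commutator formula for n-th products,
  read off from the module axiom, gives the action; for the adjoint module, together with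
  Vandermonde's identity, it gives Jacobi. Skew-symmetry costs an alternating binomial sum, because
  the substitution of -\<lambda>-\<partial> mixes all products. The other matter is that the two
  complexes make different conditions easy. Sesquilinearity and skew-symmetry of
  \<open>basic_d \<gamma>\<close> are awkward to see, since variables are renamed, added and
  omitted, whereas Cartan's recursion yields multilinearity and skew-symmetry on the other side.
  There, in turn, finiteness of the support is not visible, but polynomials have it by construction.
  Hence the device \<open>coeff_transfer\<close>: a family of polynomials and a multilinear
  skew-symmetric map with matching coefficients are both cochains and correspond to each other, so
  each condition need only be checked on the side where it is easy.\<close>

lemma clinear_iff:
  "clinear f \<longleftrightarrow> (\<forall>x y. f (x + y) = f x + f y) \<and> (\<forall>c x. f (c *\<^sub>C x) = c *\<^sub>C f x)"
  by (auto intro!: clinearI dest!: Vector_Spaces.linear.axioms(3) simp: module_hom_iff)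

lemma clinear_0: "clinear f \<Longrightarrow> f 0 = 0"
  by (metis add_cancel_right_right clinear_iff)

lemma clinear_minus: "clinear f \<Longrightarrow> f (- x) = - f x"
  by (metis clinear_iff clinear_0 add.right_inverse minus_unique)

lemma clinear_diff: "clinear f \<Longrightarrow> f (x - y) = f x - f y"
  by (metis clinear_iff clinear_minus diff_conv_add_uminus)

lemma clinear_sum: "clinear f \<Longrightarrow> f (\<Sum>i\<in>A. g i) = (\<Sum>i\<in>A. f (g i))"
  by (induction A rule: infinite_finite_induct) (auto simp: clinear_0 clinear_iff)

section \<open>Multilinear maps, one argument at a time\<close>

lemma multilinear_Suc:
  "multilinear (Suc n) \<gamma> \<longleftrightarrow>
    (\<forall>x. multilinear n (\<lambda>xs. \<gamma> (x # xs))) \<and> (\<forall>xs. length xs = n \<longrightarrow> clinear (\<lambda>x. \<gamma> (x # xs)))"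
proof (intro iffI conjI allI impI)
  assume m: "multilinear (Suc n) \<gamma>"
  show "multilinear n (\<lambda>xs. \<gamma> (x # xs))" for x
    unfolding multilinear_def
  proof (intro allI impI)
    fix xs :: "'a list" and i
    assume "length xs = n" "i < n"
    then show "clinear (\<lambda>y. \<gamma> (x # xs[i := y]))"
      using m[unfolded multilinear_def, rule_format, of "x # xs" "Suc i"] by simp
  qed
  show "clinear (\<lambda>x. \<gamma> (x # xs))" if "length xs = n" for xs
    using m[unfolded multilinear_def, rule_format, of "undefined # xs" 0] that by simp
next
  assume *: "(\<forall>x. multilinear n (\<lambda>xs. \<gamma> (x # xs))) \<and>
    (\<forall>xs. length xs = n \<longrightarrow> clinear (\<lambda>x. \<gamma> (x # xs)))"
  show "multilinear (Suc n) \<gamma>"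
    unfolding multilinear_def
  proof (intro allI impI)
    fix xs :: "'a list" and i
    assume "length xs = Suc n" and i: "i < Suc n"
    then obtain x ys where xs: "xs = x # ys" "length ys = n" by (metis length_Suc_conv)
    show "clinear (\<lambda>x. \<gamma> (xs[i := x]))"
      using * i xs unfolding multilinear_def by (cases i) auto
  qed
qed

lemma multilinear_Cons: "multilinear (Suc n) \<gamma> \<Longrightarrow> multilinear n (\<lambda>xs. \<gamma> (x # xs))"
  by (simp add: multilinear_Suc)

lemma multilinear_hd: "multilinear (Suc n) \<gamma> \<Longrightarrow> length xs = n \<Longrightarrow> clinear (\<lambda>x. \<gamma> (x # xs))"
  by (simp add: multilinear_Suc)

lemma multilinear_cong:
  "(\<And>xs. length xs = n \<Longrightarrow> \<gamma> xs = \<delta> xs) \<Longrightarrow> multilinear n \<gamma> = multilinear n \<delta>"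
  by (simp add: multilinear_def)

lemma multilinear_add: "multilinear n \<gamma> \<Longrightarrow> multilinear n \<delta> \<Longrightarrow> multilinear n (\<lambda>xs. \<gamma> xs + \<delta> xs)"
  by (simp add: multilinear_def clinear_iff scaleC_add_right algebra_simps)

lemma multilinear_scaleC: "multilinear n \<gamma> \<Longrightarrow> multilinear n (\<lambda>xs. c *\<^sub>C \<gamma> xs)"
  by (simp add: multilinear_def clinear_iff scaleC_add_right mult.commute)

lemma multilinear_minus: "multilinear n \<gamma> \<Longrightarrow> multilinear n (\<lambda>xs. - \<gamma> xs)"
  by (simp add: multilinear_def clinear_iff)

lemma multilinear_diff: "multilinear n \<gamma> \<Longrightarrow> multilinear n \<delta> \<Longrightarrow> multilinear n (\<lambda>xs. \<gamma> xs - \<delta> xs)"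
  by (drule multilinear_minus[of n \<delta>], drule (1) multilinear_add) simp

lemma multilinear_zero: "multilinear n (\<lambda>xs. 0)"
  by (simp add: multilinear_def clinear_iff)

section \<open>Skew-symmetric maps\<close>

definition alternating :: "nat \<Rightarrow> ('v list \<Rightarrow> 'w::ab_group_add) \<Rightarrow> bool"
  where "alternating n \<gamma> \<longleftrightarrow> (\<forall>xs i j. length xs = n \<longrightarrow> i < n \<longrightarrow> j < n \<longrightarrow> i \<noteq> j \<longrightarrow>
    \<gamma> (xs[i := xs ! j, j := xs ! i]) = - \<gamma> xs)"

lemma permute_list_transpose:
  assumes "i < length xs" "j < length xs"
  shows "permute_list (Transposition.transpose i j) xs = xs[i := xs ! j, j := xs ! i]"
proof (rule nth_equalityI)
  fix k assume "k < length (permute_list (Transposition.transpose i j) xs)"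
  then show "permute_list (Transposition.transpose i j) xs ! k = xs[i := xs ! j, j := xs ! i] ! k"
    using assms permutes_swap_id[of i "{..<length xs}" j]
    by (auto simp: permute_list_nth nth_list_update Transposition.transpose_def)
qed simp

text \<open>Transpositions generate the symmetric group and the sign is multiplicative. Cochains are
  defined through all permutations, but exchanges of two entries are what an induction on the number
  of arguments can handle.\<close>

lemma alternating_iff_sign:
  fixes \<gamma> :: "'v list \<Rightarrow> 'w::complex_vector"
  shows "alternating n \<gamma> \<longleftrightarrow> (\<forall>xs \<pi>. length xs = n \<longrightarrow> \<pi> permutes {..<n} \<longrightarrow>
    \<gamma> (permute_list \<pi> xs) = of_int (sign \<pi>) *\<^sub>C \<gamma> xs)"
proof (intro iffI allI impI)
  fix xs :: "'v list" and \<pi>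
  assume alt: "alternating n \<gamma>" and "length xs = n" and \<pi>: "\<pi> permutes {..<n}"
  have "\<forall>xs. length xs = n \<longrightarrow> \<gamma> (permute_list \<pi> xs) = of_int (sign \<pi>) *\<^sub>C \<gamma> xs"
    using \<pi> finite_lessThan
  proof (induction rule: permutes_induct)
    case id
    show ?case by simp
  next
    case (swap a b p)
    then have p: "p permutes {..<n}" by simp
    show ?case
    proof (intro allI impI)
      fix xs :: "'v list"
      assume len: "length xs = n"
      \<comment> \<open>\<open>permute_list\<close> reverses compositions: the exchange acts on the
        list first, and p on the result.\<close>
      have "\<gamma> (permute_list (Transposition.transpose a b \<circ> p) xs) =
          \<gamma> (permute_list p (permute_list (Transposition.transpose a b) xs))"
        using swap len by (simp add: permute_list_compose)
      also have "\<dots> = of_int (sign p) *\<^sub>C \<gamma> (permute_list (Transposition.transpose a b) xs)"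
        using swap len by simp
      also have "\<gamma> (permute_list (Transposition.transpose a b) xs) =
          of_int (sign (Transposition.transpose a b)) *\<^sub>C \<gamma> xs"
        using swap len alt
        by (cases "a = b") (auto simp: permute_list_transpose sign_swap_id alternating_def)
      also have "of_int (sign p) *\<^sub>C of_int (sign (Transposition.transpose a b)) *\<^sub>C \<gamma> xs =
          of_int (sign (Transposition.transpose a b \<circ> p)) *\<^sub>C \<gamma> xs"
        using permutes_imp_permutation[OF finite_lessThan p]
        by (simp add: sign_compose permutation_swap_id mult.commute)
      finally show "\<gamma> (permute_list (Transposition.transpose a b \<circ> p) xs) =
          of_int (sign (Transposition.transpose a b \<circ> p)) *\<^sub>C \<gamma> xs" .
    qed
  qed
  then show "\<gamma> (permute_list \<pi> xs) = of_int (sign \<pi>) *\<^sub>C \<gamma> xs"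
    using \<open>length xs = n\<close> by blast
next
  assume *: "\<forall>xs \<pi>. length xs = n \<longrightarrow> \<pi> permutes {..<n} \<longrightarrow>
    \<gamma> (permute_list \<pi> xs) = of_int (sign \<pi>) *\<^sub>C \<gamma> xs"
  show "alternating n \<gamma>"
    unfolding alternating_def
  proof (intro allI impI)
    fix xs :: "'v list" and i j
    assume "length xs = n" "i < n" "j < n" "i \<noteq> j"
    then show "\<gamma> (xs[i := xs ! j, j := xs ! i]) = - \<gamma> xs"
      using *[rule_format, of xs "Transposition.transpose i j"] permutes_swap_id[of i "{..<n}" j]
      by (simp add: permute_list_transpose sign_swap_id)
  qed
qed

lemma alternating_Cons:
  assumes "alternating (Suc n) \<gamma>"
  shows "alternating n (\<lambda>xs. \<gamma> (x # xs))"
  unfolding alternating_def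
  using assms[unfolded alternating_def, rule_format, of "x # _" "Suc _" "Suc _"] by simp

lemma alternating_swap_hd:
  assumes "alternating (Suc (Suc n)) \<gamma>" "length xs = n"
  shows "\<gamma> (x # y # xs) = - \<gamma> (y # x # xs)"
  using assms(1)[unfolded alternating_def, rule_format, of "y # x # xs" 0 "Suc 0"] assms(2) by simp

text \<open>The transposition (0 j) is the conjugate (1 j)(0 1)(1 j), so exchanges within the tail
  and the exchange of the first two entries generate all others. The fact \<open>zero\<close> is
  this conjugation for the position 0.\<close>

lemma alternating_SucI:
  assumes tl: "\<And>x. alternating n (\<lambda>xs. \<gamma> (x # xs))"
    and hd: "\<And>x y xs. Suc (length xs) = n \<Longrightarrow> \<gamma> (x # y # xs) = - \<gamma> (y # x # xs)"
  shows "alternating (Suc n) \<gamma>"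
proof -
  have zero: "\<gamma> (ys ! j # ys[j := x]) = - \<gamma> (x # ys)" if len: "length ys = n" and j: "j < n" for x ys j
  proof (cases j)
    case 0
    then obtain y zs where "ys = y # zs" using len j by (cases ys) auto
    then show ?thesis using 0 len hd[of zs y x] by simp
  next
    case (Suc k)
    then obtain y zs where ys: "ys = y # zs" using len j by (cases ys) auto
    have k: "k < length zs" using Suc len j ys by simp
    have "\<gamma> (ys ! j # ys[j := x]) = \<gamma> (zs ! k # y # zs[k := x])"
      by (simp add: Suc ys)
    also have "\<dots> = - \<gamma> (zs ! k # x # zs[k := y])"
      using tl[of "zs ! k", unfolded alternating_def, rule_format, of "y # zs[k := x]" 0 "Suc k"]
        len k ys by (simp add: minus_equation_iff)
    also have "\<dots> = \<gamma> (x # zs ! k # zs[k := y])"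
      using hd[of "zs[k := y]" "zs ! k" x] len ys by simp
    also have "\<dots> = - \<gamma> (x # ys)"
      using tl[of x, unfolded alternating_def, rule_format, of "y # zs" 0 "Suc k"] len k ys by simp
    finally show ?thesis .
  qed
  show ?thesis
    unfolding alternating_def
  proof (intro allI impI)
    fix xs :: "'a list" and i j
    assume "length xs = Suc n" and ij: "i < Suc n" "j < Suc n" "i \<noteq> j"
    then obtain x ys where xs: "xs = x # ys" "length ys = n" by (metis length_Suc_conv)
    show "\<gamma> (xs[i := xs ! j, j := xs ! i]) = - \<gamma> xs"
    proof (cases i)
      case 0
      then show ?thesis using zero[of ys "j - 1" x] ij xs by (cases j) auto
    next
      case (Suc i')
      show ?thesis
      proof (cases j)
        case 0
        then show ?thesis using zero[of ys "i - 1" x] ij xs Suc by auto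
      next
        case (Suc j')
        then show ?thesis
          using tl[of x, unfolded alternating_def, rule_format, of ys i' j'] ij xs \<open>i = Suc i'\<close> by simp
      qed
    qed
  qed
qed

lemma alternating_add: "alternating n \<gamma> \<Longrightarrow> alternating n \<delta> \<Longrightarrow> alternating n (\<lambda>xs. \<gamma> xs + \<delta> xs)"
  by (simp add: alternating_def)

lemma alternating_diff: "alternating n \<gamma> \<Longrightarrow> alternating n \<delta> \<Longrightarrow> alternating n (\<lambda>xs. \<gamma> xs - \<delta> xs)"
  by (simp add: alternating_def)

lemma alternating_move_to_front:
  fixes \<gamma> :: "'v list \<Rightarrow> 'w::complex_vector"
  assumes "alternating (Suc (length us + length vs)) \<gamma>"
  shows "\<gamma> (y # us @ vs) = (- 1) ^ length us *\<^sub>C \<gamma> (us @ y # vs)"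
  using assms
proof (induction us arbitrary: \<gamma>)
  case (Cons u us)
  have "\<gamma> (y # u # us @ vs) = - \<gamma> (u # y # us @ vs)"
    using Cons.prems by (intro alternating_swap_hd) auto
  also have "\<gamma> (u # y # us @ vs) = (- 1) ^ length us *\<^sub>C \<gamma> (u # us @ y # vs)"
    using Cons.prems by (intro Cons.IH alternating_Cons) simp
  finally show ?case by simp
qed simp

section \<open>Omitting entries of a list\<close>

lemma nths_remove_Cons:
  "nths (x # xs) (- {0}) = xs"
  "nths (x # xs) (- {Suc i}) = x # nths xs (- {i})"
  "nths (x # xs) (- {0, Suc j}) = nths xs (- {j})"
  "nths (x # xs) (- {Suc i, Suc j}) = x # nths xs (- {i, j})"
proof -
  have "{j. Suc j \<in> - {0}} = UNIV" "{j. Suc j \<in> - {Suc i}} = - {i}"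
    "{j'. Suc j' \<in> - {0, Suc j}} = - {j}" "{j'. Suc j' \<in> - {Suc i, Suc j}} = - {i, j}"
    by auto
  then show "nths (x # xs) (- {0}) = xs"
    "nths (x # xs) (- {Suc i}) = x # nths xs (- {i})"
    "nths (x # xs) (- {0, Suc j}) = nths xs (- {j})"
    "nths (x # xs) (- {Suc i, Suc j}) = x # nths xs (- {i, j})"
    by (simp_all only: nths_Cons) (simp_all add: nths_all)
qed

lemma nths_remove_conv_take_drop:
  "i < length xs \<Longrightarrow> nths xs (- {i}) = take i xs @ drop (Suc i) xs"
proof (induction xs arbitrary: i)
  case (Cons x xs)
  then show ?case by (cases i) (simp_all add: nths_remove_Cons)
qed simp

text \<open>Links two positions of a bracket: in the Chevalley--Eilenberg formula it stands in
  front, in a Lie derivative it replaces the j-th entry. Moving it takes j exchanges.\<close>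

lemma alternating_move_nth_to_front:
  fixes \<gamma> :: "'v list \<Rightarrow> 'w::complex_vector"
  assumes "alternating n \<gamma>" "length xs = n" "j < n"
  shows "\<gamma> (y # nths xs (- {j})) = (- 1) ^ j *\<^sub>C \<gamma> (xs[j := y])"
proof -
  have "\<gamma> (y # take j xs @ drop (Suc j) xs) =
      (- 1) ^ length (take j xs) *\<^sub>C \<gamma> (take j xs @ y # drop (Suc j) xs)"
    using assms by (intro alternating_move_to_front) (simp add: min_def)
  then show ?thesis
    using assms by (simp add: nths_remove_conv_take_drop upd_conv_take_nth_drop min_def)
qed

text \<open>The Lie derivative of cochains along an endomorphism f of the values and g of the
  arguments, given by iota_x L = L iota_x - iota_(g x). With \<open>ac x\<close> and
  \<open>brk x\<close> it is L_x; with \<partial> on both sides it is the action of \<partial> on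
  cochains.\<close>

fun lie_deriv :: "('w \<Rightarrow> 'w) \<Rightarrow> ('v \<Rightarrow> 'v) \<Rightarrow> ('v list \<Rightarrow> 'w::ab_group_add) \<Rightarrow> 'v list \<Rightarrow> 'w"
  where
    "lie_deriv f g \<gamma> [] = f (\<gamma> [])"
  | "lie_deriv f g \<gamma> (x # xs) = lie_deriv f g (\<lambda>ys. \<gamma> (x # ys)) xs - \<gamma> (g x # xs)"

lemma lie_deriv_conv_sum:
  "lie_deriv f g \<gamma> xs = f (\<gamma> xs) - (\<Sum>i<length xs. \<gamma> (xs[i := g (xs ! i)]))"
  by (induction f g \<gamma> xs rule: lie_deriv.induct) (simp_all add: sum.lessThan_Suc_shift del: sum.lessThan_Suc)

lemma lie_deriv_cong:
  "(\<And>ys. length ys = length xs \<Longrightarrow> \<gamma> ys = \<delta> ys) \<Longrightarrow> lie_deriv f g \<gamma> xs = lie_deriv f g \<delta> xs"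
  by (simp add: lie_deriv_conv_sum)

lemma lie_deriv_linear:
  assumes "clinear f"
  shows "lie_deriv f g (\<lambda>ys. \<gamma> ys + \<delta> ys) xs = lie_deriv f g \<gamma> xs + lie_deriv f g \<delta> xs"
    and "lie_deriv f g (\<lambda>ys. \<gamma> ys - \<delta> ys) xs = lie_deriv f g \<gamma> xs - lie_deriv f g \<delta> xs"
    and "lie_deriv f g (\<lambda>ys. - \<gamma> ys) xs = - lie_deriv f g \<gamma> xs"
    and "lie_deriv f g (\<lambda>ys. c *\<^sub>C \<gamma> ys) xs = c *\<^sub>C lie_deriv f g \<gamma> xs"
    and "lie_deriv f g (\<lambda>ys. 0) xs = 0"
  using assms clinear_diff[OF assms] clinear_minus[OF assms] clinear_0[OF assms]
  by (simp_all add: lie_deriv_conv_sum clinear_iff sum.distrib sum_subtractf sum_negf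
      scaleC.scale_sum_right scaleC.scale_right_diff_distrib)

lemma multilinear_lie_deriv:
  assumes "clinear f" "clinear g" "multilinear n \<gamma>"
  shows "multilinear n (lie_deriv f g \<gamma>)"
  using assms(3)
proof (induction n arbitrary: \<gamma>)
  case 0
  show ?case by (simp add: multilinear_def)
next
  case (Suc n)
  have "clinear (\<lambda>x. lie_deriv f g \<gamma> (x # xs))" if "length xs = n" for xs
  proof -
    have hd: "clinear (\<lambda>x. \<gamma> (x # ys))" if "length ys = length xs" for ys
      using Suc.prems that \<open>length xs = n\<close> by (intro multilinear_hd) auto
    have "lie_deriv f g (\<lambda>ys. \<gamma> ((x + y) # ys)) xs =
        lie_deriv f g (\<lambda>ys. \<gamma> (x # ys)) xs + lie_deriv f g (\<lambda>ys. \<gamma> (y # ys)) xs" for x y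
      unfolding lie_deriv_linear(1)[OF assms(1), symmetric]
      by (rule lie_deriv_cong) (use hd in \<open>auto simp: clinear_iff\<close>)
    moreover have "lie_deriv f g (\<lambda>ys. \<gamma> ((c *\<^sub>C x) # ys)) xs =
        c *\<^sub>C lie_deriv f g (\<lambda>ys. \<gamma> (x # ys)) xs" for c x
      unfolding lie_deriv_linear(4)[OF assms(1), symmetric]
      by (rule lie_deriv_cong) (use hd in \<open>auto simp: clinear_iff\<close>)
    ultimately show ?thesis
      using assms hd[OF refl] by (simp add: clinear_iff scaleC.scale_right_diff_distrib)
  qed
  then show ?case
    using Suc by (auto simp: multilinear_Suc intro!: multilinear_diff)
qed

lemma alternating_lie_deriv:
  fixes \<gamma> :: "'v list \<Rightarrow> 'w::complex_vector"
  assumes "clinear f" "alternating n \<gamma>"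
  shows "alternating n (lie_deriv f g \<gamma>)"
  using assms(2)
proof (induction n arbitrary: \<gamma>)
  case 0
  show ?case by (simp add: alternating_def)
next
  case (Suc n)
  show ?case
  proof (rule alternating_SucI)
    show "alternating n (\<lambda>xs. lie_deriv f g \<gamma> (x # xs))" for x
      using Suc by (simp add: alternating_diff alternating_Cons)
    show "lie_deriv f g \<gamma> (x # y # xs) = - lie_deriv f g \<gamma> (y # x # xs)" if "Suc (length xs) = n" for x y xs
    proof -
      have swap: "\<gamma> (u # v # ys) = - \<gamma> (v # u # ys)" if "length ys = length xs" for u v ys
        using alternating_swap_hd[of "length ys" \<gamma> ys u v] Suc.prems that \<open>Suc (length xs) = n\<close> by simp
      have "lie_deriv f g (\<lambda>ys. \<gamma> (x # y # ys)) xs = - lie_deriv f g (\<lambda>ys. \<gamma> (y # x # ys)) xs"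
        unfolding lie_deriv_linear(3)[OF assms(1), symmetric]
        by (rule lie_deriv_cong) (rule swap)
      then show ?thesis
        using swap[of xs x "g y"] swap[of xs "g x" y] by simp
    qed
  qed
qed

text \<open>Terms in which the two pairs act at different places (the value counting as a place)
  occur in both orders and cancel; what survives are the terms in which they act at the same
  place.\<close>

lemma lie_deriv_commutator:
  assumes "clinear f" "clinear h" "multilinear (length xs) \<gamma>"
  shows "lie_deriv f g (lie_deriv h k \<gamma>) xs - lie_deriv h k (lie_deriv f g \<gamma>) xs =
    lie_deriv (\<lambda>v. f (h v) - h (f v)) (\<lambda>x. g (k x) - k (g x)) \<gamma> xs"
  using assms(3)
proof (induction xs arbitrary: \<gamma>)
  case (Cons x xs)
  have "\<gamma> ((g (k x) - k (g x)) # xs) = \<gamma> (g (k x) # xs) - \<gamma> (k (g x) # xs)"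
    using Cons.prems by (intro clinear_diff[of "\<lambda>x. \<gamma> (x # xs)"] multilinear_hd) auto
  moreover have "multilinear (length xs) (\<lambda>ys. \<gamma> (x # ys))"
    using Cons.prems multilinear_Cons by auto
  ultimately show ?case
    using Cons.IH[of "\<lambda>ys. \<gamma> (x # ys)"] by (simp add: lie_deriv_linear assms algebra_simps)
qed simp

section \<open>Cartan's recursion for the differential\<close>

locale lie_rep =
  fixes brk :: "'g::complex_vector \<Rightarrow> 'g \<Rightarrow> 'g"
    and ac :: "'g \<Rightarrow> 'v::complex_vector \<Rightarrow> 'v"
  assumes brk_linear_left: "clinear (\<lambda>x. brk x y)"
    and brk_linear_right: "clinear (brk x)"
    and brk_skew: "brk x y = - brk y x"
    and brk_leibniz: "brk x (brk y z) = brk (brk x y) z + brk y (brk x z)"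
    and ac_linear_left: "clinear (\<lambda>x. ac x v)"
    and ac_linear_right: "clinear (ac x)"
    and ac_brk: "ac (brk x y) v = ac x (ac y v) - ac y (ac x v)"
begin

text \<open>Taking iota_x d = L_x - d iota_x as the definition keeps the double sum with omitted
  entries out of the inductions. The value 0 on the empty list makes the result on a single argument
  \<open>ac x (\<gamma> [])\<close>, the differential in degree 0.\<close>

fun cartan_d :: "('g list \<Rightarrow> 'v) \<Rightarrow> 'g list \<Rightarrow> 'v"
  where
    "cartan_d \<gamma> [] = 0"
  | "cartan_d \<gamma> (x # xs) = lie_deriv (ac x) (brk x) \<gamma> xs - cartan_d (\<lambda>ys. \<gamma> (x # ys)) xs"

lemma cartan_d_cong:
  "(\<And>ys. Suc (length ys) = length xs \<Longrightarrow> \<gamma> ys = \<delta> ys) \<Longrightarrow> cartan_d \<gamma> xs = cartan_d \<delta> xs"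
proof (induction xs arbitrary: \<gamma> \<delta>)
  case (Cons x xs)
  have "lie_deriv (ac x) (brk x) \<gamma> xs = lie_deriv (ac x) (brk x) \<delta> xs"
    by (rule lie_deriv_cong) (simp add: Cons.prems)
  moreover have "cartan_d (\<lambda>ys. \<gamma> (x # ys)) xs = cartan_d (\<lambda>ys. \<delta> (x # ys)) xs"
    by (rule Cons.IH) (simp add: Cons.prems)
  ultimately show ?case by simp
qed simp

lemma cartan_d_linear:
  shows "cartan_d (\<lambda>ys. \<gamma> ys + \<delta> ys) xs = cartan_d \<gamma> xs + cartan_d \<delta> xs"
    and "cartan_d (\<lambda>ys. \<gamma> ys - \<delta> ys) xs = cartan_d \<gamma> xs - cartan_d \<delta> xs"
    and "cartan_d (\<lambda>ys. - \<gamma> ys) xs = - cartan_d \<gamma> xs"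
    and "cartan_d (\<lambda>ys. c *\<^sub>C \<gamma> ys) xs = c *\<^sub>C cartan_d \<gamma> xs"
  by (induction xs arbitrary: \<gamma> \<delta>)
    (simp_all add: lie_deriv_linear[OF ac_linear_right] scaleC.scale_right_diff_distrib)

lemma multilinear_cartan_d:
  assumes "multilinear n \<gamma>"
  shows "multilinear (Suc n) (cartan_d \<gamma>)"
  using assms
proof (induction n arbitrary: \<gamma>)
  case 0
  then show ?case
    using ac_linear_left by (auto simp: multilinear_Suc clinear_iff) (auto simp: multilinear_def)
next
  case (Suc n)
  have "clinear (\<lambda>x. cartan_d \<gamma> (x # xs))" if len: "length xs = Suc n" for xs
  proof -
    have hd: "clinear (\<lambda>x. \<gamma> (x # ys))" if "Suc (length ys) = length xs" for ys
      using Suc.prems that len by (intro multilinear_hd) auto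
    have upd: "clinear (\<lambda>y. \<gamma> (xs[i := y]))" if "i < Suc n" for i
      using Suc.prems that len by (simp add: multilinear_def)
    have "cartan_d (\<lambda>ys. \<gamma> ((x + y) # ys)) xs =
        cartan_d (\<lambda>ys. \<gamma> (x # ys)) xs + cartan_d (\<lambda>ys. \<gamma> (y # ys)) xs" for x y
      unfolding cartan_d_linear(1)[symmetric]
      by (rule cartan_d_cong) (use hd in \<open>auto simp: clinear_iff\<close>)
    moreover have "cartan_d (\<lambda>ys. \<gamma> ((c *\<^sub>C x) # ys)) xs = c *\<^sub>C cartan_d (\<lambda>ys. \<gamma> (x # ys)) xs" for c x
      unfolding cartan_d_linear(4)[symmetric]
      by (rule cartan_d_cong) (use hd in \<open>auto simp: clinear_iff\<close>)
    moreover have "lie_deriv (ac (x + y)) (brk (x + y)) \<gamma> xs =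
        lie_deriv (ac x) (brk x) \<gamma> xs + lie_deriv (ac y) (brk y) \<gamma> xs" for x y
    proof -
      have "\<gamma> (xs[i := brk (x + y) (xs ! i)]) = \<gamma> (xs[i := brk x (xs ! i)]) + \<gamma> (xs[i := brk y (xs ! i)])"
        if "i < Suc n" for i
        using upd[OF that] brk_linear_left by (simp add: clinear_iff)
      then show ?thesis
        using ac_linear_left by (simp add: lie_deriv_conv_sum len sum.distrib clinear_iff)
    qed
    moreover have "lie_deriv (ac (c *\<^sub>C x)) (brk (c *\<^sub>C x)) \<gamma> xs = c *\<^sub>C lie_deriv (ac x) (brk x) \<gamma> xs" for c x
    proof -
      have "\<gamma> (xs[i := brk (c *\<^sub>C x) (xs ! i)]) = c *\<^sub>C \<gamma> (xs[i := brk x (xs ! i)])"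
        if "i < Suc n" for i
        using upd[OF that] brk_linear_left by (simp add: clinear_iff)
      then show ?thesis
        using ac_linear_left
        by (simp add: lie_deriv_conv_sum len clinear_iff scaleC.scale_sum_right scaleC.scale_right_diff_distrib
            del: sum.lessThan_Suc)
    qed
    ultimately show ?thesis
      by (simp add: clinear_iff scaleC.scale_right_diff_distrib)
  qed
  then show ?case
    using Suc by (subst multilinear_Suc)
      (auto intro!: multilinear_diff multilinear_lie_deriv ac_linear_right brk_linear_right
        simp: multilinear_Cons)
qed

text \<open>Unfolding twice, iota_y iota_x d = L_x iota_y - L_y iota_x - iota_[x,y] + d iota_y
  iota_x on \<gamma>. The first two terms together, the third and the fourth each change sign when x
  and y are exchanged; the tail is left to the induction.\<close>

lemma alternating_cartan_d:
  assumes "multilinear n \<gamma>" "alternating n \<gamma>"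
  shows "alternating (Suc n) (cartan_d \<gamma>)"
  using assms
proof (induction n arbitrary: \<gamma>)
  case 0
  show ?case by (simp add: alternating_def)
next
  case (Suc n)
  show ?case
  proof (rule alternating_SucI)
    show "alternating (Suc n) (\<lambda>xs. cartan_d \<gamma> (x # xs))" for x
      using Suc by (simp add: alternating_diff alternating_Cons multilinear_Cons alternating_lie_deriv ac_linear_right)
    show "cartan_d \<gamma> (x # y # xs) = - cartan_d \<gamma> (y # x # xs)" if "Suc (length xs) = Suc n" for x y xs
    proof -
      have "cartan_d (\<lambda>ys. \<gamma> (x # y # ys)) xs = - cartan_d (\<lambda>ys. \<gamma> (y # x # ys)) xs"
        unfolding cartan_d_linear(3)[symmetric]
      proof (rule cartan_d_cong)
        fix ys :: "'g list"
        assume "Suc (length ys) = length xs"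
        then show "\<gamma> (x # y # ys) = - \<gamma> (y # x # ys)"
          using Suc.prems(2) that by (intro alternating_swap_hd[of "length ys"]) auto
      qed
      moreover have "\<gamma> (brk x y # xs) = - \<gamma> (brk y x # xs)"
        by (subst brk_skew) (use Suc.prems that in \<open>auto intro!: clinear_minus[of "\<lambda>x. \<gamma> (x # xs)"] multilinear_hd\<close>)
      ultimately show ?thesis by simp
    qed
  qed
qed

text \<open>The hypotheses say that (f, g) is a derivation of algebra and module, so [L, L_y] = L_(g
  y). Evaluating L d and d L with y as first argument, the terms with iota_(g y) cancel and the
  statement for iota_y \<gamma> remains. It serves for L_x, towards d d = 0, and for
  \<partial>.\<close>

lemma lie_deriv_cartan_d:
  assumes f: "clinear f" and g: "clinear g"
    and f_ac: "\<And>x v. f (ac x v) = ac (g x) v + ac x (f v)"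
    and g_brk: "\<And>x y. g (brk x y) = brk (g x) y + brk x (g y)"
    and "multilinear n \<gamma>" "length xs = Suc n"
  shows "lie_deriv f g (cartan_d \<gamma>) xs = cartan_d (lie_deriv f g \<gamma>) xs"
  using assms(5,6)
proof (induction xs arbitrary: n \<gamma>)
  case (Cons y ys)
  \<comment> \<open>For n = 0 the tail is empty and out of reach of the induction hypothesis; both
    sides are then 0, since \<open>cartan_d\<close> vanishes on the empty list and f is
    linear.\<close>
  have IH: "lie_deriv f g (cartan_d (\<lambda>zs. \<gamma> (y # zs))) ys = cartan_d (lie_deriv f g (\<lambda>zs. \<gamma> (y # zs))) ys"
  proof (cases n)
    case 0
    then show ?thesis using Cons.prems clinear_0[OF f] by simp
  next
    case (Suc m)
    then show ?thesis
      using Cons.prems multilinear_Cons by (intro Cons.IH) auto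
  qed
  have "lie_deriv f g (lie_deriv (ac y) (brk y) \<gamma>) ys - lie_deriv (ac y) (brk y) (lie_deriv f g \<gamma>) ys =
      lie_deriv (ac (g y)) (brk (g y)) \<gamma> ys"
    using Cons.prems by (subst lie_deriv_commutator) (auto simp: f ac_linear_right f_ac g_brk)
  then show ?case
    using IH by (simp add: lie_deriv_linear[OF f] cartan_d_linear algebra_simps)
qed simp

text \<open>Here iota_x d d = L_x d - d L_x + d d iota_x. The first two terms cancel because L_x is
  a derivation, by the Jacobi identity and the module axiom; the last one has an argument
  less.\<close>

lemma cartan_d_cartan_d:
  assumes "multilinear n \<gamma>" "length xs = Suc (Suc n)"
  shows "cartan_d (cartan_d \<gamma>) xs = 0"
  using assms
proof (induction xs arbitrary: n \<gamma>)
  case (Cons x xs)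
  have "lie_deriv (ac x) (brk x) (cartan_d \<gamma>) xs = cartan_d (lie_deriv (ac x) (brk x) \<gamma>) xs"
    using Cons.prems
    by (intro lie_deriv_cartan_d[of _ _ n] ac_linear_right brk_linear_right brk_leibniz) (simp_all add: ac_brk)
  moreover have "cartan_d (cartan_d (\<lambda>ys. \<gamma> (x # ys))) xs = 0"
  proof (cases n)
    case 0
    then obtain z where "xs = [z]" using Cons.prems by (cases xs) auto
    then show ?thesis using clinear_0[OF ac_linear_right] by simp
  next
    case (Suc m)
    then show ?thesis
      using Cons.prems multilinear_Cons by (intro Cons.IH) auto
  qed
  ultimately show ?case by (simp add: cartan_d_linear)
qed simp

text \<open>The terms of the closed formula that involve the first argument x in the acting position
  or in the bracket make up L_x \<gamma>, the others make up - d iota_x \<gamma>. Skew-symmetry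
  enters twice: it puts [x, y_j] in the place of y_j, and it moves x in front of the remaining
  brackets.\<close>

lemma cartan_d_conv_sum:
  assumes "multilinear n \<gamma>" "alternating n \<gamma>" "length xs = Suc n"
  shows "cartan_d \<gamma> xs =
    (\<Sum>i<Suc n. (- 1) ^ i *\<^sub>C ac (xs ! i) (\<gamma> (nths xs (- {i})))) +
    (\<Sum>j<Suc n. \<Sum>i<j. (- 1) ^ (i + j) *\<^sub>C \<gamma> (brk (xs ! i) (xs ! j) # nths xs (- {i, j})))"
  using assms
proof (induction xs arbitrary: n \<gamma>)
  case (Cons x ys)
  then have len: "length ys = n" by simp
  have *: "cartan_d (\<lambda>zs. \<gamma> (x # zs)) ys =
    (\<Sum>i<n. (- 1) ^ i *\<^sub>C ac (ys ! i) (\<gamma> (x # nths ys (- {i})))) +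
    (\<Sum>j<n. \<Sum>i<j. (- 1) ^ (i + j) *\<^sub>C \<gamma> (x # brk (ys ! i) (ys ! j) # nths ys (- {i, j})))"
  proof (cases n)
    case 0
    then show ?thesis using len by simp
  next
    case (Suc m)
    then show ?thesis
      using Cons.prems multilinear_Cons alternating_Cons by (subst Cons.IH[of m]) auto
  qed
  have front: "(- 1) ^ j *\<^sub>C \<gamma> (brk x (ys ! j) # nths ys (- {j})) = \<gamma> (ys[j := brk x (ys ! j)])"
    if "j < n" for j
    using alternating_move_nth_to_front[of n \<gamma> ys j] Cons.prems that
    by (simp add: power_mult_distrib[symmetric])
  have swap: "\<gamma> (brk u v # x # nths ys (- {i, j})) = - \<gamma> (x # brk u v # nths ys (- {i, j}))"
    if "i < j" "j < n" for u v i j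
  proof (rule alternating_swap_hd)
    have "card {k. k < n \<and> k \<in> - {i, j}} = card ({..<n} - {i, j})"
      by (rule arg_cong[where f = card]) auto
    also have "\<dots> = n - 2" using that by (subst card_Diff_subset) auto
    finally have "length (nths ys (- {i, j})) = n - 2" by (simp add: length_nths len)
    then show "alternating (Suc (Suc (length (nths ys (- {i, j}))))) \<gamma>"
      using that Cons.prems by (simp add: Suc_diff_Suc numeral_2_eq_2)
  qed simp
  \<comment> \<open>Summands with i = 0 carry a bracket with x and become the Lie derivative. For i
    > 0 both indices shift by one, which leaves the sign unchanged; the minus sign comes from
    exchanging x with the bracket.\<close>
  have "(\<Sum>j<Suc n. \<Sum>i<j. (- 1) ^ (i + j) *\<^sub>C
        \<gamma> (brk ((x # ys) ! i) ((x # ys) ! j) # nths (x # ys) (- {i, j}))) =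
      (\<Sum>j<n. \<Sum>i<Suc j. (- 1) ^ (i + Suc j) *\<^sub>C
        \<gamma> (brk ((x # ys) ! i) (ys ! j) # nths (x # ys) (- {i, Suc j})))"
    unfolding sum.lessThan_Suc_shift[of _ n] by simp
  also have "\<dots> = (\<Sum>j<n. - \<gamma> (ys[j := brk x (ys ! j)]) -
        (\<Sum>i<j. (- 1) ^ (i + j) *\<^sub>C \<gamma> (x # brk (ys ! i) (ys ! j) # nths ys (- {i, j}))))"
    (is "(\<Sum>j<n. ?l j) = (\<Sum>j<n. ?r j)")
  proof (rule sum.cong)
    fix j assume "j \<in> {..<n}"
    then have j: "j < n" by simp
    have "?l j = - ((- 1) ^ j *\<^sub>C \<gamma> (brk x (ys ! j) # nths ys (- {j}))) +
        (\<Sum>i<j. (- 1) ^ (i + j) *\<^sub>C \<gamma> (brk (ys ! i) (ys ! j) # x # nths ys (- {i, j})))"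
      unfolding sum.lessThan_Suc_shift[of _ j] by (simp add: nths_remove_Cons)
    also have "(\<Sum>i<j. (- 1) ^ (i + j) *\<^sub>C \<gamma> (brk (ys ! i) (ys ! j) # x # nths ys (- {i, j}))) =
        - (\<Sum>i<j. (- 1) ^ (i + j) *\<^sub>C \<gamma> (x # brk (ys ! i) (ys ! j) # nths ys (- {i, j})))"
      unfolding sum_negf[symmetric]
      by (rule sum.cong) (simp_all only: swap[OF _ j] lessThan_iff scaleC.scale_minus_right)
    finally show "?l j = ?r j" by (simp only: front[OF j] diff_conv_add_uminus)
  qed simp
  finally have second: "(\<Sum>j<Suc n. \<Sum>i<j. (- 1) ^ (i + j) *\<^sub>C
        \<gamma> (brk ((x # ys) ! i) ((x # ys) ! j) # nths (x # ys) (- {i, j}))) = \<dots>" .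
  have first: "(\<Sum>i<Suc n. (- 1) ^ i *\<^sub>C ac ((x # ys) ! i) (\<gamma> (nths (x # ys) (- {i})))) =
      ac x (\<gamma> ys) - (\<Sum>i<n. (- 1) ^ i *\<^sub>C ac (ys ! i) (\<gamma> (x # nths ys (- {i}))))"
    unfolding sum.lessThan_Suc_shift by (simp add: nths_remove_Cons sum_negf)
  show ?case
    unfolding first second by (simp add: * lie_deriv_conv_sum len sum_negf sum_subtractf)
qed simp

end


section \<open>Coefficients of polynomials\<close>

lemma lookup_nth_list:
  "Poly_Mapping.lookup (Poly_Mapping.nth ms) i = (if i < length ms then ms ! i else 0)"
  by (simp add: nth_default_def)

lemma keys_nth_subset: "Poly_Mapping.keys (Poly_Mapping.nth ms) \<subseteq> {..<length ms}"
  by (auto simp only: in_keys_iff lookup_nth_list lessThan_iff split: if_splits)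

lemma nth_eq_nth_iff:
  assumes "length ms = length ms'"
  shows "Poly_Mapping.nth ms = Poly_Mapping.nth ms' \<longleftrightarrow> ms = ms'"
proof
  assume "Poly_Mapping.nth ms = Poly_Mapping.nth ms'"
  then have "Poly_Mapping.lookup (Poly_Mapping.nth ms) i = Poly_Mapping.lookup (Poly_Mapping.nth ms') i" for i
    by simp
  then show "ms = ms'"
    by (metis lookup_nth_list assms nth_equalityI)
qed simp

lemma nth_map_lookup:
  assumes "Poly_Mapping.keys e \<subseteq> {..<n}"
  shows "Poly_Mapping.nth (map (Poly_Mapping.lookup e) [0..<n]) = e"
proof (rule poly_mapping_eqI)
  fix i
  show "Poly_Mapping.lookup (Poly_Mapping.nth (map (Poly_Mapping.lookup e) [0..<n])) i = Poly_Mapping.lookup e i"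
    using assms by (auto simp: lookup_nth_list in_keys_iff simp del: lookup_nth)
qed

text \<open>\<open>Poly_Mapping.nth\<close> identifies the exponents in the first n variables with
  the lists of length n. This is the shape in which coefficients meet the values on
  \<open>map2 gen as ms\<close>.\<close>

lemma vars_below_eqI:
  assumes "vars_below n p" "vars_below n q"
    and "\<And>ms. length ms = n \<Longrightarrow>
      Poly_Mapping.lookup p (Poly_Mapping.nth ms) = Poly_Mapping.lookup q (Poly_Mapping.nth ms)"
  shows "p = q"
proof (rule poly_mapping_eqI)
  fix e
  show "Poly_Mapping.lookup p e = Poly_Mapping.lookup q e"
  proof (cases "Poly_Mapping.keys e \<subseteq> {..<n}")
    case True
    then show ?thesis
      using assms(3)[of "map (Poly_Mapping.lookup e) [0..<n]"] nth_map_lookup[OF True] by simp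
  next
    case False
    then show ?thesis
      using assms(1,2) by (metis vars_below_def in_keys_iff)
  qed
qed

lemma vars_belowI:
  "(\<And>e. Poly_Mapping.lookup p e \<noteq> 0 \<Longrightarrow> Poly_Mapping.keys e \<subseteq> {..<n}) \<Longrightarrow> vars_below n p"
  by (auto simp: vars_below_def in_keys_iff)

lemma vars_belowD:
  "vars_below n p \<Longrightarrow> \<not> Poly_Mapping.keys e \<subseteq> {..<n} \<Longrightarrow> Poly_Mapping.lookup p e = 0"
  by (auto simp: vars_below_def in_keys_iff)

lemma vars_below_0: "vars_below n 0"
  by (simp add: vars_below_def)

lemma vars_below_add: "vars_below n p \<Longrightarrow> vars_below n q \<Longrightarrow> vars_below n (p + q :: 'v::ab_group_add mpol)"
  by (rule vars_belowI) (metis vars_belowD lookup_add add_0)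

lemma vars_below_sum:
  "(\<And>i. i \<in> A \<Longrightarrow> vars_below n (f i)) \<Longrightarrow> vars_below n (\<Sum>i\<in>A. f i :: 'v::ab_group_add mpol)"
  by (induction A rule: infinite_finite_induct) (auto intro: vars_below_add vars_below_0)

lemma vars_below_scaleC: "vars_below n p \<Longrightarrow> vars_below n (c *\<^sub>C p)"
  by (rule vars_belowI) (metis vars_belowD lookup_scaleC scaleC.scale_zero_right)

lemma vars_below_del: "vars_below n p \<Longrightarrow> vars_below n (\<partial> p)"
  by (rule vars_belowI) (metis vars_belowD lookup_del del_0)

text \<open>Subtraction of exponents is truncated, so divisibility must be stated beside e - r. This
  is the origin of the conditions in \<open>lookup_monom_mult\<close> and
  \<open>lookup_monom_pmult\<close>.\<close>

lemma exponent_add_eq_iff: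
  fixes r k e :: "nat \<Rightarrow>\<^sub>0 nat"
  shows "r + k = e \<longleftrightarrow> k = e - r \<and> (\<forall>x. Poly_Mapping.lookup r x \<le> Poly_Mapping.lookup e x)"
proof
  assume "k = e - r \<and> (\<forall>x. Poly_Mapping.lookup r x \<le> Poly_Mapping.lookup e x)"
  then show "r + k = e"
    by (intro poly_mapping_eqI) (simp add: lookup_add lookup_minus)
qed (auto simp: lookup_add)

lemma lookup_monom_mult:
  fixes r e :: "nat \<Rightarrow>\<^sub>0 nat" and Q :: "complex mpol"
  shows "Poly_Mapping.lookup (Poly_Mapping.single r 1 * Q) e =
    (Poly_Mapping.lookup Q (e - r) when (\<forall>x. Poly_Mapping.lookup r x \<le> Poly_Mapping.lookup e x))"
proof (induction Q rule: poly_single_induct)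
  case (single k c)
  show ?case by (auto simp: exponent_add_eq_iff mult_single lookup_single when_def)
qed (simp add: distrib_left lookup_add when_def)

section \<open>Products with scalar polynomials\<close>

lemma pmult_add_left: "(P + Q) \<cdot> p = P \<cdot> p + Q \<cdot> p"
  unfolding pmult_def
  by (rule sum_keys_add[where g = "\<lambda>k x. \<Sum>l\<in>Poly_Mapping.keys p.
      Poly_Mapping.single (k + l) (x *\<^sub>C Poly_Mapping.lookup p l)"])
    (simp add: scaleC_add_left single_add sum.distrib)

lemma pmult_add_right: "P \<cdot> (p + q) = P \<cdot> p + P \<cdot> q"
  unfolding pmult_def sum.distrib[symmetric]
  by (intro sum.cong refl sum_keys_add[where g = "\<lambda>l x.
      Poly_Mapping.single (k + l) (Poly_Mapping.lookup P k *\<^sub>C x)" for k])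
    (simp add: scaleC_add_right single_add)

lemma pmult_sum_left: "(\<Sum>i\<in>A. f i) \<cdot> p = (\<Sum>i\<in>A. f i \<cdot> p)"
  by (induction A rule: infinite_finite_induct) (simp_all add: pmult_add_left, simp_all add: pmult_def)

lemma pmult_single_single: "Poly_Mapping.single k c \<cdot> Poly_Mapping.single l v = Poly_Mapping.single (k + l) (c *\<^sub>C v)"
proof -
  have "(\<Sum>l'\<in>Poly_Mapping.keys (Poly_Mapping.single l v). Poly_Mapping.single (k' + l')
      (c' *\<^sub>C Poly_Mapping.lookup (Poly_Mapping.single l v) l')) = Poly_Mapping.single (k' + l) (c' *\<^sub>C v)" for k' c'
    by (rule sum_keys_single) simp
  then show ?thesis
    unfolding pmult_def
    by (simp only:) (rule sum_keys_single[where g = "\<lambda>k' c'. Poly_Mapping.single (k' + l) (c' *\<^sub>C v)"], simp)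
qed

lemma lookup_pmult_const: "Poly_Mapping.lookup (P \<cdot> const v) e = Poly_Mapping.lookup P e *\<^sub>C v"
  by (induction P rule: poly_single_induct)
    (auto simp: pmult_add_left pmult_single_single lookup_add scaleC_add_left lookup_single when_def)

lemma lookup_monom_pmult:
  fixes k e :: "nat \<Rightarrow>\<^sub>0 nat"
  shows "Poly_Mapping.lookup (Poly_Mapping.single k 1 \<cdot> p) e =
    (Poly_Mapping.lookup p (e - k) when (\<forall>x. Poly_Mapping.lookup k x \<le> Poly_Mapping.lookup e x))"
proof (induction p rule: poly_single_induct)
  case (single l c)
  show ?case by (auto simp: exponent_add_eq_iff pmult_single_single lookup_single when_def)
qed (simp add: pmult_add_right lookup_add when_def)

lemma lookup_Var_pmult:
  "Poly_Mapping.lookup (Var i \<cdot> p) e =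
    (Poly_Mapping.lookup p (e - Poly_Mapping.single i 1) when Poly_Mapping.lookup e i \<noteq> 0)"
  unfolding Var_def lookup_monom_pmult
  by (rule arg_cong[where f = "\<lambda>b. _ when b"]) (auto simp: lookup_single when_def Suc_le_eq)

lemma nth_minus_single:
  assumes "i < length ms"
  shows "Poly_Mapping.nth ms - Poly_Mapping.single i k = Poly_Mapping.nth (ms[i := ms ! i - k])"
  using assms
  by (intro poly_mapping_eqI)
    (auto simp: lookup_minus lookup_nth_list lookup_single nth_list_update when_def simp del: lookup_nth)

lemma lookup_Var_pmult_nth:
  assumes "i < length ms"
  shows "Poly_Mapping.lookup (Var i \<cdot> p) (Poly_Mapping.nth ms) =
    (Poly_Mapping.lookup p (Poly_Mapping.nth (ms[i := ms ! i - 1])) when ms ! i \<noteq> 0)"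
  using assms by (simp add: lookup_Var_pmult nth_minus_single lookup_nth_list del: lookup_nth)

lemma vars_below_monom_pmult:
  assumes "vars_below n p" "Poly_Mapping.keys k \<subseteq> {..<n}"
  shows "vars_below n (Poly_Mapping.single k 1 \<cdot> p)"
proof (rule vars_belowI)
  fix e
  assume "Poly_Mapping.lookup (Poly_Mapping.single k 1 \<cdot> p) e \<noteq> 0"
  then have "Poly_Mapping.lookup p (e - k) \<noteq> 0"
    by (auto simp: lookup_monom_pmult when_def split: if_splits)
  then have "Poly_Mapping.keys (e - k) \<subseteq> {..<n}"
    using assms vars_belowD by metis
  then have "Poly_Mapping.keys k \<union> Poly_Mapping.keys (e - k) \<subseteq> {..<n}"
    using assms by simp
  moreover have "Poly_Mapping.keys e \<subseteq> Poly_Mapping.keys k \<union> Poly_Mapping.keys (e - k)"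
    by (auto simp: in_keys_iff lookup_minus)
  ultimately show "Poly_Mapping.keys e \<subseteq> {..<n}" by blast
qed

lemma vars_below_Var_pmult: "vars_below n p \<Longrightarrow> i < n \<Longrightarrow> vars_below n (Var i \<cdot> p)"
  unfolding Var_def by (rule vars_below_monom_pmult) auto

section \<open>Substitution of variables\<close>

lemma Var_power: "Var i ^ n = Poly_Mapping.single (Poly_Mapping.single i n) 1"
  by (induction n) (simp_all add: Var_def mult_single single_add[symmetric])

lemma prod_Var_power:
  "(\<Prod>l\<in>S. Var (\<rho> l) ^ k l) = Poly_Mapping.single (\<Sum>l\<in>S. Poly_Mapping.single (\<rho> l) (k l)) 1"
  by (induction S rule: infinite_finite_induct) (simp_all add: Var_power mult_single)

lemma lookup_sum_single_inj:
  assumes "finite S" "inj_on \<rho> S"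
  shows "Poly_Mapping.lookup (\<Sum>l\<in>S. Poly_Mapping.single (\<rho> l) (k l)) x =
    (if x \<in> \<rho> ` S then k (inv_into S \<rho> x) else 0)"
proof (cases "x \<in> \<rho> ` S")
  case True
  then obtain l where l: "l \<in> S" "x = \<rho> l" by blast
  have "(\<Sum>l'\<in>S. Poly_Mapping.lookup (Poly_Mapping.single (\<rho> l') (k l')) x) = (\<Sum>l'\<in>S. if l' = l then k l' else 0)"
    using l assms by (intro sum.cong) (auto simp: lookup_single when_def inj_on_def)
  then show ?thesis
    using l assms by (simp add: lookup_sum)
next
  case False
  then show ?thesis
    by (auto simp: lookup_sum lookup_single when_def intro!: sum.neutral)
qed

lemma sum_single_eq_iff:
  assumes "inj_on \<rho> {..<n}" "Poly_Mapping.keys k \<subseteq> {..<n}"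
  shows "(\<Sum>l<n. Poly_Mapping.single (\<rho> l) (Poly_Mapping.lookup k l)) = e \<longleftrightarrow>
    Poly_Mapping.keys e \<subseteq> \<rho> ` {..<n} \<and> k = Poly_Mapping.nth (map (\<lambda>l. Poly_Mapping.lookup e (\<rho> l)) [0..<n])"
    (is "?s = e \<longleftrightarrow> ?K \<and> ?N")
proof
  assume e: "?s = e"
  have "?K"
    unfolding e[symmetric] using assms by (auto simp: in_keys_iff lookup_sum_single_inj split: if_splits)
  moreover have "?N"
    unfolding e[symmetric] using assms
    by (intro poly_mapping_eqI)
      (auto simp: lookup_nth_list lookup_sum_single_inj in_keys_iff simp del: lookup_nth)
  ultimately show "?K \<and> ?N" ..
next
  assume *: "?K \<and> ?N"
  show "?s = e"
  proof (rule poly_mapping_eqI)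
    fix x
    have k: "Poly_Mapping.lookup k l = Poly_Mapping.lookup e (\<rho> l)" if "l < n" for l
      using * that by (simp add: lookup_nth_list del: lookup_nth)
    show "Poly_Mapping.lookup ?s x = Poly_Mapping.lookup e x"
      using * assms k by (auto simp: lookup_sum_single_inj in_keys_iff subset_iff)
  qed
qed

lemma monom_subst_below:
  fixes n :: nat
  assumes "Poly_Mapping.keys k \<subseteq> {..<n}"
  shows "(\<Prod>i\<in>Poly_Mapping.keys k. \<sigma> i ^ Poly_Mapping.lookup k i) =
    (\<Prod>i<n. (\<sigma> i :: 'r::comm_monoid_mult) ^ Poly_Mapping.lookup k i)"
  by (rule prod.mono_neutral_left[OF finite_lessThan assms]) (simp add: in_keys_iff)

lemma lookup_psubst:
  "Poly_Mapping.lookup (psubst \<sigma> p) e = (\<Sum>k\<in>Poly_Mapping.keys p.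
    Poly_Mapping.lookup (\<Prod>i\<in>Poly_Mapping.keys k. \<sigma> i ^ Poly_Mapping.lookup k i) e *\<^sub>C Poly_Mapping.lookup p k)"
  by (simp add: psubst_def lookup_sum lookup_pmult_const)

lemma sum_keys_delta:
  "(\<Sum>k\<in>Poly_Mapping.keys p. (c k when k = k0 \<and> Q) *\<^sub>C Poly_Mapping.lookup p k) =
    ((c k0 *\<^sub>C Poly_Mapping.lookup p k0) when Q)"
proof -
  have "(\<Sum>k\<in>Poly_Mapping.keys p. (c k when k = k0 \<and> Q) *\<^sub>C Poly_Mapping.lookup p k) =
      (\<Sum>k\<in>Poly_Mapping.keys p. if k = k0 then (c k *\<^sub>C Poly_Mapping.lookup p k) when Q else 0)"
    by (rule sum.cong) (auto simp: when_def)
  then show ?thesis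
    by (auto simp: in_keys_iff when_def)
qed

lemma sum_keys_delta_1:
  "(\<Sum>k\<in>Poly_Mapping.keys p. (1 when k = k0 \<and> Q) *\<^sub>C Poly_Mapping.lookup p k) =
    (Poly_Mapping.lookup p k0 when Q)"
  using sum_keys_delta[of "\<lambda>_. 1" k0 Q p] by simp

text \<open>Every monomial goes to a single monomial, and no two collide since the renaming is
  injective. Used for permutations of the variables and for the embedding of the variables that
  remain after some are omitted.\<close>

lemma lookup_psubst_Var:
  assumes p: "vars_below n p" and \<rho>: "inj_on \<rho> {..<n}" and \<sigma>: "\<And>l. l < n \<Longrightarrow> \<sigma> l = Var (\<rho> l)"
  shows "Poly_Mapping.lookup (psubst \<sigma> p) e =
    (Poly_Mapping.lookup p (Poly_Mapping.nth (map (\<lambda>l. Poly_Mapping.lookup e (\<rho> l)) [0..<n]))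
      when Poly_Mapping.keys e \<subseteq> \<rho> ` {..<n})"
    (is "_ = (Poly_Mapping.lookup p ?k0 when ?Q)")
proof -
  have "Poly_Mapping.lookup (\<Prod>i\<in>Poly_Mapping.keys k. \<sigma> i ^ Poly_Mapping.lookup k i) e =
      (1 when k = ?k0 \<and> ?Q)" if "k \<in> Poly_Mapping.keys p" for k
  proof -
    have k: "Poly_Mapping.keys k \<subseteq> {..<n}" using p that by (simp add: vars_below_def)
    have "(\<Prod>i\<in>Poly_Mapping.keys k. \<sigma> i ^ Poly_Mapping.lookup k i) =
        (\<Prod>l<n. Var (\<rho> l) ^ Poly_Mapping.lookup k l)"
      unfolding monom_subst_below[OF k] by (rule prod.cong) (simp_all add: \<sigma>)
    then show ?thesis
      using sum_single_eq_iff[OF \<rho> k, of e] by (auto simp: prod_Var_power lookup_single when_def)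
  qed
  then have "Poly_Mapping.lookup (psubst \<sigma> p) e =
      (\<Sum>k\<in>Poly_Mapping.keys p. (1 when k = ?k0 \<and> ?Q) *\<^sub>C Poly_Mapping.lookup p k)"
    unfolding lookup_psubst by (intro sum.cong refl) simp
  then show ?thesis by (simp add: sum_keys_delta_1)
qed

lemma lookup_of_nat_mult:
  "Poly_Mapping.lookup (of_nat c * (P :: complex mpol)) e = of_nat c * Poly_Mapping.lookup P e"
  by (induction c) (simp_all add: distrib_right lookup_add)

lemma lookup_Var_add_Var_power:
  assumes "i \<noteq> j"
  shows "Poly_Mapping.lookup ((Var i + Var j) ^ n) e =
    (of_nat (n choose Poly_Mapping.lookup e j)
      when Poly_Mapping.keys e \<subseteq> {i, j} \<and> Poly_Mapping.lookup e i + Poly_Mapping.lookup e j = n)"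
proof -
  have *: "Poly_Mapping.single j k + Poly_Mapping.single i (n - k) = e \<longleftrightarrow>
      k = Poly_Mapping.lookup e j \<and> Poly_Mapping.keys e \<subseteq> {i, j} \<and> Poly_Mapping.lookup e i + k = n"
    if "k \<le> n" for k
  proof
    assume e: "Poly_Mapping.single j k + Poly_Mapping.single i (n - k) = e"
    show "k = Poly_Mapping.lookup e j \<and> Poly_Mapping.keys e \<subseteq> {i, j} \<and> Poly_Mapping.lookup e i + k = n"
      unfolding e[symmetric] using assms that
      by (auto simp: lookup_add lookup_single when_def in_keys_iff split: if_splits)
  next
    assume "k = Poly_Mapping.lookup e j \<and> Poly_Mapping.keys e \<subseteq> {i, j} \<and> Poly_Mapping.lookup e i + k = n"
    then show "Poly_Mapping.single j k + Poly_Mapping.single i (n - k) = e"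
      using assms
      by (intro poly_mapping_eqI) (auto simp: lookup_add lookup_single when_def in_keys_iff subset_iff)
  qed
  have "Poly_Mapping.lookup ((Var i + Var j) ^ n) e =
      (\<Sum>k\<le>n. of_nat (n choose k) * (1 when Poly_Mapping.single j k + Poly_Mapping.single i (n - k) = e))"
    \<comment> \<open>The summands are swapped so that the summation index of the binomial theorem
      is the exponent of the variable j, as in the final formula.\<close>
    unfolding add.commute[of "Var i"] binomial_ring
    by (simp add: lookup_sum mult.assoc lookup_of_nat_mult Var_power mult_single lookup_single)
  also have "\<dots> = (\<Sum>k\<le>n. if k = Poly_Mapping.lookup e j then
      (of_nat (n choose k) when Poly_Mapping.keys e \<subseteq> {i, j} \<and> Poly_Mapping.lookup e i + k = n) else 0)"
    by (rule sum.cong) (auto simp: * when_def)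
  finally show ?thesis by (auto simp: when_def)
qed

text \<open>The substitution of the bracket terms of the differential. Only one monomial of p
  reaches e: its first exponent is the total degree of e in the variables i and j, the others are
  read off along \<rho>. The binomial coefficient comes from expanding the power of the sum.\<close>

lemma lookup_psubst_Var_add_Var:
  assumes p: "vars_below (Suc n) p" and \<rho>: "inj_on \<rho> {..<n}"
    and ij: "i \<noteq> j" "i \<notin> \<rho> ` {..<n}" "j \<notin> \<rho> ` {..<n}"
    and \<sigma>0: "\<sigma> 0 = Var i + Var j" and \<sigma>: "\<And>l. l < n \<Longrightarrow> \<sigma> (Suc l) = Var (\<rho> l)"
  shows "Poly_Mapping.lookup (psubst \<sigma> p) e =
    ((of_nat (Poly_Mapping.lookup e i + Poly_Mapping.lookup e j choose Poly_Mapping.lookup e j) *\<^sub>C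
      Poly_Mapping.lookup p (Poly_Mapping.nth ((Poly_Mapping.lookup e i + Poly_Mapping.lookup e j) #
        map (\<lambda>l. Poly_Mapping.lookup e (\<rho> l)) [0..<n])))
      when Poly_Mapping.keys e \<subseteq> insert i (insert j (\<rho> ` {..<n})))"
    (is "_ = ((?c *\<^sub>C Poly_Mapping.lookup p ?k0) when ?Q)")
proof -
  have "Poly_Mapping.lookup (\<Prod>i\<in>Poly_Mapping.keys k. \<sigma> i ^ Poly_Mapping.lookup k i) e =
      (?c when k = ?k0 \<and> ?Q)" if "k \<in> Poly_Mapping.keys p" for k
  proof -
    have k: "Poly_Mapping.keys k \<subseteq> {..<Suc n}" using p that by (simp add: vars_below_def)
    \<comment> \<open>The exponent contributed by the renamed variables; it does not involve i and
      j.\<close>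
    define r where "r = (\<Sum>l<n. Poly_Mapping.single (\<rho> l) (Poly_Mapping.lookup k (Suc l)))"
    have r: "Poly_Mapping.lookup r x =
        (if x \<in> \<rho> ` {..<n} then Poly_Mapping.lookup k (Suc (inv_into {..<n} \<rho> x)) else 0)" for x
      unfolding r_def using \<rho> by (simp add: lookup_sum_single_inj)
    have r': "Poly_Mapping.lookup r (\<rho> l) = Poly_Mapping.lookup k (Suc l)" if "l < n" for l
      using that \<rho> by (simp add: r)
    have k0: "k = ?k0 \<longleftrightarrow> Poly_Mapping.lookup k 0 = Poly_Mapping.lookup e i + Poly_Mapping.lookup e j \<and>
        (\<forall>l<n. Poly_Mapping.lookup k (Suc l) = Poly_Mapping.lookup e (\<rho> l))" (is "_ \<longleftrightarrow> ?R")
    proof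
      assume eq: "k = ?k0"
      show ?R
        by (subst (1 2) eq) (simp add: lookup_nth_list del: lookup_nth)
    next
      assume ?R
      show "k = ?k0"
      proof (rule poly_mapping_eqI)
        fix x
        show "Poly_Mapping.lookup k x = Poly_Mapping.lookup ?k0 x"
          using \<open>?R\<close> k
          by (cases x) (auto simp: lookup_nth_list in_keys_iff subset_iff simp del: lookup_nth)
      qed
    qed
    have "(\<Prod>i\<in>Poly_Mapping.keys k. \<sigma> i ^ Poly_Mapping.lookup k i) =
        (Var i + Var j) ^ Poly_Mapping.lookup k 0 * Poly_Mapping.single r 1"
    proof -
      have "(\<Prod>l<n. \<sigma> (Suc l) ^ Poly_Mapping.lookup k (Suc l)) = Poly_Mapping.single r 1"
        unfolding r_def prod_Var_power[symmetric] by (rule prod.cong) (simp_all add: \<sigma>)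
      then show ?thesis
        unfolding monom_subst_below[OF k] prod.lessThan_Suc_shift by (simp add: \<sigma>0)
    qed
    then have "Poly_Mapping.lookup (\<Prod>i\<in>Poly_Mapping.keys k. \<sigma> i ^ Poly_Mapping.lookup k i) e =
        ((of_nat (Poly_Mapping.lookup k 0 choose Poly_Mapping.lookup (e - r) j)
        when Poly_Mapping.keys (e - r) \<subseteq> {i, j} \<and>
          Poly_Mapping.lookup (e - r) i + Poly_Mapping.lookup (e - r) j = Poly_Mapping.lookup k 0)
        when (\<forall>x. Poly_Mapping.lookup r x \<le> Poly_Mapping.lookup e x))"
      by (simp add: mult.commute[of _ "Poly_Mapping.single r 1"] lookup_monom_mult
          lookup_Var_add_Var_power[OF ij(1)])
    moreover have "Poly_Mapping.lookup (e - r) i = Poly_Mapping.lookup e i"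
      "Poly_Mapping.lookup (e - r) j = Poly_Mapping.lookup e j"
      using ij by (simp_all add: lookup_minus r)
    \<comment> \<open>If r divides e and the quotient involves only i and j, then r agrees with e at
      every other variable, and there r lives on the image of \<rho>.\<close>
    moreover have "(\<forall>x. Poly_Mapping.lookup r x \<le> Poly_Mapping.lookup e x) \<and> Poly_Mapping.keys (e - r) \<subseteq> {i, j} \<longleftrightarrow>
        (\<forall>l<n. Poly_Mapping.lookup k (Suc l) = Poly_Mapping.lookup e (\<rho> l)) \<and> ?Q" (is "?A \<longleftrightarrow> ?B")
    proof
      assume A: ?A
      have eq: "Poly_Mapping.lookup r x = Poly_Mapping.lookup e x" if "x \<noteq> i" "x \<noteq> j" for x
      proof -
        have "Poly_Mapping.lookup (e - r) x = 0" using A that by (auto simp: in_keys_iff subset_iff)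
        then show ?thesis using A by (simp add: lookup_minus) (metis le_antisym)
      qed
      have "Poly_Mapping.lookup k (Suc l) = Poly_Mapping.lookup e (\<rho> l)" if "l < n" for l
        using eq[of "\<rho> l"] r'[OF that] that ij by auto
      moreover have ?Q
      proof
        fix x assume "x \<in> Poly_Mapping.keys e"
        then show "x \<in> insert i (insert j (\<rho> ` {..<n}))"
          using eq[of x] by (cases "x = i \<or> x = j") (auto simp: r in_keys_iff split: if_splits)
      qed
      ultimately show ?B by blast
    next
      assume B: ?B
      have eq: "Poly_Mapping.lookup r x = Poly_Mapping.lookup e x" if "x \<noteq> i" "x \<noteq> j" for x
      proof (cases "x \<in> \<rho> ` {..<n}")
        case True
        then show ?thesis using B r' by auto
      next
        case False
        then show ?thesis using B that by (auto simp: r in_keys_iff subset_iff)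
      qed
      have z: "Poly_Mapping.lookup r i = 0" "Poly_Mapping.lookup r j = 0" using ij by (simp_all add: r)
      have "Poly_Mapping.lookup r x \<le> Poly_Mapping.lookup e x" for x
        using eq[of x] z by (cases "x = i \<or> x = j") auto
      moreover have "Poly_Mapping.keys (e - r) \<subseteq> {i, j}"
        using eq by (auto simp: in_keys_iff lookup_minus) (metis order_refl)
      ultimately show ?A by blast
    qed
    ultimately show ?thesis
      by (auto simp: k0 when_def)
  qed
  then have "Poly_Mapping.lookup (psubst \<sigma> p) e =
      (\<Sum>k\<in>Poly_Mapping.keys p. (?c when k = ?k0 \<and> ?Q) *\<^sub>C Poly_Mapping.lookup p k)"
    unfolding lookup_psubst by (intro sum.cong refl) simp
  then show ?thesis by (simp only: sum_keys_delta[where c = "\<lambda>_. ?c"])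
qed

section \<open>Coefficients of the bilinear extension \<open>lam\<close>\<close>

lemma lookup_lam_const_left:
  assumes "\<And>v. f 0 v = 0"
  shows "Poly_Mapping.lookup (lam f q (const a) V) e =
    (\<Sum>l\<in>Poly_Mapping.keys V. \<Sum>n\<in>Poly_Mapping.keys (f a (Poly_Mapping.lookup V l)).
      Poly_Mapping.lookup (Poly_Mapping.single l 1 * q ^ n) e *\<^sub>C Poly_Mapping.lookup (f a (Poly_Mapping.lookup V l)) n)"
proof -
  have "lam f q (const a) V = (\<Sum>l\<in>Poly_Mapping.keys V. \<Sum>n\<in>Poly_Mapping.keys (f a (Poly_Mapping.lookup V l)).
      (Poly_Mapping.single l 1 * q ^ n) \<cdot> const (Poly_Mapping.lookup (f a (Poly_Mapping.lookup V l)) n))"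
    unfolding lam_def Let_def
    by (rule trans[OF sum_keys_single[where g = "\<lambda>k x. \<Sum>l\<in>Poly_Mapping.keys V.
        \<Sum>n\<in>Poly_Mapping.keys (f x (Poly_Mapping.lookup V l)).
        (Poly_Mapping.single (k + l) 1 * q ^ n) \<cdot> const (Poly_Mapping.lookup (f x (Poly_Mapping.lookup V l)) n)"]])
      (simp_all add: assms)
  then show ?thesis by (simp add: lookup_sum lookup_pmult_const)
qed

lemma lookup_lam_const_right:
  assumes "\<And>a. f a 0 = 0"
  shows "Poly_Mapping.lookup (lam f q P (const v)) e =
    (\<Sum>k\<in>Poly_Mapping.keys P. \<Sum>n\<in>Poly_Mapping.keys (f (Poly_Mapping.lookup P k) v).
      Poly_Mapping.lookup (Poly_Mapping.single k 1 * q ^ n) e *\<^sub>C Poly_Mapping.lookup (f (Poly_Mapping.lookup P k) v) n)"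
proof -
  have "(\<Sum>l\<in>Poly_Mapping.keys (const v). \<Sum>n\<in>Poly_Mapping.keys (f x (Poly_Mapping.lookup (const v) l)).
        (Poly_Mapping.single (k + l) 1 * q ^ n) \<cdot> const (Poly_Mapping.lookup (f x (Poly_Mapping.lookup (const v) l)) n)) =
      (\<Sum>n\<in>Poly_Mapping.keys (f x v). (Poly_Mapping.single k 1 * q ^ n) \<cdot> const (Poly_Mapping.lookup (f x v) n))" for k x
    by (rule trans[OF sum_keys_single[where g = "\<lambda>l y.
        \<Sum>n\<in>Poly_Mapping.keys (f x y).
        (Poly_Mapping.single (k + l) 1 * q ^ n) \<cdot> const (Poly_Mapping.lookup (f x y) n)"]])
      (simp_all add: assms)
  then show ?thesis
    unfolding lam_def Let_def by (simp add: lookup_sum lookup_pmult_const)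
qed

text \<open>As the variable i does not occur in V, a monomial of the result splits uniquely: its
  power of that variable comes from f, the rest from V.\<close>

lemma lookup_lam_Var:
  assumes f: "\<And>v. f 0 v = 0" "\<And>a. f a 0 = 0"
    and V: "\<And>l. l \<in> Poly_Mapping.keys V \<Longrightarrow> Poly_Mapping.lookup l i = 0"
  shows "Poly_Mapping.lookup (lam f (Var i) (const a) V) e =
    Poly_Mapping.lookup (f a (Poly_Mapping.lookup V (e - Poly_Mapping.single i (Poly_Mapping.lookup e i))))
      (Poly_Mapping.lookup e i)"
proof -
  let ?e = "e - Poly_Mapping.single i (Poly_Mapping.lookup e i)"
  have *: "l + Poly_Mapping.single i n = e \<longleftrightarrow> l = ?e \<and> n = Poly_Mapping.lookup e i"
    if "l \<in> Poly_Mapping.keys V" for l n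
    using V[OF that]
    by (auto simp: poly_mapping_eq_iff fun_eq_iff lookup_add lookup_minus lookup_single when_def)
  have "Poly_Mapping.lookup (lam f (Var i) (const a) V) e =
    (\<Sum>l\<in>Poly_Mapping.keys V. \<Sum>n\<in>Poly_Mapping.keys (f a (Poly_Mapping.lookup V l)).
      (1 when n = Poly_Mapping.lookup e i \<and> l = ?e) *\<^sub>C Poly_Mapping.lookup (f a (Poly_Mapping.lookup V l)) n)"
    unfolding lookup_lam_const_left[of f, OF f(1)]
    by (intro sum.cong refl) (simp add: Var_power mult_single lookup_single * conj_commute)
  also have "\<dots> = (\<Sum>l\<in>Poly_Mapping.keys V. if l = ?e then
      Poly_Mapping.lookup (f a (Poly_Mapping.lookup V l)) (Poly_Mapping.lookup e i) else 0)"
    unfolding sum_keys_delta_1 by (intro sum.cong refl) (simp add: when_def)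
  finally show ?thesis by (auto simp: in_keys_iff f)
qed

lemma lam_Var_const_const:
  assumes f: "\<And>v. f 0 v = 0" "\<And>a. f a 0 = 0"
  shows "lam f (Var i) (const a) (const b) =
    (\<Sum>n\<in>Poly_Mapping.keys (f a b). Poly_Mapping.single (Poly_Mapping.single i n) (Poly_Mapping.lookup (f a b) n))"
  (is "_ = ?r")
proof (rule poly_mapping_eqI)
  fix e :: "nat \<Rightarrow>\<^sub>0 nat"
  let ?e = "e - Poly_Mapping.single i (Poly_Mapping.lookup e i)"
  have *: "Poly_Mapping.single i n = e \<longleftrightarrow> n = Poly_Mapping.lookup e i \<and> ?e = 0" for n
    by (auto simp: poly_mapping_eq_iff fun_eq_iff lookup_minus lookup_single when_def)
  have "Poly_Mapping.lookup ?r e = (\<Sum>n\<in>Poly_Mapping.keys (f a b).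
      (1 when n = Poly_Mapping.lookup e i \<and> ?e = 0) *\<^sub>C Poly_Mapping.lookup (f a b) n)"
    by (simp add: lookup_sum lookup_single * when_def) (intro sum.cong refl, auto)
  also have "\<dots> = (Poly_Mapping.lookup (f a b) (Poly_Mapping.lookup e i) when ?e = 0)"
    by (rule sum_keys_delta_1)
  also have "\<dots> = Poly_Mapping.lookup (lam f (Var i) (const a) (const b)) e"
    using f by (subst lookup_lam_Var[of f, OF f]) (auto simp: lookup_single when_def split: if_splits)
  finally show "Poly_Mapping.lookup (lam f (Var i) (const a) (const b)) e = Poly_Mapping.lookup ?r e" ..
qed

lemma single_single_inj: "inj (Poly_Mapping.single (i :: nat) :: nat \<Rightarrow> nat \<Rightarrow>\<^sub>0 nat)"
  by (rule injI) (metis lookup_single_eq)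

text \<open>Distinct powers of one variable are distinct monomials, so the sum over multivariate
  exponents is a sum over powers of \<lambda>. Needed where a bracket is inserted into
  \<open>lam\<close> or \<open>eval_at_hd\<close>.\<close>

lemma sum_keys_lam_Var_const_const:
  assumes f: "\<And>v. f 0 v = 0" "\<And>a. f a 0 = 0"
  shows "(\<Sum>k\<in>Poly_Mapping.keys (lam f (Var i) (const a) (const b)).
      g k (Poly_Mapping.lookup (lam f (Var i) (const a) (const b)) k)) =
    (\<Sum>n\<in>Poly_Mapping.keys (f a b). g (Poly_Mapping.single i n) (Poly_Mapping.lookup (f a b) n))"
proof -
  let ?r = "lam f (Var i) (const a) (const b)"
  have l: "Poly_Mapping.lookup ?r (Poly_Mapping.single i n) = Poly_Mapping.lookup (f a b) n" for n
    by (subst lookup_lam_Var[of f, OF f]) (auto split: if_splits)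
  have "k \<in> Poly_Mapping.single i ` Poly_Mapping.keys (f a b)" if "k \<in> Poly_Mapping.keys ?r" for k
  proof -
    have "Poly_Mapping.lookup ?r k = 0" if "k \<notin> Poly_Mapping.single i ` Poly_Mapping.keys (f a b)"
      unfolding lam_Var_const_const[of f, OF f] lookup_sum
      by (rule sum.neutral) (use that in \<open>auto simp: lookup_single when_def\<close>)
    then show ?thesis using that by (auto simp: in_keys_iff)
  qed
  then have "Poly_Mapping.keys ?r = Poly_Mapping.single i ` Poly_Mapping.keys (f a b)"
    by (auto simp: in_keys_iff l)
  then show ?thesis
    by (simp add: sum.reindex inj_on_subset[OF single_single_inj] l)
qed


section \<open>The annihilation algebra is a Lie algebra acting on the module\<close>

lemma sum_keys_eq_sum_atMost:
  fixes p :: "nat \<Rightarrow>\<^sub>0 'v::zero"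
  assumes "\<And>k. g k 0 = 0" "\<And>k. N < k \<Longrightarrow> g k (Poly_Mapping.lookup p k) = 0"
  shows "(\<Sum>k\<in>Poly_Mapping.keys p. g k (Poly_Mapping.lookup p k)) = (\<Sum>k\<le>N. g k (Poly_Mapping.lookup p k))"
proof -
  have "(\<Sum>k\<in>Poly_Mapping.keys p. g k (Poly_Mapping.lookup p k)) =
      (\<Sum>k\<in>Poly_Mapping.keys p \<union> {..N}. g k (Poly_Mapping.lookup p k))"
    using assms(1) by (intro sum_keys_superset) auto
  also have "\<dots> = (\<Sum>k\<le>N. g k (Poly_Mapping.lookup p k))"
    using assms(2) by (intro sum.mono_neutral_right) auto
  finally show ?thesis .
qed

text \<open>Both sides equal m! (m + n - l)! / (m - l)!. The binomial on the left arises from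
  expanding a power of a sum of two variables, the one on the right belongs to the bracket of the
  annihilation algebra, and the factorials turn coefficients into n-th products. It is needed for
  the action and again for the bracket terms of the differential.\<close>

lemma fact_mult_binomial:
  assumes "l \<le> m"
  shows "fact m * fact n * of_nat (m + n - l choose n) =
    (of_nat (m choose l) * fact l * fact (m + n - l) :: 'a::field_char_0)"
proof -
  have fact_m: "of_nat (m choose l) * fact l * fact (m - l) = (fact m :: 'a)"
    using assms by (simp add: binomial_fact)
  have "fact (m + n - l) = (fact n * fact (m - l) * of_nat (m + n - l choose n) :: 'a)"
    using assms by (simp add: binomial_fact)
  then show ?thesis
    unfolding fact_m[symmetric] by (simp add: ac_simps)
qed

section \<open>The commutator formula for n-th products\<close>

context conformal_module
begin

lemma br_0 [simp]: "br 0 b = 0" "br a 0 = 0"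
  using clinear_0[OF br_linear_left] clinear_0[OF br_linear_right] by simp_all

lemma act_0 [simp]: "act 0 v = 0" "act a 0 = 0"
  using clinear_0[OF act_linear_left] clinear_0[OF act_linear_right] by simp_all

lemma lookup_act_Var_Var:
  assumes "i \<noteq> j"
  shows "Poly_Mapping.lookup (lam act (Var i) (const a) (lam act (Var j) (const b) (const v)))
      (Poly_Mapping.single i m + Poly_Mapping.single j n) =
    Poly_Mapping.lookup (act a (Poly_Mapping.lookup (act b v) n)) m"
proof -
  have "Poly_Mapping.lookup l i = 0"
    if "l \<in> Poly_Mapping.keys (lam act (Var j) (const b) (const v))" for l
  proof (rule ccontr)
    assume "Poly_Mapping.lookup l i \<noteq> 0"
    moreover have "\<exists>n\<in>Poly_Mapping.keys (act b v). Poly_Mapping.single j n = l"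
    proof (rule ccontr)
      assume "\<not> ?thesis"
      then have "Poly_Mapping.lookup (lam act (Var j) (const b) (const v)) l = 0"
        by (subst lam_Var_const_const) (auto simp: lookup_sum lookup_single when_def intro!: sum.neutral)
      then show False using that by (simp add: in_keys_iff)
    qed
    ultimately show False using assms by (auto simp: lookup_single)
  qed
  moreover have "Poly_Mapping.single i m + Poly_Mapping.single j n - Poly_Mapping.single i m = Poly_Mapping.single j n"
    by simp
  ultimately show ?thesis
    using assms
    by (subst lookup_lam_Var, simp, simp, simp)
      (subst lookup_lam_Var, auto simp: lookup_add lookup_single split: if_splits)
qed

text \<open>If the bracket contributes the l-th power of the variable i, the sum of the variables
  must occur to the power m + n - l, and the monomial with exponents m - l and n has the stated
  binomial coefficient in it. For l > m there is no contribution.\<close>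

lemma lookup_act_Var_add_Var:
  assumes "i \<noteq> j"
  shows "Poly_Mapping.lookup (lam act (Var i + Var j) (lam br (Var i) (const a) (const b)) (const v))
      (Poly_Mapping.single i m + Poly_Mapping.single j n) =
    (\<Sum>l\<le>m. of_nat (m + n - l choose n) *\<^sub>C
      Poly_Mapping.lookup (act (Poly_Mapping.lookup (br a b) l) v) (m + n - l))"
proof -
  let ?e = "Poly_Mapping.single i m + Poly_Mapping.single j n"
  have coeff: "Poly_Mapping.lookup (Poly_Mapping.single (Poly_Mapping.single i l) 1 * (Var i + Var j) ^ s) ?e =
      (of_nat (m + n - l choose n) when s = m + n - l \<and> l \<le> m)" for l s
  proof -
    have "(\<forall>x. Poly_Mapping.lookup (Poly_Mapping.single i l) x \<le> Poly_Mapping.lookup ?e x) \<longleftrightarrow> l \<le> m"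
      using assms by (auto simp: lookup_add lookup_single when_def dest: spec[of _ i])
    moreover have "Poly_Mapping.lookup (?e - Poly_Mapping.single i l) x =
        (if x = i then m - l else if x = j then n else 0)" for x
      using assms by (auto simp: lookup_add lookup_minus lookup_single when_def)
    moreover have "Poly_Mapping.keys (?e - Poly_Mapping.single i l) \<subseteq> {i, j}"
      using calculation(2) by (auto simp: in_keys_iff split: if_splits)
    ultimately show ?thesis
      using assms by (auto simp: lookup_monom_mult lookup_Var_add_Var_power when_def)
  qed
  have "Poly_Mapping.lookup (lam act (Var i + Var j) (lam br (Var i) (const a) (const b)) (const v)) ?e =
      (\<Sum>l\<in>Poly_Mapping.keys (br a b). \<Sum>s\<in>Poly_Mapping.keys (act (Poly_Mapping.lookup (br a b) l) v).
        (of_nat (m + n - l choose n) when s = m + n - l \<and> l \<le> m) *\<^sub>C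
          Poly_Mapping.lookup (act (Poly_Mapping.lookup (br a b) l) v) s)"
    unfolding lookup_lam_const_right[of act, OF act_0(2)]
    by (subst sum_keys_lam_Var_const_const[where g = "\<lambda>k x. \<Sum>n\<in>Poly_Mapping.keys (act x v).
        Poly_Mapping.lookup (Poly_Mapping.single k 1 * (Var i + Var j) ^ n) ?e *\<^sub>C Poly_Mapping.lookup (act x v) n"])
      (simp_all add: coeff)
  also have "\<dots> = (\<Sum>l\<in>Poly_Mapping.keys (br a b).
      ((of_nat (m + n - l choose n) *\<^sub>C Poly_Mapping.lookup (act (Poly_Mapping.lookup (br a b) l) v) (m + n - l)) when l \<le> m))"
    by (intro sum.cong refl) (rule sum_keys_delta)
  also have "\<dots> = (\<Sum>l\<le>m. ((of_nat (m + n - l choose n) *\<^sub>C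
      Poly_Mapping.lookup (act (Poly_Mapping.lookup (br a b) l) v) (m + n - l)) when l \<le> m))"
    by (rule sum_keys_eq_sum_atMost[where g = "\<lambda>l x. ((of_nat (m + n - l choose n) *\<^sub>C
      Poly_Mapping.lookup (act x v) (m + n - l)) when l \<le> m)"]) simp_all
  finally show ?thesis by simp
qed

text \<open>The coefficient of \<lambda>^m \<mu>^n in the module axiom, multiplied by m! n!. It says
  that the annihilation algebra acts on the module, and for the adjoint module it is the source of
  the Jacobi identity.\<close>

lemma nprod_commutator:
  "nprod act m a (nprod act n b v) - nprod act n b (nprod act m a v) =
    (\<Sum>l\<le>m. of_nat (m choose l) *\<^sub>C nprod act (m + n - l) (nprod br l a b) v)"
proof -
  let ?e = "Poly_Mapping.single 0 m + Poly_Mapping.single 1 n :: nat \<Rightarrow>\<^sub>0 nat"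
  have "Poly_Mapping.lookup (act a (Poly_Mapping.lookup (act b v) n)) m -
      Poly_Mapping.lookup (act b (Poly_Mapping.lookup (act a v) m)) n =
      (\<Sum>l\<le>m. of_nat (m + n - l choose n) *\<^sub>C
        Poly_Mapping.lookup (act (Poly_Mapping.lookup (br a b) l) v) (m + n - l))"
    using arg_cong[OF act_act[of a b v], of "\<lambda>p. Poly_Mapping.lookup p ?e"]
    using lookup_act_Var_Var[of 0 1 a b v m n] lookup_act_Var_Var[of 1 0 b a v n m]
      lookup_act_Var_add_Var[of 0 1 a b v m n]
    by (simp add: lookup_minus add.commute)
  then have "(fact m * fact n) *\<^sub>C Poly_Mapping.lookup (act a (Poly_Mapping.lookup (act b v) n)) m -
      (fact m * fact n) *\<^sub>C Poly_Mapping.lookup (act b (Poly_Mapping.lookup (act a v) m)) n =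
      (\<Sum>l\<le>m. (fact m * fact n * of_nat (m + n - l choose n)) *\<^sub>C
        Poly_Mapping.lookup (act (Poly_Mapping.lookup (br a b) l) v) (m + n - l))"
    by (simp add: scaleC.scale_right_diff_distrib[symmetric] scaleC.scale_sum_right)
  moreover have "nprod act m a (nprod act n b v) =
      (fact m * fact n) *\<^sub>C Poly_Mapping.lookup (act a (Poly_Mapping.lookup (act b v) n)) m" for m n a b
    using act_linear_right by (simp add: nprod_def clinear_iff)
  moreover have "nprod act (m + n - l) (nprod br l a b) v =
      (fact l * fact (m + n - l)) *\<^sub>C Poly_Mapping.lookup (act (Poly_Mapping.lookup (br a b) l) v) (m + n - l)" for l
    using act_linear_left by (simp add: nprod_def clinear_iff mult.commute)
  ultimately show ?thesis
    by (simp add: fact_mult_binomial mult.assoc[symmetric] add.commute[of n]) (simp add: mult.commute)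
qed

end

section \<open>Generators of the annihilation algebra and binomial sums\<close>

lemma annih_induct [case_names gen add]:
  assumes gen: "\<And>a n. P (gen a n)" and add: "\<And>x y. P x \<Longrightarrow> P y \<Longrightarrow> P (x + y)"
  shows "P (x :: 'a::del_module annih)"
proof -
  have "P (abs_annih p)" for p :: "nat \<Rightarrow>\<^sub>0 'a"
  proof (induction p rule: poly_single_induct)
    case (single k x)
    then show ?case using gen[of x k] by (simp add: gen.abs_eq)
  next
    case (add p q)
    then show ?case using assms(2) by (simp add: plus_annih.abs_eq[symmetric])
  qed
  then show ?thesis by (metis Quotient3_abs_rep[OF Quotient3_annih])
qed

lemma annih_abs_cases:
  obtains p where "x = abs_annih p"
  by (metis Quotient3_abs_rep[OF Quotient3_annih])

lemma gen_linear: "clinear (\<lambda>a. gen a n)"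
  by (rule clinearI)
    (simp_all add: gen.abs_eq plus_annih.abs_eq scaleC_annih.abs_eq single_add scaleC_single)

lemma gen_linear_simps:
  "gen (a + b) n = gen a n + gen b n" "gen (c *\<^sub>C a) n = c *\<^sub>C gen a n" "gen 0 n = 0"
  by (simp_all add: gen_linear[unfolded clinear_iff] clinear_0[OF gen_linear])

text \<open>Pascal's rule in operator form: (1 + S)^(p+1) = (1 + S)^p (1 + S) for the shift S,
  evaluated on the sequence Z at 0.\<close>

lemma sum_binomial_Suc:
  "(\<Sum>i\<le>Suc p. of_nat (Suc p choose i) *\<^sub>C Z i) =
    (\<Sum>i\<le>p. of_nat (p choose i) *\<^sub>C (Z i + Z (Suc i)) :: 'v::complex_vector)"
proof -
  have "(\<Sum>i\<le>Suc p. of_nat (Suc p choose i) *\<^sub>C Z i) =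
      Z 0 + (\<Sum>i\<le>p. of_nat (p choose Suc i) *\<^sub>C Z (Suc i)) + (\<Sum>i\<le>p. of_nat (p choose i) *\<^sub>C Z (Suc i))"
    by (subst sum.atMost_Suc_shift) (simp add: scaleC_add_left sum.distrib algebra_simps)
  also have "Z 0 + (\<Sum>i\<le>p. of_nat (p choose Suc i) *\<^sub>C Z (Suc i)) = (\<Sum>i\<le>Suc p. of_nat (p choose i) *\<^sub>C Z i)"
    by (subst sum.atMost_Suc_shift) simp
  finally show ?thesis by (simp add: scaleC_add_right sum.distrib)
qed

text \<open>Vandermonde's identity, as the composition of the two shifts \<open>(1 + S)\<^sup>p\<close> and \<open>(1 + S)\<^sup>q\<close>.\<close>

lemma sum_vandermonde:
  "(\<Sum>i\<le>p. \<Sum>j\<le>q. (of_nat (p choose i) * of_nat (q choose j)) *\<^sub>C Y (i + j)) =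
    (\<Sum>s\<le>p + q. of_nat (p + q choose s) *\<^sub>C Y s :: 'v::complex_vector)"
proof (induction p arbitrary: Y)
  case (Suc p)
  have "(\<Sum>i\<le>Suc p. \<Sum>j\<le>q. (of_nat (Suc p choose i) * of_nat (q choose j)) *\<^sub>C Y (i + j)) =
      (\<Sum>i\<le>Suc p. of_nat (Suc p choose i) *\<^sub>C (\<Sum>j\<le>q. of_nat (q choose j) *\<^sub>C Y (i + j)))"
    by (simp add: scaleC.scale_sum_right del: sum.atMost_Suc binomial_Suc_Suc)
  also have "\<dots> = (\<Sum>i\<le>p. \<Sum>j\<le>q. (of_nat (p choose i) * of_nat (q choose j)) *\<^sub>C (Y (i + j) + Y (Suc (i + j))))"
    unfolding sum_binomial_Suc by (simp add: scaleC.scale_sum_right scaleC_add_right sum.distrib)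
  also have "\<dots> = (\<Sum>s\<le>p + q. of_nat (p + q choose s) *\<^sub>C (Y s + Y (Suc s)))"
    by (rule Suc.IH)
  also have "\<dots> = (\<Sum>s\<le>Suc (p + q). of_nat (Suc (p + q) choose s) *\<^sub>C Y s)"
    by (rule sum_binomial_Suc[symmetric])
  finally show ?case by simp
qed simp

lemma sum_atMost_nested:
  "(\<Sum>i\<le>m. \<Sum>l\<le>i. f i l) = (\<Sum>l\<le>m. \<Sum>k\<le>m - l. f (l + k) l :: 'v::comm_monoid_add)" for m :: nat
  unfolding sum.Sigma[OF finite_atMost ballI[OF finite_atMost]]
  by (rule sum.reindex_bij_witness[of _ "\<lambda>(l, k). (l + k, l)" "\<lambda>(i, l). (l, i - l)"]) auto

text \<open>Both sides are the coefficient of \<open>x\<^sup>s\<close> in \<open>(1 + x)\<^sup>n ((1 + x) - x)\<^sup>m\<close>.\<close>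

lemma alternating_sum_binomial:
  "(\<Sum>j\<le>m. if j \<le> s then (- 1) ^ j * of_nat ((m choose j) * (m + n - j choose (s - j))) else 0) =
    (of_nat (n choose s) :: 'a::comm_ring_1)"
proof (induction m arbitrary: n s)
  case (Suc m)
  let ?f = "\<lambda>m n s j. if j \<le> s then (- 1) ^ j * of_nat ((m choose j) * (m + n - j choose (s - j))) else (0::'a)"
  let ?g = "\<lambda>i. if i \<le> s then (- 1) ^ i * of_nat (Suc m + n - i choose (s - i)) else (0::'a)"
  have "(\<Sum>j\<le>Suc m. of_nat (Suc m choose j) * ?g j) = (\<Sum>j\<le>m. of_nat (m choose j) * (?g j + ?g (Suc j)))"
  proof -
    have "(\<Sum>j\<le>Suc m. of_nat (Suc m choose j) * ?g j) =
        ?g 0 + (\<Sum>i\<le>m. of_nat (m choose Suc i) * ?g (Suc i)) + (\<Sum>i\<le>m. of_nat (m choose i) * ?g (Suc i))"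
      by (subst sum.atMost_Suc_shift) (simp add: sum.distrib algebra_simps binomial_eq_0)
    also have "?g 0 + (\<Sum>i\<le>m. of_nat (m choose Suc i) * ?g (Suc i)) = (\<Sum>i\<le>Suc m. of_nat (m choose i) * ?g i)"
      by (subst sum.atMost_Suc_shift) (simp only: binomial_n_0 of_nat_1 mult_1_left)
    finally show ?thesis by (simp add: distrib_left sum.distrib binomial_eq_0)
  qed
  also have "(\<Sum>j\<le>Suc m. of_nat (Suc m choose j) * ?g j) = (\<Sum>j\<le>Suc m. ?f (Suc m) n s j)"
    by (intro sum.cong refl) (simp add: algebra_simps del: binomial_Suc_Suc)
  \<comment> \<open>One factor (1 + x) - x is split off: its first summand turns n into n + 1, its
    second lowers s by one, and it contributes nothing when s = 0. Pascal's rule then combines the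
    two values.\<close>
  also have "(\<Sum>j\<le>m. of_nat (m choose j) * (?g j + ?g (Suc j))) =
      (\<Sum>j\<le>m. ?f m (Suc n) s j - (if s = 0 then 0 else ?f m n (s - 1) j))"
    by (intro sum.cong refl) (cases s, auto simp: algebra_simps Suc_diff_le)
  also have "\<dots> = of_nat (Suc n choose s) - (if s = 0 then 0 else of_nat (n choose (s - 1)))"
    unfolding sum_subtractf Suc.IH if_distrib[of "\<lambda>f. sum f {..m}"]
    by (cases "s = 0") (simp_all only: if_True if_False Suc.IH simp_thms sum.neutral_const)
  also have "\<dots> = of_nat (n choose s)"
    by (cases s) simp_all
  finally show ?case .
qed simp


text \<open>The conformal Jacobi identity is the module axiom for \<open>br\<close> itself. Thus
  \<open>nprod_commutator\<close> becomes available for the products of the algebra.\<close>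

lemma (in lie_conformal_algebra) adjoint_conformal_module: "conformal_module br br"
proof (intro conformal_module.intro lie_conformal_algebra_axioms conformal_module_axioms.intro)
  show "lam br (Var 0) (const a) (lam br (Var 1) (const b) (const c)) -
      lam br (Var 1) (const b) (lam br (Var 0) (const a) (const c)) =
      lam br (Var 0 + Var 1) (lam br (Var 0) (const a) (const b)) (const c)" for a b c
    by (simp only: br_jacobi[of a b c]) simp
qed (rule br_linear_left br_linear_right br_del_left br_del_right)+

text \<open>The binomial theorem for -\<lambda>-\<partial>, as multiplication by \<lambda> commutes
  with \<partial>.\<close>

lemma lookup_funpow_skew:
  "Poly_Mapping.lookup (((\<lambda>p. - (Poly_Mapping.single 1 1 \<cdot> p) - \<partial> p) ^^ n) (Poly_Mapping.single 0 c)) j =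
    ((- 1) ^ n * of_nat (n choose j)) *\<^sub>C (\<partial> ^^ (n - j)) c"
proof (induction n arbitrary: j)
  case 0
  show ?case by (cases j) (simp_all add: lookup_single)
next
  case (Suc n)
  let ?p = "((\<lambda>p. - (Poly_Mapping.single 1 1 \<cdot> p) - \<partial> p) ^^ n) (Poly_Mapping.single 0 c)"
  have step: "Poly_Mapping.lookup (((\<lambda>p. - (Poly_Mapping.single 1 1 \<cdot> p) - \<partial> p) ^^ Suc n) (Poly_Mapping.single 0 c)) j =
      - (if j = 0 then 0 else Poly_Mapping.lookup ?p (j - 1)) - \<partial> (Poly_Mapping.lookup ?p j)"
    by (simp add: lookup_minus lookup_var_pmult[unfolded One_nat_def])
  show ?case
  proof (cases j)
    case 0
    then show ?thesis unfolding step Suc.IH by (simp add: del_scaleC)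
  next
    case (Suc i)
    \<comment> \<open>Truncated subtraction: n - i is the successor of n - Suc i only for i < n;
      otherwise the binomial coefficient is 0.\<close>
    have d: "of_nat (n choose Suc i) *\<^sub>C \<partial> ((\<partial> ^^ (n - Suc i)) c) = of_nat (n choose Suc i) *\<^sub>C (\<partial> ^^ (n - i)) c"
    proof (cases "Suc i \<le> n")
      case True
      then have "n - i = Suc (n - Suc i)" by simp
      then show ?thesis by simp
    qed (simp add: binomial_eq_0)
    have "\<partial> (((- 1) ^ n * of_nat (n choose Suc i)) *\<^sub>C (\<partial> ^^ (n - Suc i)) c) =
        ((- 1) ^ n * of_nat (n choose Suc i)) *\<^sub>C (\<partial> ^^ (n - i)) c"
      using d by (simp only: del_scaleC scaleC_scaleC[symmetric])
    then show ?thesis unfolding step Suc.IH by (simp add: Suc scaleC_add_left algebra_simps)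
  qed
qed

lemma (in lie_conformal_algebra) lookup_br_skew:
  "Poly_Mapping.lookup (br a b) j = - (\<Sum>s\<in>Poly_Mapping.keys (br b a).
    ((- 1) ^ s * of_nat (s choose j)) *\<^sub>C (\<partial> ^^ (s - j)) (Poly_Mapping.lookup (br b a) s))"
  by (subst br_skew) (simp add: lookup_sum lookup_funpow_skew[unfolded One_nat_def])

text \<open>Iterating (\<partial> x)_p = -p x_(p-1) produces the falling factorial p (p - 1) ... (p
  - i + 1), written as i! times a binomial coefficient. It vanishes for i > p, so the truncated
  index p - i does no harm.\<close>

lemma gen_funpow_del:
  "gen ((\<partial> ^^ i) x) p = ((- 1) ^ i * fact i * of_nat (p choose i)) *\<^sub>C gen x (p - i)"
proof (induction i arbitrary: p)
  case (Suc i)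
  show ?case
  proof (cases p)
    case 0
    then show ?thesis by (simp add: del_gen(1)[symmetric] del_gen(2))
  next
    case (Suc q)
    have "gen ((\<partial> ^^ Suc i) x) p = - (of_nat p *\<^sub>C gen ((\<partial> ^^ i) x) (p - 1))"
      by (simp only: funpow.simps o_apply del_gen(1)[symmetric] del_gen(2))
    also have "\<dots> = ((- 1) ^ Suc i * fact i * of_nat (Suc q * (q choose i))) *\<^sub>C gen x (q - i)"
      by (simp add: Suc.IH Suc algebra_simps)
    also have "Suc q * (q choose i) = Suc i * (Suc q choose Suc i)"
      by (simp only: Suc_times_binomial)
    also have "(- 1) ^ Suc i * fact i * of_nat (Suc i * (Suc q choose Suc i)) =
        ((- 1) ^ Suc i * fact (Suc i) * of_nat (p choose Suc i) :: complex)"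
      by (simp only: fact_Suc of_nat_mult Suc mult.assoc mult.left_commute)
    finally show ?thesis by (simp add: Suc)
  qed
qed simp

section \<open>Lie algebra axioms for the bracket\<close>

context lie_conformal_algebra
begin

lemma pre_bracket_scaleC:
  "pre_bracket br (c *\<^sub>C p) q = c *\<^sub>C pre_bracket br p q"
  "pre_bracket br p (c *\<^sub>C q) = c *\<^sub>C pre_bracket br p q"
proof -
  have "pre_bracket br (c *\<^sub>C Poly_Mapping.single m a) (Poly_Mapping.single n b) =
      c *\<^sub>C pre_bracket br (Poly_Mapping.single m a) (Poly_Mapping.single n b)"
    "pre_bracket br (Poly_Mapping.single m a) (c *\<^sub>C Poly_Mapping.single n b) =
      c *\<^sub>C pre_bracket br (Poly_Mapping.single m a) (Poly_Mapping.single n b)" for m n a b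
    by (simp_all add: scaleC_single pre_bracket_single br_nprod scaleC.scale_sum_right mult.commute)
  note single = this
  have "pre_bracket br (c *\<^sub>C p) (Poly_Mapping.single n b) = c *\<^sub>C pre_bracket br p (Poly_Mapping.single n b)" for n b
    by (induction p rule: poly_single_induct)
      (simp_all add: single pre_bracket_add_left scaleC_add_right)
  then show "pre_bracket br (c *\<^sub>C p) q = c *\<^sub>C pre_bracket br p q"
    by (induction q rule: poly_single_induct)
      (simp_all add: pre_bracket_add_right scaleC_add_right)
  have "pre_bracket br p (c *\<^sub>C Poly_Mapping.single n b) = c *\<^sub>C pre_bracket br p (Poly_Mapping.single n b)" for n b
    by (induction p rule: poly_single_induct)
      (simp_all add: single pre_bracket_add_left scaleC_add_right)
  then show "pre_bracket br p (c *\<^sub>C q) = c *\<^sub>C pre_bracket br p q"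
    by (induction q rule: poly_single_induct)
      (simp_all add: pre_bracket_add_right scaleC_add_right)
qed

lemma annih_bracket_linear:
  "annih_bracket br (x + y) z = annih_bracket br x z + annih_bracket br y z"
  "annih_bracket br z (x + y) = annih_bracket br z x + annih_bracket br z y"
  "annih_bracket br (c *\<^sub>C x) z = c *\<^sub>C annih_bracket br x z"
  "annih_bracket br z (c *\<^sub>C x) = c *\<^sub>C annih_bracket br z x"
proof -
  obtain p q r where "x = abs_annih p" "y = abs_annih q" "z = abs_annih r"
    by (metis annih_abs_cases)
  then show "annih_bracket br (x + y) z = annih_bracket br x z + annih_bracket br y z"
    "annih_bracket br z (x + y) = annih_bracket br z x + annih_bracket br z y"
    "annih_bracket br (c *\<^sub>C x) z = c *\<^sub>C annih_bracket br x z"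
    "annih_bracket br z (c *\<^sub>C x) = c *\<^sub>C annih_bracket br z x"
    by (simp_all add: plus_annih.abs_eq scaleC_annih.abs_eq annih_bracket_abs
        pre_bracket_add_left pre_bracket_add_right pre_bracket_scaleC)
qed

lemma clinear_annih_bracket:
  "clinear (\<lambda>x. annih_bracket br x y)" "clinear (annih_bracket br x)"
  by (rule clinearI; simp add: annih_bracket_linear)+

text \<open>Skew-symmetry of \<open>br\<close> expresses a_(j) b through derivatives of the
  coefficients c_s of [b, a], and inside \<open>gen\<close> each derivative lowers the index. All
  terms with the same c_s then carry the index m + n - s, and their coefficients add up to s! times
  the sum of \<open>alternating_sum_binomial\<close>.\<close>

lemma annih_bracket_skew_gen:
  "annih_bracket br (gen a m) (gen b n) = - annih_bracket br (gen b n) (gen a m)"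
proof -
  let ?K = "Poly_Mapping.keys (br b a)"
  let ?c = "Poly_Mapping.lookup (br b a)"
  let ?h = "\<lambda>s j. if j \<le> s then (- 1) ^ j * of_nat ((m choose j) * (m + n - j choose (s - j))) else (0 :: complex)"
  \<comment> \<open>For j \<le> s the signs combine to (-1)^j and j! (s - j)! (s choose j) = s!. For
    j > s both sides are 0; \<open>?h\<close> tests this explicitly, because the truncated s - j
    would make its last binomial 1.\<close>
  have summand: "(of_nat (m choose j) * fact j * ((- 1) ^ s * of_nat (s choose j))) *\<^sub>C gen ((\<partial> ^^ (s - j)) x) (m + n - j) =
      (fact s * ?h s j) *\<^sub>C gen x (m + n - s)" for s j x
  proof (cases "j \<le> s")
    case True
    then obtain t where s: "s = j + t" using le_Suc_ex by blast
    have "fact s = (fact j * fact t * of_nat (s choose j) :: complex)"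
      by (simp add: s binomial_fact)
    moreover have "(- 1) ^ s * (- 1) ^ t = ((- 1) ^ j :: complex)"
      by (simp add: s power_add power_mult_distrib[symmetric] mult.assoc)
    ultimately show ?thesis
      by (simp add: s gen_funpow_del mult.assoc mult.left_commute mult.commute)
  qed (simp add: binomial_eq_0)
  have "annih_bracket br (gen a m) (gen b n) =
      (\<Sum>j\<le>m. (of_nat (m choose j) * fact j) *\<^sub>C gen (Poly_Mapping.lookup (br a b) j) (m + n - j))"
    by (simp add: annih_bracket_gen nprod_def gen_linear_simps)
  also have "\<dots> = - (\<Sum>j\<le>m. \<Sum>s\<in>?K. (fact s * ?h s j) *\<^sub>C gen (?c s) (m + n - s))"
    unfolding lookup_br_skew[of a b] summand[symmetric]
    by (simp add: clinear_minus[OF gen_linear] clinear_sum[OF gen_linear] gen_linear_simps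
        scaleC.scale_sum_right sum_negf)
  also have "(\<Sum>j\<le>m. \<Sum>s\<in>?K. (fact s * ?h s j) *\<^sub>C gen (?c s) (m + n - s)) =
      (\<Sum>s\<in>?K. (\<Sum>j\<le>m. fact s * ?h s j) *\<^sub>C gen (?c s) (m + n - s))"
    by (subst sum.swap) (simp add: scaleC.scale_sum_left)
  also have "\<dots> = (\<Sum>s\<in>?K. (fact s * of_nat (n choose s)) *\<^sub>C gen (?c s) (m + n - s))"
    by (simp only: sum_distrib_left[symmetric] alternating_sum_binomial)
  also have "\<dots> = (\<Sum>s\<le>n. (fact s * of_nat (n choose s)) *\<^sub>C gen (?c s) (m + n - s))"
    by (rule sum_keys_eq_sum_atMost[where g = "\<lambda>s x. (fact s * of_nat (n choose s)) *\<^sub>C gen x (m + n - s)"])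
      (simp_all add: gen_linear_simps)
  also have "\<dots> = annih_bracket br (gen b n) (gen a m)"
    by (simp add: annih_bracket_gen nprod_def gen_linear_simps mult.commute add.commute)
  finally show ?thesis .
qed

lemma annih_bracket_skew: "annih_bracket br x y = - annih_bracket br y x"
proof (induction x rule: annih_induct)
  case (gen a n)
  show ?case
    by (induction y rule: annih_induct) (rule annih_bracket_skew_gen, simp add: annih_bracket_linear)
qed (simp add: annih_bracket_linear)

text \<open>In the difference of the two nested brackets the commutator formula applies to each
  product a_(i) (b_(j) c), which brings in (a_(l) b)_(i+j-l) c. Its index depends only on l and on
  the sum of i - l and j, so Vandermonde's identity merges the sums over i and j into that of the
  outer bracket.\<close>

lemma annih_bracket_leibniz_gen:
  "annih_bracket br (gen a m) (annih_bracket br (gen b n) (gen c k)) =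
    annih_bracket br (annih_bracket br (gen a m) (gen b n)) (gen c k) +
    annih_bracket br (gen b n) (annih_bracket br (gen a m) (gen c k))"
proof -
  interpret adj: conformal_module br br by (rule adjoint_conformal_module)
  let ?C = "\<lambda>m l. of_nat (m choose l) :: complex"
  let ?Y = "\<lambda>l s. gen (nprod br s (nprod br l a b) c) (m + n + k - l - s)"
  have nested: "annih_bracket br (gen a m) (annih_bracket br (gen b n) (gen c k)) =
      (\<Sum>i\<le>m. \<Sum>j\<le>n. (?C m i * ?C n j) *\<^sub>C gen (nprod br i a (nprod br j b c)) (m + n + k - i - j))" for a b m n
  proof -
    have "annih_bracket br (gen a m) (annih_bracket br (gen b n) (gen c k)) =
      (\<Sum>j\<le>n. \<Sum>i\<le>m. (?C n j * ?C m i) *\<^sub>C gen (nprod br i a (nprod br j b c)) (m + (n + k - j) - i))"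
      by (simp add: annih_bracket_gen clinear_sum[OF clinear_annih_bracket(2)] annih_bracket_linear
          scaleC.scale_sum_right)
    also have "\<dots> = (\<Sum>i\<le>m. \<Sum>j\<le>n. (?C n j * ?C m i) *\<^sub>C gen (nprod br i a (nprod br j b c)) (m + (n + k - j) - i))"
      by (rule sum.swap)
    also have "\<dots> = (\<Sum>i\<le>m. \<Sum>j\<le>n. (?C m i * ?C n j) *\<^sub>C gen (nprod br i a (nprod br j b c)) (m + n + k - i - j))"
      by (intro sum.cong refl arg_cong2[where f = scaleC] arg_cong2[where f = gen]) auto
    finally show ?thesis .
  qed
  have "annih_bracket br (gen b n) (annih_bracket br (gen a m) (gen c k)) =
      (\<Sum>i\<le>m. \<Sum>j\<le>n. (?C m i * ?C n j) *\<^sub>C gen (nprod br j b (nprod br i a c)) (m + n + k - i - j))"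
    unfolding nested[of b n a m]
    by (subst sum.swap, intro sum.cong refl arg_cong2[where f = scaleC] arg_cong2[where f = gen]) auto
  then have "annih_bracket br (gen a m) (annih_bracket br (gen b n) (gen c k)) -
      annih_bracket br (gen b n) (annih_bracket br (gen a m) (gen c k)) =
      (\<Sum>i\<le>m. \<Sum>j\<le>n. (?C m i * ?C n j) *\<^sub>C gen (nprod br i a (nprod br j b c) - nprod br j b (nprod br i a c)) (m + n + k - i - j))"
    unfolding nested[of a m b n]
    by (simp add: clinear_diff[OF gen_linear] scaleC.scale_right_diff_distrib sum_subtractf)
  also have "\<dots> = (\<Sum>i\<le>m. \<Sum>l\<le>i. \<Sum>j\<le>n. (?C m i * ?C i l * ?C n j) *\<^sub>C
      gen (nprod br (i + j - l) (nprod br l a b) c) (m + n + k - i - j))"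
  proof (rule sum.cong)
    fix i
    have "(\<Sum>j\<le>n. (?C m i * ?C n j) *\<^sub>C gen (nprod br i a (nprod br j b c) - nprod br j b (nprod br i a c)) (m + n + k - i - j)) =
        (\<Sum>j\<le>n. \<Sum>l\<le>i. (?C m i * ?C i l * ?C n j) *\<^sub>C
          gen (nprod br (i + j - l) (nprod br l a b) c) (m + n + k - i - j))"
      by (simp add: adj.nprod_commutator clinear_sum[OF gen_linear] gen_linear_simps scaleC.scale_sum_right ac_simps)
    also have "\<dots> =
        (\<Sum>l\<le>i. \<Sum>j\<le>n. (?C m i * ?C i l * ?C n j) *\<^sub>C
          gen (nprod br (i + j - l) (nprod br l a b) c) (m + n + k - i - j))"
      by (rule sum.swap)
    finally show "(\<Sum>j\<le>n. (?C m i * ?C n j) *\<^sub>C gen (nprod br i a (nprod br j b c) - nprod br j b (nprod br i a c)) (m + n + k - i - j)) =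
        \<dots>" .
  qed simp
  also have "\<dots> = (\<Sum>l\<le>m. \<Sum>i\<le>m - l. \<Sum>j\<le>n. (?C m (l + i) * ?C (l + i) l * ?C n j) *\<^sub>C
      gen (nprod br (l + i + j - l) (nprod br l a b) c) (m + n + k - (l + i) - j))"
    by (rule sum_atMost_nested)
  also have "\<dots> = (\<Sum>l\<le>m. ?C m l *\<^sub>C (\<Sum>i\<le>m - l. \<Sum>j\<le>n. (?C (m - l) i * ?C n j) *\<^sub>C ?Y l (i + j)))"
  proof -
    \<comment> \<open>Choosing l + i elements and l among them is choosing the l first and then i
      from the rest; this frees the inner sums from the binomial in l.\<close>
    have "?C m (l + i) * ?C (l + i) l = ?C m l * ?C (m - l) i" if "l \<le> m" "i \<le> m - l" for l i
      using that choose_mult[of l "l + i" m] by (simp add: of_nat_mult[symmetric] del: of_nat_mult)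
    then show ?thesis
      by (simp add: scaleC.scale_sum_right mult.assoc[symmetric] diff_diff_eq add.assoc)
  qed
  also have "\<dots> = (\<Sum>l\<le>m. ?C m l *\<^sub>C (\<Sum>s\<le>m - l + n. ?C (m - l + n) s *\<^sub>C ?Y l s))"
    by (intro sum.cong refl arg_cong2[where f = scaleC] sum_vandermonde)
  also have "\<dots> = annih_bracket br (annih_bracket br (gen a m) (gen b n)) (gen c k)"
    by (simp add: annih_bracket_gen clinear_sum[OF clinear_annih_bracket(1)] annih_bracket_linear)
  finally show ?thesis by (simp add: diff_eq_eq)
qed

lemma annih_bracket_leibniz:
  "annih_bracket br x (annih_bracket br y z) =
    annih_bracket br (annih_bracket br x y) z + annih_bracket br y (annih_bracket br x z)"
proof (induction x rule: annih_induct)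
  case (gen a m)
  show ?case
  proof (induction y rule: annih_induct)
    case (gen b n)
    show ?case
      by (induction z rule: annih_induct) (rule annih_bracket_leibniz_gen, simp add: annih_bracket_linear)
  qed (simp add: annih_bracket_linear)
qed (simp add: annih_bracket_linear)

text \<open>On generators \<partial> acts through \<partial> on A, and in (\<partial> a)_(j) b +
  a_(j) \<partial> b the two terms with the product j - 1 cancel.\<close>

lemma del_annih_bracket:
  "\<partial> (annih_bracket br x y) = annih_bracket br (\<partial> x) y + annih_bracket br x (\<partial> y)"
proof (induction x rule: annih_induct)
  case (gen a m)
  show ?case
  proof (induction y rule: annih_induct)
    case (gen b n)
    have "\<partial> (nprod br j a b) = nprod br j (\<partial> a) b + nprod br j a (\<partial> b)" for j
      by (simp add: br_nprod)
    then show ?case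
      by (simp add: annih_bracket_gen del_gen(1) clinear_sum[OF clinear_del] del_scaleC gen_linear_simps
          scaleC_add_right sum.distrib)
  qed (simp add: annih_bracket_linear del_add)
qed (simp add: annih_bracket_linear del_add)

end

section \<open>The action on the module\<close>

context conformal_module
begin

lemma annih_act_linear:
  "annih_act act (x + y) v = annih_act act x v + annih_act act y v"
  "annih_act act (c *\<^sub>C x) v = c *\<^sub>C annih_act act x v"
  "annih_act act x (v + w) = annih_act act x v + annih_act act x w"
  "annih_act act x (c *\<^sub>C v) = c *\<^sub>C annih_act act x v"
proof -
  have add: "annih_act act (x + y) v = annih_act act x v + annih_act act y v" for x y v
    by (metis annih_abs_cases annih_act_abs plus_annih.abs_eq pre_act_add)
  from add show "annih_act act (x + y) v = annih_act act x v + annih_act act y v" .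
  show "annih_act act (c *\<^sub>C x) v = c *\<^sub>C annih_act act x v"
    by (induction x rule: annih_induct)
      (simp_all add: add scaleC_add_right gen_linear_simps(2)[symmetric] annih_act_gen act_nprod)
  show "annih_act act x (v + w) = annih_act act x v + annih_act act x w"
    "annih_act act x (c *\<^sub>C v) = c *\<^sub>C annih_act act x v"
    by (induction x rule: annih_induct)
      (simp_all add: annih_act_gen act_nprod add scaleC_add_right)
qed

lemma clinear_annih_act: "clinear (\<lambda>x. annih_act act x v)" "clinear (annih_act act x)"
  by (rule clinearI; simp add: annih_act_linear)+

lemma annih_act_bracket:
  "annih_act act (annih_bracket br x y) v = annih_act act x (annih_act act y v) - annih_act act y (annih_act act x v)"
proof (induction x rule: annih_induct)
  case (gen a m)
  show ?case
    by (induction y rule: annih_induct)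
      (simp_all add: annih_bracket_gen annih_act_gen nprod_commutator clinear_sum[OF clinear_annih_act(1)]
        annih_act_linear annih_bracket_linear)
qed (simp add: annih_act_linear annih_bracket_linear)

lemma del_annih_act: "\<partial> (annih_act act x v) = annih_act act (\<partial> x) v + annih_act act x (\<partial> v)"
  by (induction x rule: annih_induct)
    (simp_all add: annih_act_gen del_gen(1) act_nprod annih_act_linear del_add)

sublocale annih: lie_rep "annih_bracket br" "annih_act act"
  by (rule lie_rep.intro)
    (rule clinear_annih_bracket annih_bracket_skew annih_bracket_leibniz clinear_annih_act annih_act_bracket)+

end


section \<open>Multilinear maps on the annihilation algebra\<close>

lemma multilinear_sum:
  "(\<And>i. i \<in> A \<Longrightarrow> multilinear n (f i)) \<Longrightarrow> multilinear n (\<lambda>xs. \<Sum>i\<in>A. f i xs)"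
  by (induction A rule: infinite_finite_induct) (auto simp: multilinear_zero multilinear_add)

lemma multilinear_gen_eqI:
  assumes "multilinear n \<gamma>" "multilinear n \<delta>"
    and "\<And>as ms. length as = n \<Longrightarrow> length ms = n \<Longrightarrow> \<gamma> (map2 gen as ms) = \<delta> (map2 gen as ms)"
    and "length xs = n"
  shows "\<gamma> xs = \<delta> xs"
  using assms
proof (induction n arbitrary: \<gamma> \<delta> xs)
  case 0
  then show ?case using 0(3)[of "[]" "[]"] by simp
next
  case (Suc n)
  then obtain x ys where xs: "xs = x # ys" "length ys = n" by (metis length_Suc_conv)
  have lin: "clinear (\<lambda>x. \<gamma> (x # ys))" "clinear (\<lambda>x. \<delta> (x # ys))"
    using Suc.prems xs by (auto intro: multilinear_hd)
  have "\<gamma> (x # ys) = \<delta> (x # ys)"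
  proof (induction x rule: annih_induct)
    case (gen a m)
    show ?case
    proof (rule Suc.IH[of "\<lambda>ys. \<gamma> (gen a m # ys)" "\<lambda>ys. \<delta> (gen a m # ys)"])
      show "\<gamma> (gen a m # map2 gen as ms) = \<delta> (gen a m # map2 gen as ms)"
        if "length as = n" "length ms = n" for as ms
        using Suc.prems(3)[of "a # as" "m # ms"] that by simp
    qed (use Suc.prems xs in \<open>auto intro: multilinear_Cons\<close>)
  qed (use lin in \<open>simp add: clinear_iff\<close>)
  then show ?case by (simp add: xs)
qed

text \<open>Expands every argument in the monomials of its chosen representative. The dependence on
  that choice is removed by \<open>extend_abs\<close>, for those F that respect the relations of the
  quotient.\<close>

fun extend :: "('a::del_module list \<Rightarrow> nat list \<Rightarrow> 'm::complex_vector) \<Rightarrow> 'a annih list \<Rightarrow> 'm"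
  where
    "extend F [] = F [] []"
  | "extend F (x # xs) = (\<Sum>m\<in>Poly_Mapping.keys (rep_annih x).
      extend (\<lambda>as ms. F (Poly_Mapping.lookup (rep_annih x) m # as) (m # ms)) xs)"

text \<open>The condition for F to factor through A[t]/(\<partial> + \<partial>_t)A[t] in each
  argument: it is linear and kills the total derivative of a monomial. At exponent 0 the factor 0
  absorbs the truncated index.\<close>

definition gen_compatible :: "nat \<Rightarrow> ('a::del_module list \<Rightarrow> nat list \<Rightarrow> 'm::complex_vector) \<Rightarrow> bool"
  where "gen_compatible n F \<longleftrightarrow> (\<forall>as ms i. length as = n \<longrightarrow> length ms = n \<longrightarrow> i < n \<longrightarrow>
    clinear (\<lambda>a. F (as[i := a]) ms) \<and>
    F (as[i := \<partial> (as ! i)]) ms = - (of_nat (ms ! i) *\<^sub>C F as (ms[i := ms ! i - 1])))"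

lemma gen_compatible_Cons:
  assumes "gen_compatible (Suc n) F"
  shows "gen_compatible n (\<lambda>as ms. F (a # as) (m # ms))"
  unfolding gen_compatible_def
proof (intro allI impI)
  fix as :: "'a list" and ms :: "nat list" and i
  assume "length as = n" "length ms = n" "i < n"
  then show "clinear (\<lambda>x. F (a # as[i := x]) (m # ms)) \<and>
    F (a # as[i := \<partial> (as ! i)]) (m # ms) = - (of_nat (ms ! i) *\<^sub>C F (a # as) (m # ms[i := ms ! i - 1]))"
    using assms[unfolded gen_compatible_def, rule_format, of "a # as" "m # ms" "Suc i"] by simp
qed

lemma gen_compatible_hd:
  assumes "gen_compatible (Suc n) F" "length as = n" "length ms = n"
  shows "clinear (\<lambda>a. F (a # as) (m # ms))"
    and "F (\<partial> a # as) (m # ms) = - (of_nat m *\<^sub>C F (a # as) ((m - 1) # ms))"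
  using assms(1)[unfolded gen_compatible_def, rule_format, of "a # as" "m # ms" 0] assms(2,3) by simp_all

lemma extend_cong:
  "(\<And>as ms. length as = length xs \<Longrightarrow> length ms = length xs \<Longrightarrow> F as ms = G as ms) \<Longrightarrow>
    extend F xs = extend G xs"
proof (induction xs arbitrary: F G)
  case (Cons x xs)
  show ?case
    unfolding extend.simps by (intro sum.cong refl Cons.IH) (simp add: Cons.prems)
qed simp

lemma extend_linear:
  "extend (\<lambda>as ms. F as ms + G as ms) xs = extend F xs + extend G xs"
  "extend (\<lambda>as ms. c *\<^sub>C F as ms) xs = c *\<^sub>C extend F xs"
  by (induction xs arbitrary: F G) (simp_all add: sum.distrib scaleC.scale_sum_right)

text \<open>The sum over the monomials of p is additive in p and vanishes on total derivatives, by
  compatibility in the first argument. Hence any p may stand in for the chosen representative of its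
  class.\<close>

lemma extend_abs:
  assumes F: "gen_compatible (Suc n) F" and xs: "length xs = n"
  shows "extend F (abs_annih p # xs) =
    (\<Sum>m\<in>Poly_Mapping.keys p. extend (\<lambda>as ms. F (Poly_Mapping.lookup p m # as) (m # ms)) xs)"
    and "extend (\<lambda>as ms. F ((a + b) # as) (m # ms)) xs =
      extend (\<lambda>as ms. F (a # as) (m # ms)) xs + extend (\<lambda>as ms. F (b # as) (m # ms)) xs"
    and "extend (\<lambda>as ms. F ((c *\<^sub>C a) # as) (m # ms)) xs = c *\<^sub>C extend (\<lambda>as ms. F (a # as) (m # ms)) xs"
proof -
  let ?h = "\<lambda>m a. extend (\<lambda>as ms. F (a # as) (m # ms)) xs"
  let ?H = "\<lambda>p. \<Sum>m\<in>Poly_Mapping.keys p. ?h m (Poly_Mapping.lookup p m)"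
  show h_add: "?h m (a + b) = ?h m a + ?h m b" for m a b
    unfolding extend_linear(1)[symmetric]
    by (rule extend_cong) (use gen_compatible_hd(1)[OF F] xs in \<open>auto simp: clinear_iff\<close>)
  show h_scale: "?h m (c *\<^sub>C a) = c *\<^sub>C ?h m a" for m c a
    unfolding extend_linear(2)[symmetric]
    by (rule extend_cong) (use gen_compatible_hd(1)[OF F] xs in \<open>auto simp: clinear_iff\<close>)
  have h_del: "?h m (\<partial> a) = - of_nat m *\<^sub>C ?h (m - 1) a" for m a
    unfolding extend_linear(2)[symmetric]
    by (rule extend_cong) (use gen_compatible_hd(2)[OF F] xs in simp)
  have h_0: "?h m 0 = 0" for m using h_scale[of 0 0 m] by simp
  have H_add: "?H (p + q) = ?H p + ?H q" for p q
    by (rule sum_keys_add[where g = ?h]) (rule h_add)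
  have H_single: "?H (Poly_Mapping.single m a) = ?h m a" for m a
    by (rule sum_keys_single[where g = ?h]) (rule h_0)
  have H_total_deriv: "?H (total_deriv r) = 0" for r
  proof (induction r rule: poly_single_induct)
    case (single k x)
    show ?case
      unfolding total_deriv_single H_add H_single h_del h_scale by simp
  next
    case (add p q)
    then show ?case unfolding total_deriv_add H_add by simp
  qed
  obtain r where r: "rep_annih (abs_annih p) = p + total_deriv r"
    using annih_rel_rep_abs[of p] unfolding annih_rel_def by (metis diff_add_cancel add.commute)
  show "extend F (abs_annih p # xs) = ?H p"
    unfolding extend.simps r H_add H_total_deriv by simp
qed

lemma extend_Cons_gen:
  assumes "gen_compatible (Suc n) F" "length xs = n"
  shows "extend F (gen a m # xs) = extend (\<lambda>as ms. F (a # as) (m # ms)) xs"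
proof -
  have "extend (\<lambda>as ms. F (0 # as) (m # ms)) xs = 0"
    using extend_abs(3)[OF assms, where c = 0 and a = 0 and m = m] by simp
  then show ?thesis
    unfolding gen.abs_eq extend_abs(1)[OF assms]
    by (intro sum_keys_single[where g = "\<lambda>m a. extend (\<lambda>as ms. F (a # as) (m # ms)) xs"]) simp
qed

lemma extend_gen:
  assumes "gen_compatible n F" "length as = n" "length ms = n"
  shows "extend F (map2 gen as ms) = F as ms"
  using assms
proof (induction as arbitrary: n ms F)
  case (Cons a as)
  then obtain m ms' n' where [simp]: "ms = m # ms'" "n = Suc n'" "length as = n'" "length ms' = n'"
    by (metis length_Suc_conv length_Cons)
  show ?case
    using Cons.prems Cons.IH[OF gen_compatible_Cons] by (simp add: extend_Cons_gen del: extend.simps(2))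
qed simp

lemma multilinear_extend:
  assumes "gen_compatible n F"
  shows "multilinear n (extend F)"
  using assms
proof (induction n arbitrary: F)
  case 0
  show ?case by (simp add: multilinear_def)
next
  case (Suc n)
  have "multilinear n (\<lambda>xs. extend F (x # xs))" for x
    unfolding extend.simps by (intro multilinear_sum Suc.IH gen_compatible_Cons Suc.prems)
  moreover have "clinear (\<lambda>x. extend F (x # xs))" if xs: "length xs = n" for xs
  proof (rule clinearI)
    let ?h = "\<lambda>m a. extend (\<lambda>as ms. F (a # as) (m # ms)) xs"
    note abs = extend_abs[OF Suc.prems xs]
    fix x y :: "'a annih" and c
    obtain p q where pq: "x = abs_annih p" "y = abs_annih q" by (metis annih_abs_cases)
    show "extend F ((x + y) # xs) = extend F (x # xs) + extend F (y # xs)"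
      unfolding pq plus_annih.abs_eq abs(1)
      by (rule sum_keys_add[where g = ?h]) (rule abs(2))
    \<comment> \<open>Induction on p avoids comparing the supports of p and its multiple, which
      differ for c = 0.\<close>
    have "extend F (c *\<^sub>C abs_annih p # xs) = c *\<^sub>C extend F (abs_annih p # xs)"
    proof (induction p rule: poly_single_induct)
      case (single k a)
      show ?case
        using abs(3) by (simp add: gen.abs_eq[symmetric] gen_linear_simps(2)[symmetric]
            extend_Cons_gen[OF Suc.prems xs] del: extend.simps)
    next
      case (add p q)
      have *: "extend F ((abs_annih p + abs_annih q) # xs) = extend F (abs_annih p # xs) + extend F (abs_annih q # xs)" for p q
        unfolding plus_annih.abs_eq abs(1) by (rule sum_keys_add[where g = ?h]) (rule abs(2))
      show ?case
        using add * by (simp add: plus_annih.abs_eq[symmetric] scaleC_add_right)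
          (simp add: * scaleC_annih.abs_eq scaleC_add_right)
    qed
    then show "extend F (c *\<^sub>C x # xs) = c *\<^sub>C extend F (x # xs)"
      unfolding pq .
  qed
  ultimately show ?case by (simp add: multilinear_Suc)
qed

section \<open>The isomorphism on cochains\<close>

lemma mem_ce_cochains_iff:
  "\<gamma> \<in> ce_cochains n \<longleftrightarrow>
    (\<forall>xs. length xs \<noteq> n \<longrightarrow> \<gamma> xs = 0) \<and> multilinear n \<gamma> \<and> alternating n \<gamma> \<and>
    (\<forall>as. length as = n \<longrightarrow> finite {ms. length ms = n \<and> \<gamma> (map2 gen as ms) \<noteq> 0})"
  by (simp add: ce_cochains_def alternating_iff_sign)

definition coeff_map :: "nat \<Rightarrow> ('a::del_module list \<Rightarrow> 'm::del_module mpol) \<Rightarrow> 'a annih list \<Rightarrow> 'm"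
  where "coeff_map n \<gamma> xs = (if length xs = n then extend (\<lambda>as ms.
    (\<Prod>m\<leftarrow>ms. fact m) *\<^sub>C Poly_Mapping.lookup (\<gamma> as) (Poly_Mapping.nth ms)) xs else 0)"

lemma basic_cochainsD:
  assumes "\<gamma> \<in> basic_cochains n"
  shows "length as \<noteq> n \<Longrightarrow> \<gamma> as = 0" "vars_below n (\<gamma> as)" "multilinear n \<gamma>"
    "length as = n \<Longrightarrow> i < n \<Longrightarrow> \<gamma> (as[i := \<partial> (as ! i)]) = - (Var i \<cdot> \<gamma> as)"
    "length as = n \<Longrightarrow> \<pi> permutes {..<n} \<Longrightarrow>
      psubst (\<lambda>i. Var (\<pi> i)) (\<gamma> (permute_list \<pi> as)) = of_int (sign \<pi>) *\<^sub>C \<gamma> as"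
  using assms by (simp_all add: basic_cochains_def)

lemma prod_list_fact_update:
  assumes "i < length ms" "ms ! i \<noteq> 0"
  shows "(\<Prod>m\<leftarrow>ms. fact m) = (of_nat (ms ! i) * (\<Prod>m\<leftarrow>ms[i := ms ! i - 1]. fact m) :: complex)"
  using assms
proof (induction ms arbitrary: i)
  case (Cons m ms)
  then show ?case
  proof (cases i)
    case 0
    then show ?thesis using Cons.prems by (simp add: fact_reduce)
  next
    case (Suc j)
    then show ?thesis using Cons.prems Cons.IH[of j] by simp
  qed
qed simp

lemma prod_list_fact_nonzero [simp]: "(\<Prod>m\<leftarrow>ms. fact m) \<noteq> (0 :: complex)"
  by (induction ms) simp_all

text \<open>Multiplication by the i-th variable shifts coefficients; since m! = m (m - 1)!, the
  normalisation by factorials turns this shift into the factor m_i. If m_i = 0, both sides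
  vanish.\<close>

lemma gen_compatible_coeff:
  assumes \<gamma>: "\<gamma> \<in> basic_cochains n"
  shows "gen_compatible n (\<lambda>as ms. (\<Prod>m\<leftarrow>ms. fact m) *\<^sub>C Poly_Mapping.lookup (\<gamma> as) (Poly_Mapping.nth ms))"
  unfolding gen_compatible_def
proof (intro allI impI conjI)
  fix as :: "'a list" and ms :: "nat list" and i
  assume len: "length as = n" "length ms = n" "i < n"
  have "clinear (\<lambda>a. \<gamma> (as[i := a]))"
    using basic_cochainsD(3)[OF \<gamma>] len by (simp add: multilinear_def)
  then show "clinear (\<lambda>a. (\<Prod>m\<leftarrow>ms. fact m) *\<^sub>C Poly_Mapping.lookup (\<gamma> (as[i := a])) (Poly_Mapping.nth ms))"
    by (simp add: clinear_iff lookup_add scaleC_add_right mult.commute)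
  show "(\<Prod>m\<leftarrow>ms. fact m) *\<^sub>C Poly_Mapping.lookup (\<gamma> (as[i := \<partial> (as ! i)])) (Poly_Mapping.nth ms) =
    - (of_nat (ms ! i) *\<^sub>C (\<Prod>m\<leftarrow>ms[i := ms ! i - 1]. fact m) *\<^sub>C
      Poly_Mapping.lookup (\<gamma> as) (Poly_Mapping.nth (ms[i := ms ! i - 1])))"
    using len prod_list_fact_update[of i ms]
    by (simp add: basic_cochainsD(4)[OF \<gamma>] lookup_Var_pmult_nth when_def)
qed

lemma coeff_map_gen:
  assumes "\<gamma> \<in> basic_cochains n" "length as = n" "length ms = n"
  shows "coeff_map n \<gamma> (map2 gen as ms) =
    (\<Prod>m\<leftarrow>ms. fact m) *\<^sub>C Poly_Mapping.lookup (\<gamma> as) (Poly_Mapping.nth ms)"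
  using assms by (simp add: coeff_map_def extend_gen[OF gen_compatible_coeff])

lemma multilinear_coeff_map:
  assumes "\<gamma> \<in> basic_cochains n"
  shows "multilinear n (coeff_map n \<gamma>)"
  using multilinear_extend[OF gen_compatible_coeff[OF assms]]
  by (rule iffD1[OF multilinear_cong, rotated]) (simp add: coeff_map_def)

text \<open>After the renaming, the old variable l carries the exponent at position \<pi> l. This is
  the rearrangement that \<open>permute_list\<close> makes in the arguments, so \<open>as\<close>
  and \<open>ms\<close> are permuted in the same direction.\<close>

lemma lookup_psubst_permutes:
  assumes "vars_below n p" "\<pi> permutes {..<n}" "length ms = n"
  shows "Poly_Mapping.lookup (psubst (\<lambda>i. Var (\<pi> i)) p) (Poly_Mapping.nth ms) =
    Poly_Mapping.lookup p (Poly_Mapping.nth (permute_list \<pi> ms))"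
proof -
  have "map (\<lambda>l. Poly_Mapping.lookup (Poly_Mapping.nth ms) (\<pi> l)) [0..<n] = permute_list \<pi> ms"
    unfolding permute_list_def using assms permutes_in_image[OF assms(2)]
    by (intro map_cong) (auto simp: lookup_nth_list simp del: lookup_nth)
  then show ?thesis
    using assms permutes_inj_on[OF assms(2)] keys_nth_subset[of ms]
    by (simp add: lookup_psubst_Var[where \<rho> = \<pi>] permutes_image del: lookup_nth keys_nth)
qed

lemma vars_below_psubst_permutes:
  assumes "vars_below n p" "\<pi> permutes {..<n}"
  shows "vars_below n (psubst (\<lambda>i. Var (\<pi> i)) p)"
  using assms permutes_inj_on[OF assms(2)]
  by (intro vars_belowI) (auto simp: lookup_psubst_Var[where \<rho> = \<pi>] permutes_image when_def split: if_splits)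

lemma permute_list_map2:
  assumes "\<pi> permutes {..<n}" "length xs = n" "length ys = n"
  shows "permute_list \<pi> (map2 f xs ys) = map2 f (permute_list \<pi> xs) (permute_list \<pi> ys)"
  using assms by (simp add: permute_list_map permute_list_zip)

lemma prod_list_permute_list:
  fixes f :: "'v \<Rightarrow> 'w::comm_monoid_mult"
  assumes "\<pi> permutes {..<n}" "length xs = n"
  shows "(\<Prod>x\<leftarrow>permute_list \<pi> xs. f x) = (\<Prod>x\<leftarrow>xs. f x)"
proof -
  have "mset (map f (permute_list \<pi> xs)) = mset (map f xs)"
    using assms by (simp add: mset_map)
  then show ?thesis by (metis prod_mset_prod_list)
qed

lemma multilinear_permute_list:
  assumes "multilinear n \<gamma>" "\<pi> permutes {..<n}"
  shows "multilinear n (\<lambda>xs. \<gamma> (permute_list \<pi> xs))"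
  unfolding multilinear_def
proof (intro allI impI)
  fix xs :: "'a list" and i
  assume xs: "length xs = n" and i: "i < n"
  obtain k where k: "k < n" "\<pi> k = i"
    using permutes_image[OF assms(2)] i by (metis imageE lessThan_iff)
  have "permute_list \<pi> (xs[i := x]) = (permute_list \<pi> xs)[k := x]" for x
  proof (rule nth_equalityI)
    fix l assume "l < length (permute_list \<pi> (xs[i := x]))"
    then show "permute_list \<pi> (xs[i := x]) ! l = (permute_list \<pi> xs)[k := x] ! l"
      using xs i k assms(2) permutes_in_image[OF assms(2), of l] inj_eq[OF permutes_inj[OF assms(2)], of l k]
      by (auto simp: permute_list_nth nth_list_update)
  qed simp
  then show "clinear (\<lambda>x. \<gamma> (permute_list \<pi> (xs[i := x])))"
    using assms(1) xs k by (simp add: multilinear_def)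
qed

text \<open>The source of all continuity statements: a polynomial has finite support, and lists of
  fixed length inject into exponents.\<close>

lemma finite_lists_nth_keys:
  "finite {ms. length ms = n \<and> Poly_Mapping.lookup p (Poly_Mapping.nth ms) \<noteq> 0}"
proof (rule finite_imageD)
  show "inj_on Poly_Mapping.nth {ms. length ms = n \<and> Poly_Mapping.lookup p (Poly_Mapping.nth ms) \<noteq> 0}"
    by (auto simp: inj_on_def nth_eq_nth_iff)
  show "finite (Poly_Mapping.nth ` {ms. length ms = n \<and> Poly_Mapping.lookup p (Poly_Mapping.nth ms) \<noteq> 0})"
    by (rule finite_subset[OF _ finite_keys[of p]]) (auto simp: in_keys_iff)
qed

text \<open>Sesquilinearity is already used up in making the extension well defined. Skew-symmetry
  is tested on generators, where a permutation of the arguments permutes \<open>as\<close> and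
  \<open>ms\<close> alike and preserves the product of the factorials.\<close>

lemma coeff_map_ce_cochain:
  assumes \<gamma>: "\<gamma> \<in> basic_cochains n"
  shows "coeff_map n \<gamma> \<in> ce_cochains n"
  unfolding mem_ce_cochains_iff alternating_iff_sign
proof (intro conjI allI impI)
  fix xs :: "'a annih list" and \<pi>
  assume xs: "length xs = n" and \<pi>: "\<pi> permutes {..<n}"
  show "coeff_map n \<gamma> (permute_list \<pi> xs) = of_int (sign \<pi>) *\<^sub>C coeff_map n \<gamma> xs"
  proof (rule multilinear_gen_eqI[OF _ _ _ xs])
    fix as :: "'a list" and ms :: "nat list"
    assume len: "length as = n" "length ms = n"
    have "Poly_Mapping.lookup (\<gamma> (permute_list \<pi> as)) (Poly_Mapping.nth (permute_list \<pi> ms)) =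
        of_int (sign \<pi>) *\<^sub>C Poly_Mapping.lookup (\<gamma> as) (Poly_Mapping.nth ms)"
      using basic_cochainsD(5)[OF \<gamma> len(1) \<pi>]
        lookup_psubst_permutes[OF basic_cochainsD(2)[OF \<gamma>] \<pi> len(2), of "permute_list \<pi> as"]
      by simp
    then show "coeff_map n \<gamma> (permute_list \<pi> (map2 gen as ms)) = of_int (sign \<pi>) *\<^sub>C coeff_map n \<gamma> (map2 gen as ms)"
      using len by (simp add: permute_list_map2[OF \<pi>] coeff_map_gen[OF \<gamma>] prod_list_permute_list[OF \<pi>] mult.commute)
  qed (use multilinear_coeff_map[OF \<gamma>] \<pi> in \<open>auto intro: multilinear_permute_list multilinear_scaleC\<close>)
next
  fix as :: "'a list"
  assume "length as = n"
  then have "{ms. length ms = n \<and> coeff_map n \<gamma> (map2 gen as ms) \<noteq> 0} =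
      {ms. length ms = n \<and> Poly_Mapping.lookup (\<gamma> as) (Poly_Mapping.nth ms) \<noteq> 0}"
    by (intro Collect_cong conj_cong refl) (simp add: coeff_map_gen[OF \<gamma>])
  then show "finite {ms. length ms = n \<and> coeff_map n \<gamma> (map2 gen as ms) \<noteq> 0}"
    using finite_lists_nth_keys by simp
qed (simp_all add: multilinear_coeff_map[OF \<gamma>], simp add: coeff_map_def)

text \<open>The inverse of \<open>coeff_map n\<close> on continuous cochains. The index set of the
  sum is finite by continuity; for other maps the sum may default to 0 and mean nothing.\<close>

definition poly_map :: "nat \<Rightarrow> ('a::del_module annih list \<Rightarrow> 'm::del_module) \<Rightarrow> 'a list \<Rightarrow> 'm mpol"
  where "poly_map n \<delta> as = (if length as = n then
    \<Sum>ms | length ms = n \<and> \<delta> (map2 gen as ms) \<noteq> 0.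
      Poly_Mapping.single (Poly_Mapping.nth ms) (inverse (\<Prod>m\<leftarrow>ms. fact m) *\<^sub>C \<delta> (map2 gen as ms)) else 0)"

lemma lookup_poly_map:
  assumes "\<delta> \<in> ce_cochains n" "length as = n" "length ms = n"
  shows "Poly_Mapping.lookup (poly_map n \<delta> as) (Poly_Mapping.nth ms) =
    inverse (\<Prod>m\<leftarrow>ms. fact m) *\<^sub>C \<delta> (map2 gen as ms)"
proof -
  let ?S = "{ms. length ms = n \<and> \<delta> (map2 gen as ms) \<noteq> 0}"
  have fin: "finite ?S" using assms by (simp add: mem_ce_cochains_iff)
  have "Poly_Mapping.lookup (poly_map n \<delta> as) (Poly_Mapping.nth ms) =
      (\<Sum>ms'\<in>?S. if ms' = ms then inverse (\<Prod>m\<leftarrow>ms'. fact m) *\<^sub>C \<delta> (map2 gen as ms') else 0)"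
    using assms unfolding poly_map_def
    by (auto simp: lookup_sum lookup_single when_def nth_eq_nth_iff intro!: sum.cong)
  then show ?thesis
    using fin assms by (auto simp: sum.delta)
qed

lemma vars_below_poly_map: "vars_below n (poly_map n \<delta> as)"
  unfolding poly_map_def
  by (auto intro!: vars_below_sum vars_below_0)
    (auto simp: vars_below_def simp del: keys_nth split: if_splits dest!: subsetD[OF keys_nth_subset])

lemma map2_update: "map2 f (xs[i := x]) ys = (map2 f xs ys)[i := f x (ys ! i)]"
  if "length xs = length ys" "i < length ys"
  using that by (intro nth_equalityI) (simp_all add: nth_list_update)

lemma map2_update_snd: "map2 f xs (ys[i := y]) = (map2 f xs ys)[i := f (xs ! i) y]"
  if "length xs = length ys" "i < length ys"
  using that by (intro nth_equalityI) (simp_all add: nth_list_update)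

lemma vars_below_uminus: "vars_below n p \<Longrightarrow> vars_below n (- p)"
  by (simp add: vars_below_def)

text \<open>Every condition is an equality of polynomials in n variables, and on coefficients it
  becomes a property of \<delta> on generators: linearity, the relation (\<partial> a)_m = - m
  a_(m-1), or skew-symmetry.\<close>

lemma poly_map_basic_cochain:
  assumes \<delta>: "\<delta> \<in> ce_cochains n"
  shows "poly_map n \<delta> \<in> basic_cochains n"
  unfolding basic_cochains_def mem_Collect_eq
proof (intro conjI allI impI)
  have ml: "multilinear n \<delta>" using \<delta> by (simp add: mem_ce_cochains_iff)
  have upd: "clinear (\<lambda>a. \<delta> (map2 gen (as[i := a]) ms))"
    if "length as = n" "length ms = n" "i < n" for as ms i
  proof -
    have "clinear (\<lambda>x. \<delta> ((map2 gen as ms)[i := x]))"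
      using ml that by (simp add: multilinear_def)
    then show ?thesis
      using that by (simp add: map2_update clinear_iff gen_linear_simps)
  qed
  show "multilinear n (poly_map n \<delta>)"
    unfolding multilinear_def
  proof (intro allI impI clinearI)
    fix as :: "'a list" and i x y c
    assume len: "length as = n" "i < n"
    show "poly_map n \<delta> (as[i := x + y]) = poly_map n \<delta> (as[i := x]) + poly_map n \<delta> (as[i := y])"
      using len upd
      by (intro vars_below_eqI[of n] vars_below_add vars_below_poly_map)
        (simp add: lookup_add lookup_poly_map[OF \<delta>] clinear_iff scaleC_add_right)
    show "poly_map n \<delta> (as[i := c *\<^sub>C x]) = c *\<^sub>C poly_map n \<delta> (as[i := x])"
      using len upd
      by (intro vars_below_eqI[of n] vars_below_scaleC vars_below_poly_map)
        (simp add: lookup_poly_map[OF \<delta>] clinear_iff mult.commute)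
  qed
  fix as :: "'a list"
  show "poly_map n \<delta> (as[i := \<partial> (as ! i)]) = - (Var i \<cdot> poly_map n \<delta> as)"
    if len: "length as = n" "i < n" for i
  proof (rule vars_below_eqI[of n])
    show "vars_below n (- (Var i \<cdot> poly_map n \<delta> as))"
      using len by (intro vars_below_uminus vars_below_Var_pmult vars_below_poly_map)
    fix ms :: "nat list" assume ms: "length ms = n"
    have "clinear (\<lambda>x. \<delta> ((map2 gen as ms)[i := x]))"
      using ml len ms by (simp add: multilinear_def)
    then have "\<delta> (map2 gen (as[i := \<partial> (as ! i)]) ms) = - (of_nat (ms ! i) *\<^sub>C \<delta> (map2 gen as (ms[i := ms ! i - 1])))"
      using len ms clinear_minus[of "\<lambda>x. \<delta> ((map2 gen as ms)[i := x])"]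
      by (simp add: map2_update map2_update_snd del_gen(1)[symmetric] del_gen(2) clinear_iff)
    then show "Poly_Mapping.lookup (poly_map n \<delta> (as[i := \<partial> (as ! i)])) (Poly_Mapping.nth ms) =
        Poly_Mapping.lookup (- (Var i \<cdot> poly_map n \<delta> as)) (Poly_Mapping.nth ms)"
      using len ms prod_list_fact_update[of i ms]
      by (simp add: lookup_poly_map[OF \<delta>] lookup_Var_pmult_nth when_def)
  qed (rule vars_below_poly_map)
  show "psubst (\<lambda>i. Var (\<pi> i)) (poly_map n \<delta> (permute_list \<pi> as)) = of_int (sign \<pi>) *\<^sub>C poly_map n \<delta> as"
    if len: "length as = n" and \<pi>: "\<pi> permutes {..<n}" for \<pi>
  proof (rule vars_below_eqI[of n])
    fix ms :: "nat list" assume ms: "length ms = n"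
    have "\<delta> (permute_list \<pi> (map2 gen as ms)) = of_int (sign \<pi>) *\<^sub>C \<delta> (map2 gen as ms)"
      using \<delta> len ms \<pi> by (simp add: mem_ce_cochains_iff alternating_iff_sign)
    then show "Poly_Mapping.lookup (psubst (\<lambda>i. Var (\<pi> i)) (poly_map n \<delta> (permute_list \<pi> as))) (Poly_Mapping.nth ms) =
        Poly_Mapping.lookup (of_int (sign \<pi>) *\<^sub>C poly_map n \<delta> as) (Poly_Mapping.nth ms)"
      using len ms
      by (simp add: lookup_psubst_permutes[OF vars_below_poly_map \<pi>] lookup_poly_map[OF \<delta>]
          permute_list_map2[OF \<pi>] prod_list_permute_list[OF \<pi>] mult.commute)
  qed (intro vars_below_psubst_permutes vars_below_poly_map \<pi> vars_below_scaleC)+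
qed (simp_all add: vars_below_poly_map, simp add: poly_map_def)

lemma coeff_map_poly_map:
  assumes \<delta>: "\<delta> \<in> ce_cochains n"
  shows "coeff_map n (poly_map n \<delta>) = \<delta>"
proof
  fix xs :: "'a annih list"
  show "coeff_map n (poly_map n \<delta>) xs = \<delta> xs"
  proof (cases "length xs = n")
    case True
    then show ?thesis
      using multilinear_coeff_map[OF poly_map_basic_cochain[OF \<delta>]] \<delta>
      by (elim multilinear_gen_eqI[rotated 3])
        (simp_all add: mem_ce_cochains_iff coeff_map_gen[OF poly_map_basic_cochain[OF \<delta>]] lookup_poly_map[OF \<delta>])
  next
    case False
    then show ?thesis using \<delta> by (simp add: coeff_map_def mem_ce_cochains_iff)
  qed
qed

text \<open>The polynomial values of F make \<delta> continuous, hence a cochain; then F must be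
  \<open>poly_map n \<delta>\<close>, as both have the same coefficients, and it inherits
  sesquilinearity and skew-symmetry.\<close>

lemma coeff_transfer:
  assumes F: "\<And>as. length as \<noteq> n \<Longrightarrow> F as = 0" "\<And>as. length as = n \<Longrightarrow> vars_below n (F as)"
    and \<delta>: "\<And>xs. length xs \<noteq> n \<Longrightarrow> \<delta> xs = 0" "multilinear n \<delta>" "alternating n \<delta>"
    and coeff: "\<And>as ms. length as = n \<Longrightarrow> length ms = n \<Longrightarrow>
      (\<Prod>m\<leftarrow>ms. fact m) *\<^sub>C Poly_Mapping.lookup (F as) (Poly_Mapping.nth ms) = \<delta> (map2 gen as ms)"
  shows "F \<in> basic_cochains n" "\<delta> \<in> ce_cochains n" "coeff_map n F = \<delta>"
proof -
  have "finite {ms. length ms = n \<and> \<delta> (map2 gen as ms) \<noteq> 0}" if "length as = n" for as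
    by (rule finite_subset[OF _ finite_lists_nth_keys[of n "F as"]]) (auto simp: coeff[OF that, symmetric])
  then show ce: "\<delta> \<in> ce_cochains n" using \<delta> by (simp add: mem_ce_cochains_iff)
  have "F as = poly_map n \<delta> as" for as
  proof (cases "length as = n")
    case True
    have "Poly_Mapping.lookup (F as) (Poly_Mapping.nth ms) = Poly_Mapping.lookup (poly_map n \<delta> as) (Poly_Mapping.nth ms)"
      if "length ms = n" for ms
      using True that by (simp add: lookup_poly_map[OF ce] coeff[symmetric])
    then show ?thesis
      using F(2)[OF True] by (intro vars_below_eqI[of n] vars_below_poly_map)
  qed (simp add: F poly_map_def)
  then have F_eq: "F = poly_map n \<delta>" ..
  show "F \<in> basic_cochains n" "coeff_map n F = \<delta>"
    unfolding F_eq using ce by (simp_all add: poly_map_basic_cochain coeff_map_poly_map)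
qed

lemma inj_on_coeff_map:
  "inj_on (coeff_map n) (basic_cochains n :: ('a::del_module list \<Rightarrow> 'm::del_module mpol) set)"
proof (rule inj_onI, rule ext)
  fix \<gamma> \<gamma>' :: "'a list \<Rightarrow> 'm mpol" and as
  assume \<gamma>: "\<gamma> \<in> basic_cochains n" and \<gamma>': "\<gamma>' \<in> basic_cochains n" and eq: "coeff_map n \<gamma> = coeff_map n \<gamma>'"
  show "\<gamma> as = \<gamma>' as"
  proof (cases "length as = n")
    case True
    have "Poly_Mapping.lookup (\<gamma> as) (Poly_Mapping.nth ms) = Poly_Mapping.lookup (\<gamma>' as) (Poly_Mapping.nth ms)"
      if "length ms = n" for ms
      using fun_cong[OF eq, of "map2 gen as ms"] True that
      by (simp add: coeff_map_gen[OF \<gamma>] coeff_map_gen[OF \<gamma>'])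
    then show ?thesis
      by (intro vars_below_eqI[of n] basic_cochainsD(2)[OF \<gamma>] basic_cochainsD(2)[OF \<gamma>'])
  next
    case False
    then show ?thesis using basic_cochainsD(1)[OF \<gamma>] basic_cochainsD(1)[OF \<gamma>'] by simp
  qed
qed

lemma bij_betw_coeff_map:
  "bij_betw (coeff_map n) (basic_cochains n :: ('a::del_module list \<Rightarrow> 'm::del_module mpol) set) (ce_cochains n)"
  unfolding bij_betw_def
proof (intro conjI equalityI subsetI inj_on_coeff_map)
  fix \<delta> :: "'a annih list \<Rightarrow> 'm"
  assume "\<delta> \<in> ce_cochains n"
  then show "\<delta> \<in> coeff_map n ` basic_cochains n"
    by (metis coeff_map_poly_map poly_map_basic_cochain image_eqI)
qed (auto intro: coeff_map_ce_cochain)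

lemma coeff_map_linear:
  "coeff_map n (\<lambda>as. \<gamma> as + \<gamma>' as) = (\<lambda>xs. coeff_map n \<gamma> xs + coeff_map n \<gamma>' xs)"
  "coeff_map n (\<lambda>as. c *\<^sub>C \<gamma> as) = (\<lambda>xs. c *\<^sub>C coeff_map n \<gamma> xs)"
  by (auto simp: coeff_map_def fun_eq_iff extend_linear[symmetric] lookup_add scaleC_add_right mult.commute)


section \<open>The differentials correspond\<close>

lemma ce_del_conv_lie_deriv: "ce_del \<delta> = lie_deriv \<partial> \<partial> \<delta>"
  by (rule ext) (simp add: ce_del_def lie_deriv_conv_sum)

section \<open>Bookkeeping for omitted indices\<close>

lemma nths_conv_map: "nths xs A = map ((!) xs) (nths [0..<length xs] A)"
  by (metis map_nth nths_map)

lemma nths_map2: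
  "length xs = length ys \<Longrightarrow> nths (map2 f xs ys) A = map2 f (nths xs A) (nths ys A)"
  by (subst (1 2 3) nths_conv_map) (auto simp: zip_map1 zip_map2 zip_same_conv_map set_nths)

lemma set_nths_upt: "set (nths [0..<N] (- J)) = {..<N} - J"
  by (auto simp: set_nths) (metis add_0 nth_upt)

lemma length_nths_remove:
  assumes "J \<subseteq> {..<length xs}"
  shows "length (nths xs (- J)) = length xs - card J"
proof -
  have "{i. i < length xs \<and> i \<in> - J} = {..<length xs} - J" by auto
  then show ?thesis using assms by (simp add: length_nths card_Diff_subset finite_subset)
qed

text \<open>Indexing into \<open>nths [0..<N] (- J)\<close> enumerates the indices outside J. This
  enumeration is the renaming \<rho> to which the substitution lemmas are applied whenever arguments
  are omitted.\<close>

lemma nth_nths_image: "(!) (nths [0..<N] (- J)) ` {..<length (nths [0..<N] (- J))} = {..<N} - J"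
  unfolding set_nths_upt[symmetric] by (auto simp: set_conv_nth)

lemma inj_on_nth_nths: "inj_on ((!) (nths [0..<N] A)) {..<length (nths [0..<N] A)}"
  by (rule inj_on_nth) (auto intro: distinct_nthsI)

lemma prod_list_nths_remove:
  assumes "length ms = N" "J \<subseteq> {..<N}"
  shows "(\<Prod>m\<leftarrow>ms. f m) = (\<Prod>k\<in>J. f (ms ! k)) * (\<Prod>m\<leftarrow>nths ms (- J). f m :: 'r::comm_monoid_mult)"
proof -
  have "(\<Prod>m\<leftarrow>nths ms (- J). f m) = (\<Prod>k\<leftarrow>nths [0..<N] (- J). f (ms ! k))"
    by (subst nths_conv_map) (simp add: assms o_def)
  also have "\<dots> = (\<Prod>k\<in>{..<N} - J. f (ms ! k))"
    unfolding set_nths_upt[symmetric] by (rule prod.distinct_set_conv_list[symmetric]) (simp add: distinct_nthsI)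
  finally have "(\<Prod>m\<leftarrow>nths ms (- J). f m) = (\<Prod>k\<in>{..<N} - J. f (ms ! k))" .
  moreover have "(\<Prod>m\<leftarrow>ms. f m) = (\<Prod>k<N. f (ms ! k))"
    using prod.distinct_set_conv_list[of "[0..<N]" "\<lambda>k. f (ms ! k)"] assms(1)
    by (metis (no_types, lifting) distinct_upt list.map_comp map_nth o_def map_eq_conv atLeast_upt)
  ultimately show ?thesis
    using prod.subset_diff[OF assms(2) finite_lessThan, of "\<lambda>k. f (ms ! k)"] by (simp add: mult.commute)
qed

lemma map_lookup_nth_nths:
  assumes "length ms = N"
  shows "map (\<lambda>l. Poly_Mapping.lookup (Poly_Mapping.nth ms) (nths [0..<N] A ! l)) [0..<length (nths [0..<N] A)] = nths ms A"
proof -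
  have "nths [0..<N] A ! l < N" if "l < length (nths [0..<N] A)" for l
    using nth_mem[OF that] by (auto simp: set_nths)
  then show ?thesis
    by (subst nths_conv_map) (auto simp: assms lookup_nth_list intro!: nth_equalityI simp del: lookup_nth)
qed

lemma nths_update_removed: "i \<notin> A \<Longrightarrow> nths (xs[i := x]) A = nths xs A"
  by (subst (1 2) nths_conv_map) (auto simp: set_nths, metis nth_list_update_neq)

lemma lookup_eval_at:
  assumes \<gamma>: "\<gamma> \<in> basic_cochains n" and n: "length (nths [0..<N] (- J)) = n"
  shows "Poly_Mapping.lookup (eval_at \<gamma> (nths (map Var [0..<N]) (- J)) as) e =
    (Poly_Mapping.lookup (\<gamma> as)
      (Poly_Mapping.nth (map (\<lambda>l. Poly_Mapping.lookup e (nths [0..<N] (- J) ! l)) [0..<n]))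
      when Poly_Mapping.keys e \<subseteq> {..<N} - J)"
  unfolding eval_at_def
  using inj_on_nth_nths[of N "- J"] nth_nths_image[of N J] n
  by (subst lookup_psubst_Var[of n _ "(!) (nths [0..<N] (- J))"])
    (simp_all add: basic_cochainsD(2)[OF \<gamma>] nths_map)

section \<open>Coefficients of the two kinds of terms\<close>

context conformal_module
begin

lemma lookup_act_term:
  assumes \<gamma>: "\<gamma> \<in> basic_cochains n" and i: "i \<le> n"
  shows "Poly_Mapping.lookup (lam act (Var i) (const a) (eval_at \<gamma> (nths (map Var [0..<Suc n]) (- {i})) as)) e =
    Poly_Mapping.lookup (act a (Poly_Mapping.lookup (eval_at \<gamma> (nths (map Var [0..<Suc n]) (- {i})) as)
      (e - Poly_Mapping.single i (Poly_Mapping.lookup e i)))) (Poly_Mapping.lookup e i)"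
proof (rule lookup_lam_Var)
  fix l
  assume "l \<in> Poly_Mapping.keys (eval_at \<gamma> (nths (map Var [0..<Suc n]) (- {i})) as)"
  moreover have "length (nths [0..<Suc n] (- {i})) = n"
    using i by (subst length_nths_remove) auto
  ultimately have "Poly_Mapping.keys l \<subseteq> {..<Suc n} - {i}"
    by (auto simp only: in_keys_iff lookup_eval_at[OF \<gamma>] when_def split: if_splits)
  then show "Poly_Mapping.lookup l i = 0"
    by (auto simp: in_keys_iff)
qed simp_all

lemma vars_below_act_term:
  assumes \<gamma>: "\<gamma> \<in> basic_cochains n" and i: "i \<le> n"
  shows "vars_below (Suc n) (lam act (Var i) (const a) (eval_at \<gamma> (nths (map Var [0..<Suc n]) (- {i})) as))"
proof (rule vars_belowI)
  fix e
  assume "Poly_Mapping.lookup (lam act (Var i) (const a) (eval_at \<gamma> (nths (map Var [0..<Suc n]) (- {i})) as)) e \<noteq> 0"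
  then have "Poly_Mapping.lookup (eval_at \<gamma> (nths (map Var [0..<Suc n]) (- {i})) as)
      (e - Poly_Mapping.single i (Poly_Mapping.lookup e i)) \<noteq> 0"
    unfolding lookup_act_term[OF assms] by (metis act_0(2) lookup_zero)
  moreover have "length (nths [0..<Suc n] (- {i})) = n"
    using i by (subst length_nths_remove) auto
  ultimately have *: "Poly_Mapping.keys (e - Poly_Mapping.single i (Poly_Mapping.lookup e i)) \<subseteq> {..<Suc n} - {i}"
    by (auto simp only: lookup_eval_at[OF \<gamma>] when_def split: if_splits)
  show "Poly_Mapping.keys e \<subseteq> {..<Suc n}"
  proof
    fix x assume x: "x \<in> Poly_Mapping.keys e"
    show "x \<in> {..<Suc n}"
    proof (cases "x = i")
      case False
      then have "x \<in> Poly_Mapping.keys (e - Poly_Mapping.single i (Poly_Mapping.lookup e i))"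
        using x by (simp add: in_keys_iff lookup_minus lookup_single)
      then show ?thesis using * by blast
    qed (use i in simp)
  qed
qed

text \<open>The factor (m_i)! turns the coefficient of the variable i into the product a_(m_i), that
  is, the action of a generator; the remaining factorials are those that \<open>coeff_map\<close>
  puts on the other arguments.\<close>

lemma coeff_act_term:
  assumes \<gamma>: "\<gamma> \<in> basic_cochains n" and i: "i \<le> n" and len: "length ms = Suc n" "length as = n"
  shows "(\<Prod>m\<leftarrow>ms. fact m) *\<^sub>C Poly_Mapping.lookup
      (lam act (Var i) (const a) (eval_at \<gamma> (nths (map Var [0..<Suc n]) (- {i})) as)) (Poly_Mapping.nth ms) =
    annih_act act (gen a (ms ! i)) (coeff_map n \<gamma> (map2 gen as (nths ms (- {i}))))"
proof -
  let ?ms = "nths ms (- {i})"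
  have R: "length (nths [0..<Suc n] (- {i})) = n"
    using i by (subst length_nths_remove) auto
  \<comment> \<open>Removing the power of the variable i puts 0 at position i, which the enumeration
    of the other indices then skips.\<close>
  have e: "Poly_Mapping.nth ms - Poly_Mapping.single i (ms ! i) = Poly_Mapping.nth (ms[i := 0])"
    using i len by (subst nth_minus_single) auto
  have "Poly_Mapping.keys (Poly_Mapping.nth (ms[i := 0])) \<subseteq> {..<Suc n} - {i}"
    using i len by (auto simp only: in_keys_iff lookup_nth_list split: if_splits) simp_all
  moreover have "map (\<lambda>l. Poly_Mapping.lookup (Poly_Mapping.nth (ms[i := 0])) (nths [0..<Suc n] (- {i}) ! l)) [0..<n] = ?ms"
    using map_lookup_nth_nths[of "ms[i := 0]" "Suc n" "- {i}"] len R
    by (simp only: nths_update_removed length_list_update) (simp add: nths_update_removed)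
  ultimately have lookup: "Poly_Mapping.lookup (lam act (Var i) (const a) (eval_at \<gamma> (nths (map Var [0..<Suc n]) (- {i})) as)) (Poly_Mapping.nth ms) =
      Poly_Mapping.lookup (act a (Poly_Mapping.lookup (\<gamma> as) (Poly_Mapping.nth ?ms))) (ms ! i)"
    using i len unfolding lookup_act_term[OF \<gamma> i] lookup_eval_at[OF \<gamma> R]
    by (simp add: e lookup_nth_list del: lookup_nth keys_nth upt_Suc)
  have "length ?ms = n" using i len by (subst length_nths_remove) auto
  then show ?thesis
    using prod_list_nths_remove[OF len(1), of "{i}" "fact :: nat \<Rightarrow> complex"] i len
    by (simp add: lookup coeff_map_gen[OF \<gamma>] annih_act_gen act_nprod del: upt_Suc)
      (simp add: nprod_def mult.commute)
qed

lemma eval_at_hd_bracket: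
  "eval_at_hd \<gamma> qs (lam br (Var i) (const a) (const b)) as =
    (\<Sum>l\<in>Poly_Mapping.keys (br a b). Poly_Mapping.single (Poly_Mapping.single i l) 1 \<cdot>
      eval_at \<gamma> qs (Poly_Mapping.lookup (br a b) l # as))"
  unfolding eval_at_hd_def
  by (rule sum_keys_lam_Var_const_const[where g = "\<lambda>k x. Poly_Mapping.single k 1 \<cdot> eval_at \<gamma> qs (x # as)"]) simp_all

lemma lookup_eval_at_add:
  assumes \<gamma>: "\<gamma> \<in> basic_cochains (Suc n)" and ij: "i \<noteq> j" "i \<in> J" "j \<in> J"
    and n: "length (nths [0..<N] (- J)) = n"
  shows "Poly_Mapping.lookup (eval_at \<gamma> ((Var i + Var j) # nths (map Var [0..<N]) (- J)) as) e =
    ((of_nat (Poly_Mapping.lookup e i + Poly_Mapping.lookup e j choose Poly_Mapping.lookup e j) *\<^sub>C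
      Poly_Mapping.lookup (\<gamma> as) (Poly_Mapping.nth ((Poly_Mapping.lookup e i + Poly_Mapping.lookup e j) #
        map (\<lambda>l. Poly_Mapping.lookup e (nths [0..<N] (- J) ! l)) [0..<n])))
      when Poly_Mapping.keys e \<subseteq> insert i (insert j ({..<N} - J)))"
  unfolding eval_at_def
  using inj_on_nth_nths[of N "- J"] nth_nths_image[of N J] n ij
  by (subst lookup_psubst_Var_add_Var[of n _ "(!) (nths [0..<N] (- J))" i j])
    (simp_all add: basic_cochainsD(2)[OF \<gamma>] nths_map)

lemma vars_below_bracket_term:
  assumes \<gamma>: "\<gamma> \<in> basic_cochains n" and ij: "i < j" "j \<le> n"
  shows "vars_below (Suc n) (eval_at_hd \<gamma> ((Var i + Var j) # nths (map Var [0..<Suc n]) (- {i, j}))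
    (lam br (Var i) (const a) (const b)) as)"
  unfolding eval_at_hd_bracket
proof (intro vars_below_sum vars_below_monom_pmult vars_belowI)
  obtain n' where n': "n = Suc n'" using ij by (cases n) auto
  have R: "length (nths [0..<Suc n] (- {i, j})) = n'"
    using ij n' by (subst length_nths_remove) auto
  fix l e
  assume "Poly_Mapping.lookup (eval_at \<gamma> ((Var i + Var j) # nths (map Var [0..<Suc n]) (- {i, j}))
    (Poly_Mapping.lookup (br a b) l # as)) e \<noteq> 0"
  then have "Poly_Mapping.keys e \<subseteq> insert i (insert j ({..<Suc n} - {i, j}))"
    using ij by (subst (asm) lookup_eval_at_add[OF \<gamma>[unfolded n'] _ _ _ R]) (auto simp: when_def split: if_splits)
  also have "\<dots> \<subseteq> {..<Suc n}" using ij by auto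
  finally show "Poly_Mapping.keys e \<subseteq> {..<Suc n}" .
qed (use ij in auto)

text \<open>The variable i receives a power l from the bracket, and the rest comes from the power
  m_i + m_j - l of the sum of two variables. With (m_i)! (m_j)! in front,
  \<open>fact_mult_binomial\<close> turns its binomial coefficient into (m_i choose l) l! (m_i + m_j
  - l)!: the bracket coefficient, the factorial of the l-th product, and the factorial of the new
  generator.\<close>

lemma coeff_bracket_term:
  assumes \<gamma>: "\<gamma> \<in> basic_cochains n" and ij: "i < j" "j \<le> n"
    and len: "length ms = Suc n" "length as = n - 1"
  shows "(\<Prod>m\<leftarrow>ms. fact m) *\<^sub>C Poly_Mapping.lookup
      (eval_at_hd \<gamma> ((Var i + Var j) # nths (map Var [0..<Suc n]) (- {i, j}))
        (lam br (Var i) (const a) (const b)) as) (Poly_Mapping.nth ms) =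
    coeff_map n \<gamma> (annih_bracket br (gen a (ms ! i)) (gen b (ms ! j)) # map2 gen as (nths ms (- {i, j})))"
proof -
  obtain n' where n': "n = Suc n'" using ij by (cases n) auto
  have R: "length (nths [0..<Suc n] (- {i, j})) = n'"
    using ij n' by (subst length_nths_remove) auto
  let ?ms = "nths ms (- {i, j})"
  let ?x = "Poly_Mapping.lookup (br a b)"
  let ?m = "ms ! i" and ?n = "ms ! j"
  let ?c = "\<lambda>l x. Poly_Mapping.lookup (\<gamma> (x # as)) (Poly_Mapping.nth ((?m + ?n - l) # ?ms))"
  have len_ms: "length ?ms = n'" using ij len n' by (subst length_nths_remove) auto
  have len_as: "length as = n'" using len n' by simp
  have hd: "clinear (\<lambda>x. \<gamma> (x # as))"
    using basic_cochainsD(3)[OF \<gamma>] len_as n' by (auto intro: multilinear_hd)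
  have "Poly_Mapping.lookup (Poly_Mapping.single (Poly_Mapping.single i l) 1 \<cdot>
      eval_at \<gamma> ((Var i + Var j) # nths (map Var [0..<Suc n]) (- {i, j})) (x # as)) (Poly_Mapping.nth ms) =
      ((of_nat (?m + ?n - l choose ?n) *\<^sub>C ?c l x) when l \<le> ?m)" for l x
  proof -
    have e: "Poly_Mapping.nth ms - Poly_Mapping.single i l = Poly_Mapping.nth (ms[i := ?m - l])"
      using ij len by (subst nth_minus_single) auto
    have keys: "Poly_Mapping.keys (Poly_Mapping.nth (ms[i := ?m - l])) \<subseteq> insert i (insert j ({..<Suc n} - {i, j}))"
      using keys_nth_subset[of "ms[i := ?m - l]"] len by auto
    have rest: "map (\<lambda>k. Poly_Mapping.lookup (Poly_Mapping.nth (ms[i := ?m - l])) (nths [0..<Suc n] (- {i, j}) ! k)) [0..<n'] = ?ms"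
      using map_lookup_nth_nths[of "ms[i := ?m - l]" "Suc n" "- {i, j}"] len R
      by (simp only: nths_update_removed length_list_update) (simp add: nths_update_removed)
    have "(\<forall>x. Poly_Mapping.lookup (Poly_Mapping.single i l) x \<le> Poly_Mapping.lookup (Poly_Mapping.nth ms) x) \<longleftrightarrow> l \<le> ?m"
      using ij len by (auto simp: lookup_single when_def lookup_nth_list simp del: lookup_nth dest: spec[of _ i])
    moreover have "Poly_Mapping.lookup (Poly_Mapping.nth (ms[i := ?m - l])) i = ?m - l"
      "Poly_Mapping.lookup (Poly_Mapping.nth (ms[i := ?m - l])) j = ?n"
      using ij len by (simp_all add: lookup_nth_list del: lookup_nth)
    then have "Poly_Mapping.lookup (eval_at \<gamma> ((Var i + Var j) # nths (map Var [0..<Suc n]) (- {i, j})) (x # as))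
        (Poly_Mapping.nth (ms[i := ?m - l])) =
        of_nat (?m - l + ?n choose ?n) *\<^sub>C
        Poly_Mapping.lookup (\<gamma> (x # as)) (Poly_Mapping.nth ((?m - l + ?n) # ?ms))"
      using ij len keys
      by (subst lookup_eval_at_add[OF \<gamma>[unfolded n'] _ _ _ R])
        (simp_all add: rest del: lookup_nth keys_nth upt_Suc)
    ultimately show ?thesis
      unfolding lookup_monom_pmult e by (auto simp: when_def)
  qed
  then have "Poly_Mapping.lookup (eval_at_hd \<gamma> ((Var i + Var j) # nths (map Var [0..<Suc n]) (- {i, j}))
        (lam br (Var i) (const a) (const b)) as) (Poly_Mapping.nth ms) =
      (\<Sum>l\<in>Poly_Mapping.keys (br a b). ((of_nat (?m + ?n - l choose ?n) *\<^sub>C ?c l (?x l)) when l \<le> ?m))"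
    unfolding eval_at_hd_bracket lookup_sum by simp
  \<comment> \<open>The bracket of the annihilation algebra sums over l up to m_i. Larger l do not
    divide the monomial, and an l outside the support of the bracket gives 0 by linearity in the
    first argument.\<close>
  also have "\<dots> = (\<Sum>l\<le>?m. ((of_nat (?m + ?n - l choose ?n) *\<^sub>C ?c l (?x l)) when l \<le> ?m))"
    by (rule sum_keys_eq_sum_atMost[where g = "\<lambda>l x. ((of_nat (?m + ?n - l choose ?n) *\<^sub>C ?c l x) when l \<le> ?m)"])
      (simp_all add: clinear_0[OF hd])
  finally have lookup: "Poly_Mapping.lookup (eval_at_hd \<gamma> ((Var i + Var j) # nths (map Var [0..<Suc n]) (- {i, j}))
        (lam br (Var i) (const a) (const b)) as) (Poly_Mapping.nth ms) =
      (\<Sum>l\<le>?m. of_nat (?m + ?n - l choose ?n) *\<^sub>C ?c l (?x l))" by simp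
  let ?P = "\<Prod>m\<leftarrow>?ms. fact m :: complex"
  have P: "(\<Prod>m\<leftarrow>ms. fact m) = fact ?m * fact ?n * ?P"
    using prod_list_nths_remove[OF len(1), of "{i, j}" fact] ij len by simp
  have lin: "clinear (\<lambda>x. coeff_map n \<gamma> (x # map2 gen as ?ms))"
    using multilinear_coeff_map[OF \<gamma>] len_as len_ms n' by (auto intro: multilinear_hd)
  have "coeff_map n \<gamma> (gen x m # map2 gen as ?ms) =
      (fact m * ?P) *\<^sub>C Poly_Mapping.lookup (\<gamma> (x # as)) (Poly_Mapping.nth (m # ?ms))" for x m
    using coeff_map_gen[OF \<gamma>, of "x # as" "m # ?ms"] len_as len_ms n' by simp
  then have "coeff_map n \<gamma> (annih_bracket br (gen a ?m) (gen b ?n) # map2 gen as ?ms) =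
      (\<Sum>l\<le>?m. of_nat (?m choose l) *\<^sub>C fact l *\<^sub>C (fact (?m + ?n - l) * ?P) *\<^sub>C ?c l (?x l))"
    using lin hd
    by (simp add: annih_bracket_gen clinear_sum[OF lin] clinear_iff nprod_def gen_linear_simps mult.assoc)
  also have "\<dots> = (\<Sum>l\<le>?m. (fact ?m * fact ?n * ?P) *\<^sub>C of_nat (?m + ?n - l choose ?n) *\<^sub>C ?c l (?x l))"
  proof (rule sum.cong)
    fix l assume "l \<in> {..?m}"
    then have "of_nat (?m choose l) * (fact l * (fact (?m + ?n - l) * ?P)) =
        fact ?m * fact ?n * ?P * of_nat (?m + ?n - l choose ?n)"
      using fact_mult_binomial[of l ?m ?n, where 'a = complex] by (simp add: ac_simps)
    then show "of_nat (?m choose l) *\<^sub>C fact l *\<^sub>C (fact (?m + ?n - l) * ?P) *\<^sub>C ?c l (?x l) =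
        (fact ?m * fact ?n * ?P) *\<^sub>C of_nat (?m + ?n - l choose ?n) *\<^sub>C ?c l (?x l)"
      by (simp only: scaleC_scaleC)
  qed simp
  finally show ?thesis
    unfolding lookup P by (simp only: scaleC.scale_sum_right)
qed

lemma coeff_basic_d:
  assumes \<gamma>: "\<gamma> \<in> basic_cochains n" and len: "length as = Suc n" "length ms = Suc n"
  shows "(\<Prod>m\<leftarrow>ms. fact m) *\<^sub>C Poly_Mapping.lookup (basic_d br act \<gamma> as) (Poly_Mapping.nth ms) =
    ce_d br act (coeff_map n \<gamma>) (map2 gen as ms)"
proof -
  let ?P = "\<Prod>m\<leftarrow>ms. fact m :: complex"
  let ?A = "\<lambda>i. lam act (Var i) (const (as ! i))
    (eval_at \<gamma> (nths (map Var [0..<Suc n]) (- {i})) (nths as (- {i})))"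
  let ?B = "\<lambda>i j. eval_at_hd \<gamma> ((Var i + Var j) # nths (map Var [0..<Suc n]) (- {i, j}))
    (lam br (Var i) (const (as ! i)) (const (as ! j))) (nths as (- {i, j}))"
  let ?xs = "map2 gen as ms"
  have A: "?P *\<^sub>C Poly_Mapping.lookup (?A i) (Poly_Mapping.nth ms) =
      annih_act act (?xs ! i) (coeff_map n \<gamma> (nths ?xs (- {i})))" if "i < Suc n" for i
  proof -
    have "length (nths as (- {i})) = n"
      using that len by (subst length_nths_remove) auto
    then show ?thesis
      using that len by (simp add: coeff_act_term[OF \<gamma>] nths_map2 del: upt_Suc)
  qed
  have B: "?P *\<^sub>C Poly_Mapping.lookup (?B i j) (Poly_Mapping.nth ms) =
      coeff_map n \<gamma> (annih_bracket br (?xs ! i) (?xs ! j) # nths ?xs (- {i, j}))" if "i < j" "j < Suc n" for i j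
  proof -
    have "length (nths as (- {i, j})) = n - 1"
      using that len by (subst length_nths_remove) auto
    then show ?thesis
      using that len by (simp add: coeff_bracket_term[OF \<gamma>] nths_map2 del: upt_Suc)
  qed
  have "?P *\<^sub>C Poly_Mapping.lookup (basic_d br act \<gamma> as) (Poly_Mapping.nth ms) =
      (\<Sum>i<Suc n. (- 1) ^ i *\<^sub>C ?P *\<^sub>C Poly_Mapping.lookup (?A i) (Poly_Mapping.nth ms)) +
      (\<Sum>j<Suc n. \<Sum>i<j. (- 1) ^ (i + j) *\<^sub>C ?P *\<^sub>C Poly_Mapping.lookup (?B i j) (Poly_Mapping.nth ms))"
    unfolding basic_d_def Let_def len
    by (simp add: lookup_add lookup_sum scaleC_add_right scaleC.scale_sum_right mult.commute
        del: sum.lessThan_Suc upt_Suc)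
  also have "\<dots> = ce_d br act (coeff_map n \<gamma>) ?xs"
    unfolding ce_d_def Let_def using len
    by (intro arg_cong2[where f = "(+)"] sum.cong refl) (simp_all add: A B del: upt_Suc)
  finally show ?thesis .
qed

lemma vars_below_basic_d:
  assumes \<gamma>: "\<gamma> \<in> basic_cochains n" and len: "length as = Suc n"
  shows "vars_below (Suc n) (basic_d br act \<gamma> as)"
  unfolding basic_d_def Let_def len
  by (intro vars_below_add vars_below_sum vars_below_scaleC vars_below_act_term[OF \<gamma>] vars_below_bracket_term[OF \<gamma>])
    auto

lemma basic_d_outside:
  assumes \<gamma>: "\<gamma> \<in> basic_cochains n" and len: "length as \<noteq> Suc n"
  shows "basic_d br act \<gamma> as = 0"
proof -
  have eval_0: "eval_at \<gamma> qs xs = 0" if "length xs \<noteq> n" for qs xs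
    using basic_cochainsD(1)[OF \<gamma> that] by (simp add: eval_at_def psubst_def)
  have "lam act q P (eval_at \<gamma> qs (nths as (- {i}))) = 0" if "i < length as" for q P qs i
    using that len by (subst eval_0) (auto simp: length_nths_remove lam_def)
  moreover have "eval_at_hd \<gamma> qs P (nths as (- {i, j})) = 0" if "i < j" "j < length as" for qs P i j
  proof -
    have "length (nths as (- {i, j})) = length as - 2"
      using that by (subst length_nths_remove) auto
    then show ?thesis
      using that len by (simp add: eval_at_hd_def eval_0 pmult_def)
  qed
  ultimately show ?thesis by (simp add: basic_d_def Let_def)
qed

text \<open>At length n + 1 this is \<open>cartan_d_conv_sum\<close>. At any other length each list
  handed to \<delta> has the wrong length, so all terms vanish.\<close>

lemma ce_d_conv_cartan_d:
  assumes "\<delta> \<in> ce_cochains n"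
  shows "ce_d br act \<delta> xs = (if length xs = Suc n then annih.cartan_d \<delta> xs else 0)"
proof (cases "length xs = Suc n")
  case True
  then show ?thesis
    using assms annih.cartan_d_conv_sum[of n \<delta> xs] by (simp add: ce_d_def Let_def mem_ce_cochains_iff)
next
  case False
  have zero: "\<delta> ys = 0" if "length ys \<noteq> n" for ys
    using assms that by (simp add: mem_ce_cochains_iff)
  have "\<delta> (nths xs (- {i})) = 0" if "i < length xs" for i
    using that False by (intro zero) (auto simp: length_nths_remove)
  moreover have "\<delta> (y # nths xs (- {i, j})) = 0" if "i < j" "j < length xs" for y i j
  proof -
    have "length (nths xs (- {i, j})) = length xs - 2"
      using that by (subst length_nths_remove) auto
    then show ?thesis using that False by (intro zero) auto
  qed
  ultimately show ?thesis
    using False by (simp add: ce_d_def Let_def clinear_0[OF clinear_annih_act(2)])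
qed

lemma ce_d_multilinear_alternating:
  assumes "\<delta> \<in> ce_cochains n"
  shows "multilinear (Suc n) (ce_d br act \<delta>)" "alternating (Suc n) (ce_d br act \<delta>)"
proof -
  have \<delta>: "multilinear n \<delta>" "alternating n \<delta>" using assms by (simp_all add: mem_ce_cochains_iff)
  show "multilinear (Suc n) (ce_d br act \<delta>)"
    using annih.multilinear_cartan_d[OF \<delta>(1)]
    by (rule iffD1[OF multilinear_cong, rotated]) (simp add: ce_d_conv_cartan_d[OF assms])
  show "alternating (Suc n) (ce_d br act \<delta>)"
    using annih.alternating_cartan_d[OF \<delta>] by (simp add: alternating_def ce_d_conv_cartan_d[OF assms])
qed

text \<open>An instance of \<open>coeff_transfer\<close>: the bound on the variables is checked on
  the polynomials, multilinearity and skew-symmetry on \<open>ce_d\<close>.\<close>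

lemma coeff_map_basic_d:
  assumes "\<gamma> \<in> basic_cochains n"
  shows "basic_d br act \<gamma> \<in> basic_cochains (Suc n)"
    and "coeff_map (Suc n) (basic_d br act \<gamma>) = ce_d br act (coeff_map n \<gamma>)"
  using coeff_transfer[of "Suc n" "basic_d br act \<gamma>" "ce_d br act (coeff_map n \<gamma>)"]
    basic_d_outside[OF assms] vars_below_basic_d[OF assms]
    ce_d_conv_cartan_d[OF coeff_map_ce_cochain[OF assms]]
    ce_d_multilinear_alternating[OF coeff_map_ce_cochain[OF assms]] coeff_basic_d[OF assms]
  by simp_all

text \<open>The continuity of \<open>d \<delta>\<close> comes for free from the finite support of polynomials.\<close>

lemma ce_d_closed:
  assumes "\<delta> \<in> ce_cochains n"
  shows "ce_d br act \<delta> \<in> ce_cochains (Suc n)"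
  using coeff_map_ce_cochain[OF coeff_map_basic_d(1)[OF poly_map_basic_cochain[OF assms]]]
  by (simp add: coeff_map_basic_d(2)[OF poly_map_basic_cochain[OF assms]] coeff_map_poly_map[OF assms])

lemma ce_d_ce_d:
  assumes "\<delta> \<in> ce_cochains n"
  shows "ce_d br act (ce_d br act \<delta>) = (\<lambda>_. 0)"
proof
  fix xs :: "'a annih list"
  show "ce_d br act (ce_d br act \<delta>) xs = 0"
  proof (cases "length xs = Suc (Suc n)")
    case True
    have "annih.cartan_d (ce_d br act \<delta>) xs = annih.cartan_d (annih.cartan_d \<delta>) xs"
      by (rule annih.cartan_d_cong) (simp add: ce_d_conv_cartan_d[OF assms] True)
    then show ?thesis
      using assms True annih.cartan_d_cartan_d[of n \<delta> xs]
      by (simp add: ce_d_conv_cartan_d[OF ce_d_closed[OF assms]] mem_ce_cochains_iff)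
  qed (simp add: ce_d_conv_cartan_d[OF ce_d_closed[OF assms]])
qed

lemma ce_d_linear:
  "ce_d br act (\<lambda>xs. \<delta> xs + \<epsilon> xs) = (\<lambda>xs. ce_d br act \<delta> xs + ce_d br act \<epsilon> xs)"
  "ce_d br act (\<lambda>xs. c *\<^sub>C \<delta> xs) = (\<lambda>xs. c *\<^sub>C ce_d br act \<delta> xs)"
  by (simp_all add: fun_eq_iff ce_d_def Let_def annih_act_linear scaleC_add_right sum.distrib
      scaleC.scale_sum_right mult.commute)

text \<open>\<partial> is a derivation of the annihilation algebra together with its module, so
  \<open>lie_deriv_cartan_d\<close> applies to it as it does to L_x.\<close>

lemma ce_d_del:
  assumes "\<delta> \<in> ce_cochains n" "ce_del \<delta> \<in> ce_cochains n"
  shows "ce_d br act (ce_del \<delta>) = ce_del (ce_d br act \<delta>)"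
proof
  fix xs :: "'a annih list"
  show "ce_d br act (ce_del \<delta>) xs = ce_del (ce_d br act \<delta>) xs"
  proof (cases "length xs = Suc n")
    case True
    have "lie_deriv \<partial> \<partial> (annih.cartan_d \<delta>) xs = annih.cartan_d (lie_deriv \<partial> \<partial> \<delta>) xs"
      using assms(1) True
      by (intro annih.lie_deriv_cartan_d[of _ _ n] clinear_del del_annih_act del_annih_bracket)
        (simp_all add: mem_ce_cochains_iff)
    moreover have "lie_deriv \<partial> \<partial> (ce_d br act \<delta>) xs = lie_deriv \<partial> \<partial> (annih.cartan_d \<delta>) xs"
      by (rule lie_deriv_cong) (simp add: ce_d_conv_cartan_d[OF assms(1)] True)
    ultimately show ?thesis
      by (simp add: ce_d_conv_cartan_d[OF assms(2)] True) (simp add: ce_del_conv_lie_deriv)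
  next
    case False
    then show ?thesis
      by (simp add: ce_d_conv_cartan_d[OF assms(1)] ce_d_conv_cartan_d[OF assms(2)] ce_del_def)
  qed
qed

end

text \<open>Multiplication by the i-th variable corresponds to -\<partial> in the i-th argument;
  this carries the sum of \<partial> on M and all variables to \<open>ce_del\<close>.\<close>

lemma coeff_basic_del:
  assumes \<gamma>: "\<gamma> \<in> basic_cochains n" and len: "length as = n" "length ms = n"
  shows "(\<Prod>m\<leftarrow>ms. fact m) *\<^sub>C Poly_Mapping.lookup (basic_del \<gamma> as) (Poly_Mapping.nth ms) =
    ce_del (coeff_map n \<gamma>) (map2 gen as ms)"
proof -
  let ?P = "\<Prod>m\<leftarrow>ms. fact m :: complex"
  let ?xs = "map2 gen as ms"
  have "?P *\<^sub>C Poly_Mapping.lookup (Var i \<cdot> \<gamma> as) (Poly_Mapping.nth ms) = - coeff_map n \<gamma> (?xs[i := \<partial> (?xs ! i)])"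
    if "i < n" for i
  proof -
    have lin: "clinear (\<lambda>x. coeff_map n \<gamma> (?xs[i := x]))"
      using multilinear_coeff_map[OF \<gamma>] that len by (simp add: multilinear_def)
    have "coeff_map n \<gamma> (?xs[i := \<partial> (?xs ! i)]) = - (of_nat (ms ! i) *\<^sub>C coeff_map n \<gamma> (map2 gen as (ms[i := ms ! i - 1])))"
      using lin clinear_minus[OF lin] that len by (simp add: del_gen(2) clinear_iff map2_update_snd)
    then show ?thesis
      using that len prod_list_fact_update[of i ms]
      by (simp add: coeff_map_gen[OF \<gamma>] lookup_Var_pmult_nth when_def)
  qed
  then have "(\<Sum>i<n. ?P *\<^sub>C Poly_Mapping.lookup (Var i \<cdot> \<gamma> as) (Poly_Mapping.nth ms)) =
      - (\<Sum>i<n. coeff_map n \<gamma> (?xs[i := \<partial> (?xs ! i)]))"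
    by (simp add: sum_negf)
  then show ?thesis
    using len
    by (simp add: basic_del_def ce_del_def coeff_map_gen[OF \<gamma>] lookup_add pmult_sum_left lookup_sum
        scaleC_add_right scaleC.scale_sum_right del_scaleC)
qed

lemma coeff_map_basic_del:
  fixes \<gamma> :: "'a::del_module list \<Rightarrow> 'm::del_module mpol"
  assumes \<gamma>: "\<gamma> \<in> basic_cochains n"
  shows "basic_del \<gamma> \<in> basic_cochains n"
    and "coeff_map n (basic_del \<gamma>) = ce_del (coeff_map n \<gamma>)"
proof -
  have ce: "coeff_map n \<gamma> \<in> ce_cochains n" by (rule coeff_map_ce_cochain[OF \<gamma>])
  have 1: "basic_del \<gamma> as = 0" if "length as \<noteq> n" for as
    using basic_cochainsD(1)[OF \<gamma> that] by (simp add: basic_del_def pmult_def)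
  have 2: "vars_below n (basic_del \<gamma> as)" if "length as = n" for as
    unfolding basic_del_def pmult_sum_left
    using basic_cochainsD(2)[OF \<gamma>] that
    by (intro vars_below_add vars_below_del vars_below_sum vars_below_Var_pmult) auto
  have 3: "ce_del (coeff_map n \<gamma>) xs = 0" if "length xs \<noteq> n" for xs
    using that by (simp add: ce_del_def coeff_map_def)
  have 4: "multilinear n (ce_del (coeff_map n \<gamma>))" "alternating n (ce_del (coeff_map n \<gamma>))"
    unfolding ce_del_conv_lie_deriv using ce by (auto simp: mem_ce_cochains_iff intro: multilinear_lie_deriv alternating_lie_deriv clinear_del)
  show "basic_del \<gamma> \<in> basic_cochains n" "coeff_map n (basic_del \<gamma>) = ce_del (coeff_map n \<gamma>)"
    using coeff_transfer[of n "basic_del \<gamma>" "ce_del (coeff_map n \<gamma>)"] 1 2 3 4 coeff_basic_del[OF \<gamma>] by auto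
qed

lemma ce_del_closed:
  assumes "\<delta> \<in> ce_cochains n"
  shows "ce_del \<delta> \<in> ce_cochains n"
  using coeff_map_ce_cochain[OF coeff_map_basic_del(1)[OF poly_map_basic_cochain[OF assms]]]
  by (simp add: coeff_map_basic_del(2)[OF poly_map_basic_cochain[OF assms]] coeff_map_poly_map[OF assms])


section \<open>Quotient complexes\<close>

lemma complex_ring_simps [simp]:
  "carrier complex_ring = UNIV" "x \<otimes>\<^bsub>complex_ring\<^esub> y = x * y" "\<one>\<^bsub>complex_ring\<^esub> = 1"
  "\<zero>\<^bsub>complex_ring\<^esub> = 0" "x \<oplus>\<^bsub>complex_ring\<^esub> y = x + y"
  by (simp_all add: complex_ring_def)

lemma cring_complex_ring: "cring complex_ring"
proof (intro cringI abelian_groupI comm_monoidI)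
  show "\<exists>y\<in>carrier complex_ring. y \<oplus>\<^bsub>complex_ring\<^esub> x = \<zero>\<^bsub>complex_ring\<^esub>" for x
    by (rule bexI[of _ "- x"]) simp_all
qed (simp_all add: algebra_simps)

lemma fun_space_simps [simp]:
  "carrier (fun_space S) = S" "\<zero>\<^bsub>fun_space S\<^esub> = (\<lambda>_. 0)"
  "f \<oplus>\<^bsub>fun_space S\<^esub> g = (\<lambda>x. f x + g x)" "c \<odot>\<^bsub>fun_space S\<^esub> f = (\<lambda>x. c *\<^sub>C f x)"
  by (simp_all add: fun_space_def)

lemma module_fun_space:
  assumes zero: "(\<lambda>_. 0) \<in> S" and add: "\<And>f g. f \<in> S \<Longrightarrow> g \<in> S \<Longrightarrow> (\<lambda>x. f x + g x) \<in> S"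
    and scale: "\<And>c f. f \<in> S \<Longrightarrow> (\<lambda>x. c *\<^sub>C f x) \<in> S"
  shows "Module.module complex_ring (fun_space S)"
proof (intro moduleI cring_complex_ring abelian_groupI)
  show "\<exists>g\<in>carrier (fun_space S). g \<oplus>\<^bsub>fun_space S\<^esub> f = \<zero>\<^bsub>fun_space S\<^esub>" if "f \<in> carrier (fun_space S)" for f
    using that scale[of f "- 1"] by (intro bexI[of _ "\<lambda>x. (- 1) *\<^sub>C f x"]) auto
qed (auto simp: assms scaleC_add_left scaleC_add_right algebra_simps)

lemma linear_mapsD:
  assumes "f \<in> linear_maps V W"
  shows "x \<in> carrier V \<Longrightarrow> f x \<in> carrier W"
    and "x \<in> carrier V \<Longrightarrow> y \<in> carrier V \<Longrightarrow> f (x \<oplus>\<^bsub>V\<^esub> y) = f x \<oplus>\<^bsub>W\<^esub> f y"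
    and "x \<in> carrier V \<Longrightarrow> f (c \<odot>\<^bsub>V\<^esub> x) = c \<odot>\<^bsub>W\<^esub> f x"
  using assms by (auto simp: linear_maps_def)

lemma submodule_image:
  assumes V: "Module.module complex_ring V" and D: "D \<in> linear_maps V V"
  shows "submodule (D ` carrier V) complex_ring V"
proof -
  interpret module complex_ring V by (rule V)
  note D = linear_mapsD[OF D]
  have zero: "D \<zero>\<^bsub>V\<^esub> = \<zero>\<^bsub>V\<^esub>"
    using D(1)[of "\<zero>\<^bsub>V\<^esub>"] D(2)[of "\<zero>\<^bsub>V\<^esub>" "\<zero>\<^bsub>V\<^esub>"] by (metis M.add.l_cancel_one' M.zero_closed M.l_zero)
  show ?thesis
  proof (rule submoduleI)
    show "D ` carrier V \<subseteq> carrier V" using D(1) by auto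
    show "\<zero>\<^bsub>V\<^esub> \<in> D ` carrier V" using zero by (metis M.zero_closed imageI)
    fix x assume "x \<in> D ` carrier V"
    then obtain x' where x: "x' \<in> carrier V" "x = D x'" by blast
    have "D x' \<oplus>\<^bsub>V\<^esub> D (\<ominus>\<^bsub>V\<^esub> x') = \<zero>\<^bsub>V\<^esub>"
      using x zero by (simp add: D(2)[symmetric] M.r_neg)
    then have "\<ominus>\<^bsub>V\<^esub> x = D (\<ominus>\<^bsub>V\<^esub> x')"
      using x D(1) by (metis M.minus_equality M.a_comm M.a_inv_closed)
    then show "\<ominus>\<^bsub>V\<^esub> x \<in> D ` carrier V" using x by simp
    show "c \<odot>\<^bsub>V\<^esub> x \<in> D ` carrier V" for c
      using x D(3)[of x' c, symmetric] by simp
    fix y assume "y \<in> D ` carrier V"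
    then show "x \<oplus>\<^bsub>V\<^esub> y \<in> D ` carrier V"
      using x D(2) by (auto simp: D(2)[symmetric])
  qed
qed

lemma submodule_abelian_subgroup:
  assumes "Module.module complex_ring V" "submodule B complex_ring V"
  shows "abelian_subgroup B V"
proof -
  interpret module complex_ring V by (rule assms(1))
  interpret submodule B complex_ring V by (rule assms(2))
  show ?thesis
    by (rule abelian_subgroupI3) (rule additive_subgroup.intro, rule subgroup_axioms, rule M.abelian_group_axioms)
qed

text \<open>An additive map sends a coset of B only into a coset of B', and adding B' fills it up.
  The lemma covers both scalar multiplication on a quotient, where c = 0 collapses cosets, and
  \<open>quot_d\<close>.\<close>

lemma set_add_image_coset:
  assumes "abelian_subgroup B V" "abelian_subgroup B' W"
    and closed: "\<And>x. x \<in> carrier V \<Longrightarrow> f x \<in> carrier W"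
    and add: "\<And>x y. x \<in> carrier V \<Longrightarrow> y \<in> carrier V \<Longrightarrow> f (x \<oplus>\<^bsub>V\<^esub> y) = f x \<oplus>\<^bsub>W\<^esub> f y"
    and B: "f ` B \<subseteq> B'" and x: "x \<in> carrier V"
  shows "B' <+>\<^bsub>W\<^esub> f ` (B +>\<^bsub>V\<^esub> x) = B' +>\<^bsub>W\<^esub> f x"
proof -
  interpret V: abelian_subgroup B V by fact
  interpret W: abelian_subgroup B' W by fact
  have eq: "h \<oplus>\<^bsub>W\<^esub> f (b \<oplus>\<^bsub>V\<^esub> x) = (h \<oplus>\<^bsub>W\<^esub> f b) \<oplus>\<^bsub>W\<^esub> f x" if "h \<in> B'" "b \<in> B" for h b
    using that x closed B add by (simp add: W.a_assoc image_subset_iff)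
  show ?thesis
  proof (intro equalityI subsetI)
    fix y assume "y \<in> B' <+>\<^bsub>W\<^esub> f ` (B +>\<^bsub>V\<^esub> x)"
    then obtain h b where "h \<in> B'" "b \<in> B" "y = h \<oplus>\<^bsub>W\<^esub> f (b \<oplus>\<^bsub>V\<^esub> x)"
      by (auto simp: set_add_def' a_r_coset_def')
    moreover have "h \<oplus>\<^bsub>W\<^esub> f b \<in> B'" using calculation B by auto
    ultimately show "y \<in> B' +>\<^bsub>W\<^esub> f x" by (auto simp: eq a_r_coset_def')
  next
    fix y assume "y \<in> B' +>\<^bsub>W\<^esub> f x"
    then obtain h where "h \<in> B'" "y = h \<oplus>\<^bsub>W\<^esub> f x" by (auto simp: a_r_coset_def')
    moreover have "x \<in> B +>\<^bsub>V\<^esub> x" using x by (rule V.a_rcos_self)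
    ultimately show "y \<in> B' <+>\<^bsub>W\<^esub> f ` (B +>\<^bsub>V\<^esub> x)"
      unfolding set_add_def' by (intro UN_I[of h] UN_I[of "f x"]) auto
  qed
qed

text \<open>With the exact image of B as subgroup of the target, the image of a coset is already a
  full coset. This is why an isomorphism can act on quotients by direct image.\<close>

lemma image_coset:
  assumes "abelian_subgroup B V"
    and add: "\<And>x y. x \<in> carrier V \<Longrightarrow> y \<in> carrier V \<Longrightarrow> f (x \<oplus>\<^bsub>V\<^esub> y) = f x \<oplus>\<^bsub>W\<^esub> f y"
    and x: "x \<in> carrier V"
  shows "f ` (B +>\<^bsub>V\<^esub> x) = (f ` B) +>\<^bsub>W\<^esub> f x"
proof -
  interpret V: abelian_subgroup B V by fact
  show ?thesis
    using x add unfolding a_r_coset_def' by (force simp: image_UN)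
qed

section \<open>Quotient spaces, computed on representatives\<close>

lemma quot_space_simps:
  "carrier (quot_space V B) = a_rcosets\<^bsub>V\<^esub> B" "\<zero>\<^bsub>quot_space V B\<^esub> = B"
  "X \<oplus>\<^bsub>quot_space V B\<^esub> Y = X <+>\<^bsub>V\<^esub> Y"
  "c \<odot>\<^bsub>quot_space V B\<^esub> X = B <+>\<^bsub>V\<^esub> ((\<lambda>x. c \<odot>\<^bsub>V\<^esub> x) ` X)"
  by (simp_all add: quot_space_def)

lemma quot_space_cases:
  assumes "X \<in> carrier (quot_space V B)"
  obtains x where "x \<in> carrier V" "X = B +>\<^bsub>V\<^esub> x"
  using assms by (auto simp: quot_space_simps A_RCOSETS_def')

lemma coset_in_quot_space: "x \<in> carrier V \<Longrightarrow> B +>\<^bsub>V\<^esub> x \<in> carrier (quot_space V B)"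
  by (auto simp: quot_space_simps A_RCOSETS_def')

lemma quot_space_coset:
  assumes V: "Module.module complex_ring V" and B: "submodule B complex_ring V"
  shows "x \<in> carrier V \<Longrightarrow> y \<in> carrier V \<Longrightarrow>
      (B +>\<^bsub>V\<^esub> x) \<oplus>\<^bsub>quot_space V B\<^esub> (B +>\<^bsub>V\<^esub> y) = B +>\<^bsub>V\<^esub> (x \<oplus>\<^bsub>V\<^esub> y)"
    and "x \<in> carrier V \<Longrightarrow> c \<odot>\<^bsub>quot_space V B\<^esub> (B +>\<^bsub>V\<^esub> x) = B +>\<^bsub>V\<^esub> (c \<odot>\<^bsub>V\<^esub> x)"
    and "\<zero>\<^bsub>quot_space V B\<^esub> = B +>\<^bsub>V\<^esub> \<zero>\<^bsub>V\<^esub>"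
proof -
  interpret module complex_ring V by (rule V)
  interpret sub: submodule B complex_ring V by (rule B)
  interpret B: abelian_subgroup B V by (rule submodule_abelian_subgroup[OF V B])
  show "x \<in> carrier V \<Longrightarrow> y \<in> carrier V \<Longrightarrow>
      (B +>\<^bsub>V\<^esub> x) \<oplus>\<^bsub>quot_space V B\<^esub> (B +>\<^bsub>V\<^esub> y) = B +>\<^bsub>V\<^esub> (x \<oplus>\<^bsub>V\<^esub> y)"
    by (simp add: quot_space_simps B.a_rcos_sum)
  show "c \<odot>\<^bsub>quot_space V B\<^esub> (B +>\<^bsub>V\<^esub> x) = B +>\<^bsub>V\<^esub> (c \<odot>\<^bsub>V\<^esub> x)" if "x \<in> carrier V"
    unfolding quot_space_simps using that sub.smult_closed
    by (intro set_add_image_coset B.abelian_subgroup_axioms) (auto simp: smult_r_distr)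
  show "\<zero>\<^bsub>quot_space V B\<^esub> = B +>\<^bsub>V\<^esub> \<zero>\<^bsub>V\<^esub>"
    using B.a_subset by (simp add: quot_space_simps)
qed

lemma module_quot_space:
  assumes V: "Module.module complex_ring V" and B: "submodule B complex_ring V"
  shows "Module.module complex_ring (quot_space V B)"
proof -
  interpret module complex_ring V by (rule V)
  interpret B: abelian_subgroup B V by (rule submodule_abelian_subgroup[OF V B])
  note coset = quot_space_coset[OF V B]
  have "abelian_group (quot_space V B)"
  proof (rule abelian_groupI)
    fix X Y Z
    assume "X \<in> carrier (quot_space V B)"
    then obtain x where x: "x \<in> carrier V" "X = B +>\<^bsub>V\<^esub> x" by (rule quot_space_cases)
    show "\<zero>\<^bsub>quot_space V B\<^esub> \<oplus>\<^bsub>quot_space V B\<^esub> X = X"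
      using x by (simp add: coset(1,3))
    show "\<exists>Y\<in>carrier (quot_space V B). Y \<oplus>\<^bsub>quot_space V B\<^esub> X = \<zero>\<^bsub>quot_space V B\<^esub>"
      using x by (intro bexI[of _ "B +>\<^bsub>V\<^esub> (\<ominus>\<^bsub>V\<^esub> x)"]) (simp_all add: coset(1,3) M.l_neg coset_in_quot_space)
    assume "Y \<in> carrier (quot_space V B)"
    then obtain y where y: "y \<in> carrier V" "Y = B +>\<^bsub>V\<^esub> y" by (rule quot_space_cases)
    show "X \<oplus>\<^bsub>quot_space V B\<^esub> Y \<in> carrier (quot_space V B)"
      using x y by (simp add: coset(1) coset_in_quot_space)
    show "X \<oplus>\<^bsub>quot_space V B\<^esub> Y = Y \<oplus>\<^bsub>quot_space V B\<^esub> X"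
      using x y by (simp add: coset(1) M.a_comm)
    assume "Z \<in> carrier (quot_space V B)"
    then obtain z where "z \<in> carrier V" "Z = B +>\<^bsub>V\<^esub> z" by (rule quot_space_cases)
    then show "X \<oplus>\<^bsub>quot_space V B\<^esub> Y \<oplus>\<^bsub>quot_space V B\<^esub> Z =
        X \<oplus>\<^bsub>quot_space V B\<^esub> (Y \<oplus>\<^bsub>quot_space V B\<^esub> Z)"
      using x y by (simp add: coset(1) M.a_assoc)
  qed (simp add: coset(3) coset_in_quot_space)
  then show ?thesis
  proof (intro moduleI cring_complex_ring)
    fix c c' X Y assume X: "X \<in> carrier (quot_space V B)"
    then obtain x where x: "x \<in> carrier V" "X = B +>\<^bsub>V\<^esub> x" by (rule quot_space_cases)
    show "c \<odot>\<^bsub>quot_space V B\<^esub> X \<in> carrier (quot_space V B)"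
      using x by (simp add: coset coset_in_quot_space)
    show "(c \<oplus>\<^bsub>complex_ring\<^esub> c') \<odot>\<^bsub>quot_space V B\<^esub> X =
        c \<odot>\<^bsub>quot_space V B\<^esub> X \<oplus>\<^bsub>quot_space V B\<^esub> c' \<odot>\<^bsub>quot_space V B\<^esub> X"
      using x smult_l_distr[of c c' x] by (simp add: coset)
    show "(c \<otimes>\<^bsub>complex_ring\<^esub> c') \<odot>\<^bsub>quot_space V B\<^esub> X = c \<odot>\<^bsub>quot_space V B\<^esub> (c' \<odot>\<^bsub>quot_space V B\<^esub> X)"
      using x smult_assoc1[of c c' x] by (simp add: coset)
    show "\<one>\<^bsub>complex_ring\<^esub> \<odot>\<^bsub>quot_space V B\<^esub> X = X"
      using x smult_one[of x] by (simp add: coset)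
    assume "Y \<in> carrier (quot_space V B)"
    then obtain y where y: "y \<in> carrier V" "Y = B +>\<^bsub>V\<^esub> y" by (rule quot_space_cases)
    show "c \<odot>\<^bsub>quot_space V B\<^esub> (X \<oplus>\<^bsub>quot_space V B\<^esub> Y) =
        c \<odot>\<^bsub>quot_space V B\<^esub> X \<oplus>\<^bsub>quot_space V B\<^esub> c \<odot>\<^bsub>quot_space V B\<^esub> Y"
      using x y smult_r_distr[of c x y] by (simp add: coset)
  qed
qed

text \<open>As D commutes with d, the image of D is mapped into the image of D. So
  \<open>quot_d\<close> acts on representatives, and linearity and d d = 0 descend.\<close>

lemma quot_complex_cochain_complex:
  assumes C: "cochain_complex C d" and D: "complex_endo C d D"
    and B: "\<And>n. B n = D ` carrier (C n)"
  shows "cochain_complex (quot_complex C B) (quot_d C B d)"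
    and "\<And>n x. x \<in> carrier (C n) \<Longrightarrow> quot_d C B d n (B n +>\<^bsub>C n\<^esub> x) = B (Suc n) +>\<^bsub>C (Suc n)\<^esub> d n x"
    and "\<And>n. submodule (B n) complex_ring (C n)"
proof -
  have V: "Module.module complex_ring (C n)" and d: "d n \<in> linear_maps (C n) (C (Suc n))" for n
    using C by (simp_all add: cochain_complex_def)
  show sub: "submodule (B n) complex_ring (C n)" for n
    using D unfolding B by (intro submodule_image V) (simp add: complex_endo_def)
  note coset = quot_space_coset[OF V sub]
  note d' = linear_mapsD[OF d]
  show qd: "quot_d C B d n (B n +>\<^bsub>C n\<^esub> x) = B (Suc n) +>\<^bsub>C (Suc n)\<^esub> d n x" if "x \<in> carrier (C n)" for n x
  proof -
    have "d n ` B n \<subseteq> B (Suc n)"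
      using D d'(1) unfolding B complex_endo_def by auto
    then show ?thesis
      unfolding quot_d_def using that d'
      by (intro set_add_image_coset submodule_abelian_subgroup[OF V sub]) auto
  qed
  show "cochain_complex (quot_complex C B) (quot_d C B d)"
    unfolding cochain_complex_def quot_complex_def
  proof (intro allI conjI ballI)
    fix n
    show "Module.module complex_ring (quot_space (C n) (B n))" by (rule module_quot_space[OF V sub])
    show "quot_d C B d n \<in> linear_maps (quot_space (C n) (B n)) (quot_space (C (Suc n)) (B (Suc n)))"
      unfolding linear_maps_def
    proof (intro CollectI conjI funcsetI ballI allI)
      fix X c assume "X \<in> carrier (quot_space (C n) (B n))"
      then obtain x where x: "x \<in> carrier (C n)" "X = B n +>\<^bsub>C n\<^esub> x" by (rule quot_space_cases)
      show "quot_d C B d n X \<in> carrier (quot_space (C (Suc n)) (B (Suc n)))"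
        using x d' by (simp add: qd coset_in_quot_space)
      show "quot_d C B d n (c \<odot>\<^bsub>quot_space (C n) (B n)\<^esub> X) =
          c \<odot>\<^bsub>quot_space (C (Suc n)) (B (Suc n))\<^esub> quot_d C B d n X"
        using x d' module.smult_closed[OF V] by (simp add: qd coset)
      fix Y assume "Y \<in> carrier (quot_space (C n) (B n))"
      then obtain y where y: "y \<in> carrier (C n)" "Y = B n +>\<^bsub>C n\<^esub> y" by (rule quot_space_cases)
      have "x \<oplus>\<^bsub>C n\<^esub> y \<in> carrier (C n)"
        using x y module.axioms(2)[OF V] by (simp add: abelian_groupE(1))
      then show "quot_d C B d n (X \<oplus>\<^bsub>quot_space (C n) (B n)\<^esub> Y) =
          quot_d C B d n X \<oplus>\<^bsub>quot_space (C (Suc n)) (B (Suc n))\<^esub> quot_d C B d n Y"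
        using x y d' by (simp add: qd coset)
    qed
    fix X assume "X \<in> carrier (quot_space (C n) (B n))"
    then obtain x where x: "x \<in> carrier (C n)" "X = B n +>\<^bsub>C n\<^esub> x" by (rule quot_space_cases)
    then show "quot_d C B d (Suc n) (quot_d C B d n X) = \<zero>\<^bsub>quot_space (C (Suc (Suc n))) (B (Suc (Suc n)))\<^esub>"
      using C d' by (simp add: qd coset(3) cochain_complex_def)
  qed
qed

text \<open>An isomorphism that intertwines D and D' identifies their images, so direct image maps
  cosets to cosets; all properties are then read off on representatives.\<close>

lemma complex_iso_quotient:
  assumes iso: "complex_iso C d C' d' \<phi>" and D: "complex_endo C d D" and D': "complex_endo C' d' D'"
    and comm: "\<And>n x. x \<in> carrier (C n) \<Longrightarrow> \<phi> n (D x) = D' (\<phi> n x)"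
    and B: "\<And>n. B n = D ` carrier (C n)" and B': "\<And>n. B' n = D' ` carrier (C' n)"
  shows "complex_iso (quot_complex C B) (quot_d C B d) (quot_complex C' B') (quot_d C' B' d') (\<lambda>n S. \<phi> n ` S)"
    and "x \<in> carrier (C n) \<Longrightarrow> \<phi> n ` (B n +>\<^bsub>C n\<^esub> x) = B' n +>\<^bsub>C' n\<^esub> \<phi> n x"
proof -
  have C: "cochain_complex C d" and C': "cochain_complex C' d'"
    and lin: "\<phi> n \<in> linear_maps (C n) (C' n)" and bij: "bij_betw (\<phi> n) (carrier (C n)) (carrier (C' n))"
    and chain: "x \<in> carrier (C n) \<Longrightarrow> \<phi> (Suc n) (d n x) = d' n (\<phi> n x)" for n x
    using iso by (simp_all add: complex_iso_def)
  have V: "Module.module complex_ring (C n)" and V': "Module.module complex_ring (C' n)"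
    and d: "d n \<in> linear_maps (C n) (C (Suc n))" for n
    using C C' by (simp_all add: cochain_complex_def)
  note Q = quot_complex_cochain_complex[OF C D B] and Q' = quot_complex_cochain_complex[OF C' D' B']
  note coset = quot_space_coset[OF V Q(3)] and coset' = quot_space_coset[OF V' Q'(3)]
  note lin = linear_mapsD[OF lin] and d = linear_mapsD[OF d]
  \<comment> \<open>Surjectivity of \<phi> is essential here: it makes the image of B all of B'
    instead of a part of it.\<close>
  have image_B: "\<phi> n ` B n = B' n" for n
  proof -
    have "\<phi> n ` B n = (\<lambda>x. D' (\<phi> n x)) ` carrier (C n)"
      unfolding B image_image using comm by (intro image_cong) auto
    also have "\<dots> = D' ` (\<phi> n ` carrier (C n))" by (simp only: image_image)
    also have "\<dots> = B' n" unfolding B' using bij[of n] by (simp add: bij_betw_def)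
    finally show ?thesis .
  qed
  have image: "\<phi> n ` (B n +>\<^bsub>C n\<^esub> x) = B' n +>\<^bsub>C' n\<^esub> \<phi> n x" if "x \<in> carrier (C n)" for n x
    unfolding image_B[symmetric]
    using that lin by (intro image_coset submodule_abelian_subgroup[OF V Q(3)]) auto
  then show "x \<in> carrier (C n) \<Longrightarrow> \<phi> n ` (B n +>\<^bsub>C n\<^esub> x) = B' n +>\<^bsub>C' n\<^esub> \<phi> n x" .
  have sub: "X \<subseteq> carrier (C n)" if "X \<in> carrier (quot_space (C n) (B n))" for X n
    using that abelian_subgroup.a_rcosets_carrier[OF submodule_abelian_subgroup[OF V Q(3)]]
    by (simp add: quot_space_simps)
  show "complex_iso (quot_complex C B) (quot_d C B d) (quot_complex C' B') (quot_d C' B' d') (\<lambda>n S. \<phi> n ` S)"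
    unfolding complex_iso_def
  proof (intro conjI allI ballI Q(1) Q'(1))
    fix n
    show "(`) (\<phi> n) \<in> linear_maps (quot_complex C B n) (quot_complex C' B' n)"
      unfolding linear_maps_def quot_complex_def
    proof (intro CollectI conjI funcsetI ballI allI)
      fix X c assume "X \<in> carrier (quot_space (C n) (B n))"
      then obtain x where x: "x \<in> carrier (C n)" "X = B n +>\<^bsub>C n\<^esub> x" by (rule quot_space_cases)
      show "\<phi> n ` X \<in> carrier (quot_space (C' n) (B' n))"
        using x lin by (simp add: image coset_in_quot_space)
      show "\<phi> n ` (c \<odot>\<^bsub>quot_space (C n) (B n)\<^esub> X) = c \<odot>\<^bsub>quot_space (C' n) (B' n)\<^esub> \<phi> n ` X"
        using x lin module.smult_closed[OF V] by (simp add: image coset coset')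
      fix Y assume "Y \<in> carrier (quot_space (C n) (B n))"
      then obtain y where y: "y \<in> carrier (C n)" "Y = B n +>\<^bsub>C n\<^esub> y" by (rule quot_space_cases)
      have "x \<oplus>\<^bsub>C n\<^esub> y \<in> carrier (C n)"
        using x y module.axioms(2)[OF V] by (simp add: abelian_groupE(1))
      then show "\<phi> n ` (X \<oplus>\<^bsub>quot_space (C n) (B n)\<^esub> Y) = \<phi> n ` X \<oplus>\<^bsub>quot_space (C' n) (B' n)\<^esub> \<phi> n ` Y"
        using x y lin by (simp add: image coset coset')
    qed
    show "bij_betw ((`) (\<phi> n)) (carrier (quot_complex C B n)) (carrier (quot_complex C' B' n))"
      unfolding bij_betw_def quot_complex_def
    proof (intro conjI inj_onI subset_antisym[of _ "carrier _"] subsetI)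
      fix X Y assume "X \<in> carrier (quot_space (C n) (B n))" "Y \<in> carrier (quot_space (C n) (B n))" "\<phi> n ` X = \<phi> n ` Y"
      \<comment> \<open>Cosets are subsets of the carrier, and an injective map is injective on
        subsets.\<close>
      then show "X = Y"
        using bij[of n] sub by (metis bij_betw_def inj_on_image_eq_iff)
    next
      fix Y assume "Y \<in> (`) (\<phi> n) ` carrier (quot_space (C n) (B n))"
      then obtain X where X: "X \<in> carrier (quot_space (C n) (B n))" "Y = \<phi> n ` X" by blast
      from X(1) obtain x where "x \<in> carrier (C n)" "X = B n +>\<^bsub>C n\<^esub> x" by (rule quot_space_cases)
      with X(2) show "Y \<in> carrier (quot_space (C' n) (B' n))"
        using lin by (simp add: image coset_in_quot_space)
    next
      fix Y assume "Y \<in> carrier (quot_space (C' n) (B' n))"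
      then obtain y where "y \<in> carrier (C' n)" "Y = B' n +>\<^bsub>C' n\<^esub> y" by (rule quot_space_cases)
      moreover obtain x where "x \<in> carrier (C n)" "\<phi> n x = y"
        using bij[of n] calculation(1) by (metis bij_betw_def imageE)
      ultimately show "Y \<in> (`) (\<phi> n) ` carrier (quot_space (C n) (B n))"
        by (metis image coset_in_quot_space imageI)
    qed
    fix X assume "X \<in> carrier (quot_complex C B n)"
    then obtain x where x: "x \<in> carrier (C n)" "X = B n +>\<^bsub>C n\<^esub> x"
      unfolding quot_complex_def by (rule quot_space_cases)
    then show "\<phi> (Suc n) ` quot_d C B d n X = quot_d C' B' d' n (\<phi> n ` X)"
      using lin d by (simp add: Q(2) Q'(2) image chain)
  qed
qed

section \<open>The isomorphism of complexes\<close>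

text \<open>Through \<open>coeff_transfer\<close>, sesquilinearity and skew-symmetry of sums and
  multiples come from the other side, where only multilinearity and exchanges of entries need
  checking.\<close>

lemma basic_cochains_subspace:
  fixes \<gamma> \<gamma>' :: "'a::del_module list \<Rightarrow> 'm::del_module mpol"
  shows "\<gamma> \<in> basic_cochains n \<Longrightarrow> \<gamma>' \<in> basic_cochains n \<Longrightarrow> (\<lambda>as. \<gamma> as + \<gamma>' as) \<in> basic_cochains n"
    and "\<gamma> \<in> basic_cochains n \<Longrightarrow> (\<lambda>as. c *\<^sub>C \<gamma> as) \<in> basic_cochains n"
    and "(\<lambda>_. 0) \<in> (basic_cochains n :: ('a list \<Rightarrow> 'm mpol) set)"
proof -
  have ce: "coeff_map n \<gamma> \<in> ce_cochains n" if "\<gamma> \<in> basic_cochains n" for \<gamma> :: "'a list \<Rightarrow> 'm mpol"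
    by (rule coeff_map_ce_cochain[OF that])
  show "(\<lambda>as. \<gamma> as + \<gamma>' as) \<in> basic_cochains n" if "\<gamma> \<in> basic_cochains n" "\<gamma>' \<in> basic_cochains n"
    using that ce[OF that(1)] ce[OF that(2)]
    by (intro coeff_transfer(1)[where \<delta> = "\<lambda>xs. coeff_map n \<gamma> xs + coeff_map n \<gamma>' xs"])
      (auto simp: basic_cochainsD mem_ce_cochains_iff vars_below_add coeff_map_gen lookup_add scaleC_add_right
        intro: multilinear_add alternating_add)
  show scale: "(\<lambda>as. c *\<^sub>C \<gamma> as) \<in> basic_cochains n" if "\<gamma> \<in> basic_cochains n" for \<gamma> :: "'a list \<Rightarrow> 'm mpol" and c
    using that ce[OF that]
    by (intro coeff_transfer(1)[where \<delta> = "\<lambda>xs. c *\<^sub>C coeff_map n \<gamma> xs"])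
      (auto simp: basic_cochainsD mem_ce_cochains_iff vars_below_scaleC coeff_map_gen mult.commute alternating_def
        intro: multilinear_scaleC)
  show "(\<lambda>_. 0) \<in> (basic_cochains n :: ('a list \<Rightarrow> 'm mpol) set)"
    by (rule coeff_transfer(1)[where \<delta> = "\<lambda>_. 0"]) (auto simp: vars_below_0 multilinear_zero alternating_def)
qed

text \<open>The reverse passage: sums and multiples of continuous cochains are images of sums and
  multiples of polynomial cochains, which settles finiteness.\<close>

lemma ce_cochains_subspace:
  fixes \<delta> \<epsilon> :: "'a::del_module annih list \<Rightarrow> 'm::del_module"
  shows "\<delta> \<in> ce_cochains n \<Longrightarrow> \<epsilon> \<in> ce_cochains n \<Longrightarrow> (\<lambda>xs. \<delta> xs + \<epsilon> xs) \<in> ce_cochains n"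
    and "\<delta> \<in> ce_cochains n \<Longrightarrow> (\<lambda>xs. c *\<^sub>C \<delta> xs) \<in> ce_cochains n"
    and "(\<lambda>_. 0) \<in> (ce_cochains n :: ('a annih list \<Rightarrow> 'm) set)"
proof -
  show "(\<lambda>xs. \<delta> xs + \<epsilon> xs) \<in> ce_cochains n" if "\<delta> \<in> ce_cochains n" "\<epsilon> \<in> ce_cochains n"
    using coeff_map_ce_cochain[OF basic_cochains_subspace(1)[OF that[THEN poly_map_basic_cochain]]]
    by (simp add: coeff_map_linear coeff_map_poly_map that)
  show scale: "(\<lambda>xs. c *\<^sub>C \<delta> xs) \<in> ce_cochains n" if "\<delta> \<in> ce_cochains n" for \<delta> :: "'a annih list \<Rightarrow> 'm" and c
    using coeff_map_ce_cochain[OF basic_cochains_subspace(2)[OF that[THEN poly_map_basic_cochain]]]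
    by (simp add: coeff_map_linear coeff_map_poly_map that)
  show "(\<lambda>_. 0) \<in> (ce_cochains n :: ('a annih list \<Rightarrow> 'm) set)"
    by (simp add: mem_ce_cochains_iff multilinear_zero alternating_def)
qed

lemma ce_del_linear:
  "ce_del (\<lambda>xs. \<delta> xs + \<epsilon> xs) = (\<lambda>xs. ce_del \<delta> xs + ce_del \<epsilon> xs)"
  "ce_del (\<lambda>xs. c *\<^sub>C \<delta> xs) = (\<lambda>xs. c *\<^sub>C ce_del \<delta> xs)"
  by (simp_all add: fun_eq_iff ce_del_def del_add del_scaleC sum.distrib scaleC.scale_sum_right
      scaleC.scale_right_diff_distrib)

lemma coeff_map_linear_maps: "coeff_map n \<in> linear_maps (basic_complex n) (ce_complex n)"
  by (auto simp: linear_maps_def basic_complex_def ce_complex_def coeff_map_linear coeff_map_ce_cochain)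

text \<open>The way identities in the basic complex are proved: linearity, d d = 0 and commutation
  with \<partial> become identities of \<open>ce_d\<close> and \<open>ce_del\<close> after applying
  \<open>coeff_map\<close> to both sides.\<close>

lemma coeff_map_eqD:
  "coeff_map n \<gamma> = coeff_map n \<gamma>' \<Longrightarrow> \<gamma> \<in> basic_cochains n \<Longrightarrow> \<gamma>' \<in> basic_cochains n \<Longrightarrow> \<gamma> = \<gamma>'"
  by (rule inj_onD[OF inj_on_coeff_map])

context conformal_module
begin

lemma ce_cochain_complex:
  "cochain_complex (ce_complex :: nat \<Rightarrow> (complex, 'a annih list \<Rightarrow> 'm) module) (\<lambda>_. ce_d br act)"
  unfolding cochain_complex_def ce_complex_def
  by (auto simp: linear_maps_def ce_d_closed ce_d_linear ce_d_ce_d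
      intro!: module_fun_space ce_cochains_subspace)

lemma basic_cochain_complex:
  "cochain_complex (basic_complex :: nat \<Rightarrow> (complex, 'a list \<Rightarrow> 'm mpol) module) (\<lambda>_. basic_d br act)"
  unfolding cochain_complex_def basic_complex_def
proof (intro allI conjI ballI)
  fix n
  show "Module.module complex_ring (fun_space (basic_cochains n :: ('a list \<Rightarrow> 'm mpol) set))"
    by (intro module_fun_space basic_cochains_subspace)
  note closed = basic_cochains_subspace coeff_map_basic_d(1)
  have add: "basic_d br act (\<lambda>as. \<gamma> as + \<gamma>' as) = (\<lambda>as. basic_d br act \<gamma> as + basic_d br act \<gamma>' as)"
    if "\<gamma> \<in> basic_cochains n" "\<gamma>' \<in> basic_cochains n" for \<gamma> \<gamma>' :: "'a list \<Rightarrow> 'm mpol"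
    using that
    by (intro coeff_map_eqD[of "Suc n"] closed)
      (simp_all add: coeff_map_basic_d(2) closed coeff_map_linear ce_d_linear)
  have scale: "basic_d br act (\<lambda>as. c *\<^sub>C \<gamma> as) = (\<lambda>as. c *\<^sub>C basic_d br act \<gamma> as)"
    if "\<gamma> \<in> basic_cochains n" for \<gamma> :: "'a list \<Rightarrow> 'm mpol" and c
    using that
    by (intro coeff_map_eqD[of "Suc n"] closed)
      (simp_all add: coeff_map_basic_d(2) closed coeff_map_linear ce_d_linear)
  show "basic_d br act \<in> linear_maps (fun_space (basic_cochains n)) (fun_space (basic_cochains (Suc n)))"
    by (auto simp: linear_maps_def closed add scale)
  have zero: "coeff_map (Suc (Suc n)) (\<lambda>_ :: 'a list. 0 :: 'm mpol) = (\<lambda>_. 0)"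
    using coeff_map_linear(2)[of "Suc (Suc n)" 0 "\<lambda>_ :: 'a list. 0 :: 'm mpol"] by simp
  show "basic_d br act (basic_d br act \<gamma>) = \<zero>\<^bsub>fun_space (basic_cochains (Suc (Suc n)))\<^esub>"
    if "\<gamma> \<in> carrier (fun_space (basic_cochains n))" for \<gamma> :: "'a list \<Rightarrow> 'm mpol"
    using that ce_d_ce_d[OF coeff_map_ce_cochain[of \<gamma> n]] unfolding fun_space_simps
    by (intro coeff_map_eqD[of "Suc (Suc n)"] closed)
      (simp_all add: coeff_map_basic_d(2) closed zero)
qed

lemma coeff_map_complex_iso:
  "complex_iso basic_complex (\<lambda>_. basic_d br act) ce_complex (\<lambda>_. ce_d br act) coeff_map"
  unfolding complex_iso_def
  using basic_cochain_complex ce_cochain_complex coeff_map_linear_maps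
  by (auto simp: basic_complex_def ce_complex_def bij_betw_coeff_map coeff_map_basic_d(2))

lemma ce_del_complex_endo:
  "complex_endo (ce_complex :: nat \<Rightarrow> (complex, 'a annih list \<Rightarrow> 'm) module) (\<lambda>_. ce_d br act) ce_del"
  by (auto simp: complex_endo_def linear_maps_def ce_complex_def ce_del_closed ce_del_linear ce_d_del)

lemma basic_del_complex_endo:
  "complex_endo (basic_complex :: nat \<Rightarrow> (complex, 'a list \<Rightarrow> 'm mpol) module) (\<lambda>_. basic_d br act) basic_del"
  unfolding complex_endo_def basic_complex_def linear_maps_def
proof (intro allI conjI ballI CollectI funcsetI)
  note closed = basic_cochains_subspace coeff_map_basic_d(1) coeff_map_basic_del(1)
  note coeff = coeff_map_basic_d(2) coeff_map_basic_del(2) closed coeff_map_linear ce_del_linear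
  fix n c and \<gamma> \<gamma>' :: "'a list \<Rightarrow> 'm mpol"
  assume "\<gamma> \<in> carrier (fun_space (basic_cochains n))"
  then have \<gamma>: "\<gamma> \<in> basic_cochains n" by simp
  show "basic_del \<gamma> \<in> carrier (fun_space (basic_cochains n))"
    using \<gamma> by (simp add: closed)
  show "basic_del (c \<odot>\<^bsub>fun_space (basic_cochains n)\<^esub> \<gamma>) = c \<odot>\<^bsub>fun_space (basic_cochains n)\<^esub> basic_del \<gamma>"
    unfolding fun_space_simps using \<gamma>
    by (intro coeff_map_eqD[of n] closed) (simp_all add: coeff)
  show "basic_d br act (basic_del \<gamma>) = basic_del (basic_d br act \<gamma>)"
    using \<gamma> by (intro coeff_map_eqD[of "Suc n"] closed)
      (simp_all add: coeff ce_d_del[of _ n] coeff_map_ce_cochain ce_del_closed)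
  assume "\<gamma>' \<in> carrier (fun_space (basic_cochains n))"
  then show "basic_del (\<gamma> \<oplus>\<^bsub>fun_space (basic_cochains n)\<^esub> \<gamma>') =
      basic_del \<gamma> \<oplus>\<^bsub>fun_space (basic_cochains n)\<^esub> basic_del \<gamma>'"
    unfolding fun_space_simps using \<gamma>
    by (intro coeff_map_eqD[of n] closed) (simp_all add: coeff)
qed

end

theorem theorem6p1:
  fixes br :: "'a::del_module \<Rightarrow> 'a \<Rightarrow> (nat \<Rightarrow>\<^sub>0 'a)"
    and act :: "'a \<Rightarrow> 'm::del_module \<Rightarrow> (nat \<Rightarrow>\<^sub>0 'm)"
  assumes "lie_conformal_algebra br"
    and "conformal_module br act"
  shows "\<exists>\<phi> :: nat \<Rightarrow> ('a list \<Rightarrow> 'm mpol) \<Rightarrow> ('a annih list \<Rightarrow> 'm).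
    complex_iso basic_complex (\<lambda>_. basic_d br act) ce_complex (\<lambda>_. ce_d br act) \<phi> \<and>
    complex_endo basic_complex (\<lambda>_. basic_d br act) basic_del \<and>
    complex_endo ce_complex (\<lambda>_. ce_d br act) ce_del \<and>
    (\<forall>n. \<forall>\<gamma> \<in> basic_cochains n. \<phi> n (basic_del \<gamma>) = ce_del (\<phi> n \<gamma>)) \<and>
    (\<forall>n. \<forall>\<gamma> \<in> basic_cochains n. \<forall>as ms. length as = n \<longrightarrow> length ms = n \<longrightarrow>
      \<phi> n \<gamma> (map2 gen as ms) =
        (\<Prod>m\<leftarrow>ms. fact m) *\<^sub>C Poly_Mapping.lookup (\<gamma> as) (Poly_Mapping.nth ms)) \<and>
    (\<exists>\<psi>. complex_iso
        (quot_complex basic_complex basic_boundaries)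
        (quot_d basic_complex basic_boundaries (\<lambda>_. basic_d br act))
        (quot_complex ce_complex ce_boundaries)
        (quot_d ce_complex ce_boundaries (\<lambda>_. ce_d br act)) \<psi> \<and>
      (\<forall>n. \<forall>\<gamma> \<in> basic_cochains n.
        \<psi> n (basic_boundaries n +>\<^bsub>basic_complex n\<^esub> \<gamma>) =
          ce_boundaries n +>\<^bsub>ce_complex n\<^esub> \<phi> n \<gamma>))"
proof -
  interpret conformal_module br act by fact
  \<comment> \<open>The isomorphism of the reduced complexes is direct image under
    \<open>coeff_map\<close>; the second part of this fact gives its value on the coset of a
    cochain.\<close>
  note quotient = complex_iso_quotient[OF coeff_map_complex_iso basic_del_complex_endo ce_del_complex_endo,
      where B = basic_boundaries and B' = ce_boundaries]
  have Q: "complex_iso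
        (quot_complex basic_complex basic_boundaries)
        (quot_d basic_complex basic_boundaries (\<lambda>_. basic_d br act))
        (quot_complex ce_complex ce_boundaries)
        (quot_d ce_complex ce_boundaries (\<lambda>_. ce_d br act)) (\<lambda>n S. coeff_map n ` S)"
    by (rule quotient(1))
      (simp_all add: basic_complex_def ce_complex_def coeff_map_basic_del(2) basic_boundaries_def ce_boundaries_def)
  have coset: "coeff_map n ` (basic_boundaries n +>\<^bsub>basic_complex n\<^esub> \<gamma>) = ce_boundaries n +>\<^bsub>ce_complex n\<^esub> coeff_map n \<gamma>"
    if "\<gamma> \<in> basic_cochains n" for n and \<gamma> :: "'a list \<Rightarrow> 'm mpol"
    by (rule quotient(2))
      (simp_all add: that basic_complex_def ce_complex_def coeff_map_basic_del(2) basic_boundaries_def ce_boundaries_def)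
  show ?thesis
    using coeff_map_complex_iso basic_del_complex_endo ce_del_complex_endo Q coset
    by (intro exI[of _ coeff_map] conjI exI[of _ "\<lambda>n S. coeff_map n ` S"])
      (simp_all add: coeff_map_basic_del(2) coeff_map_gen)
qed

end
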